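(* Let $r,l,m,n$ be positive integers with $r<n\le m$, $n>36r$, $l>22(r-1)$, and $r\le l<\min(m,n)$. Let $\sigma_1\ge\sigma_2\ge\dots\ge\sigma_n\ge0$ be constants with $\sigma_r>0$, and let $$\Sigma_r=\operatorname{diag}(\sigma_j)_{j=1}^r,\qquad \Sigma_\perp=\begin{bmatrix}\operatorname{diag}(\sigma_j)_{j=r+1}^n\\ O_{m-n,n-r}\end{bmatrix}\in\mathbb R^{(m-r)\times(n-r)} .$$ Let $G$ be an $r\times n$ Gaussian matrix, let $Q\in\mathbb R^{n\times r}$ and $Q_\perp\in\mathbb R^{n\times(n-r)}$ be matrices whose columns form orthonormal bases of the row space of $G$ and of its orthogonal complement, respectively, let $U\in\mathbb R^{m\times m}$ be a matrix with orthonormal columns, and let $$M=U\begin{bmatrix}\Sigma_r&0\\0&\Sigma_\perp\end{bmatrix}\begin{bmatrix}Q^*\\Q_\perp^*\end{bmatrix}.$$ Let $H\in\mathbb R^{n\times l}$ be a constant matrix, let $T$ be a nonsingular $l\times l$ matrix, and let $X:=MHT^{-1}$, $Y:=X^+M$. (i) If $H$ has orthonormal columns, then $$|||M-XY|||\,/\,\tau_{r+1}(M)\le\sqrt{1+16n/l}$$ with a probability no less than $1-\exp(-\frac n{72})-\exp(-\frac{l-r}{20})$. (ii) If $H$ has full rank $l$, then $$|||M-XY|||\,/\,\tau_{r+1}(M)\le\sqrt{1+16\kappa^2(H)n/l}$$ with a probability no less than $1-\exp(-\frac n{72})-\exp(-\frac{l-r}{20})$.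
   Context: All matrices are real, and $A^*$ is the transpose of $A$. A Gaussian matrix is one filled with independent identically distributed standard normal random variables; constant matrices are non-random. $|||\cdot|||$ denotes either the spectral norm or the Frobenius norm (the claim is for each of them). $\tau_{r+1}(M):=\min_{N:\,\operatorname{rank}(N)\le r}|||M-N|||$, i.e. $\sigma_{r+1}(M)$ for the spectral norm and $\sqrt{\sum_{j>r}\sigma_j^2(M)}$ for the Frobenius norm, where $\sigma_j(M)$ is the $j$-th largest singular value of $M$. An inequality $a/\tau_{r+1}(M)\le b$ is read as $a\le b\,\tau_{r+1}(M)$. $A^+$ is the Moore–Penrose pseudo inverse, and $\kappa(H)=\|H\|\,\|H^+\|$ in the spectral norm. $X,Y$ are the output of the paper's Range Finder (column sketching) algorithm applied to $M$ with test matrix $H$. *)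

theory Defs
  imports "HOL-Probability.Probability" "Jordan_Normal_Form.DL_Rank"
    "Jordan_Normal_Form.Gauss_Jordan_Elimination"
begin

abbreviation mat_rank :: "real mat \<Rightarrow> nat" where
  "mat_rank A \<equiv> vec_space.rank (dim_row A) A"

definition euclid_norm :: "real Matrix.vec \<Rightarrow> real" where
  "euclid_norm v = sqrt (scalar_prod v v)"

definition spectral_norm :: "real mat \<Rightarrow> real" where
  "spectral_norm A =
     Sup {euclid_norm (A *\<^sub>v v) | v. v \<in> carrier_vec (dim_col A) \<and> euclid_norm v \<le> 1}"

definition frobenius_norm :: "real mat \<Rightarrow> real" where
  "frobenius_norm A = sqrt (\<Sum>i<dim_row A. \<Sum>j<dim_col A. (A $$ (i, j))\<^sup>2)"

text \<open>The infimum below is a minimum for the spectral and for the Frobenius norm, because the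
  matrices of rank less than \<open>k\<close> form a closed set. The paper's \<open>\<tau>\<^sub>r\<^sub>+\<^sub>1\<close> is
  \<open>tau nrm (r + 1)\<close>.\<close>

definition tau :: "(real mat \<Rightarrow> real) \<Rightarrow> nat \<Rightarrow> real mat \<Rightarrow> real" where
  "tau nrm k M = Inf {nrm (M - N) | N. N \<in> carrier_mat (dim_row M) (dim_col M) \<and> mat_rank N < k}"

text \<open>The four Penrose conditions.\<close>

definition is_pseudo_inverse :: "real mat \<Rightarrow> real mat \<Rightarrow> bool" where
  "is_pseudo_inverse A B \<longleftrightarrow> B \<in> carrier_mat (dim_col A) (dim_row A) \<and>
     A * B * A = A \<and> B * A * B = B \<and>
     transpose_mat (A * B) = A * B \<and> transpose_mat (B * A) = B * A"

definition pseudo_inverse :: "real mat \<Rightarrow> real mat" where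
  "pseudo_inverse A = (THE B. is_pseudo_inverse A B)"

definition cond_number :: "real mat \<Rightarrow> real" where
  "cond_number A = spectral_norm A * spectral_norm (pseudo_inverse A)"

definition orthonormal_columns :: "real mat \<Rightarrow> bool" where
  "orthonormal_columns A \<longleftrightarrow> (\<forall>i<dim_col A. \<forall>j<dim_col A.
     scalar_prod (Matrix.col A i) (Matrix.col A j) = (if i = j then 1 else 0))"

definition columns_orthonormal_basis :: "real mat \<Rightarrow> real Matrix.vec set \<Rightarrow> bool" where
  "columns_orthonormal_basis A S \<longleftrightarrow>
     orthonormal_columns A \<and> vec_space.col_space (dim_row A) A = S"

definition (in prob_space) gaussian_matrix :: "nat \<Rightarrow> nat \<Rightarrow> ('a \<Rightarrow> real mat) \<Rightarrow> bool" where
  "gaussian_matrix p q G \<longleftrightarrow>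
     (\<forall>\<omega>\<in>space M. G \<omega> \<in> carrier_mat p q) \<and>
     (\<forall>i<p. \<forall>j<q. distributed M lborel (\<lambda>\<omega>. G \<omega> $$ (i, j)) std_normal_density) \<and>
     indep_vars (\<lambda>_. borel) (\<lambda>ij \<omega>. G \<omega> $$ ij) ({..<p} \<times> {..<q})"

text \<open>The events considered may depend on factors that are arbitrary, possibly non-measurable,
  functions of the outcome. So we ask for a measurable event of probability at least \<open>p\<close> on which
  \<open>C\<close> holds; if \<open>{\<omega> \<in> space M. C \<omega>}\<close> is itself an event, this says that its probability is
  at least \<open>p\<close>.\<close>

definition (in prob_space) holds_with_prob_at_least :: "real \<Rightarrow> ('a \<Rightarrow> bool) \<Rightarrow> bool" where
  "holds_with_prob_at_least p C \<longleftrightarrow> (\<exists>E\<in>events. (\<forall>\<omega>\<in>E. C \<omega>) \<and> p \<le> prob E)"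

lemma (in prob_space) holds_with_prob_at_least_iff:
  assumes "{\<omega> \<in> space M. C \<omega>} \<in> events"
  shows "holds_with_prob_at_least p C \<longleftrightarrow> p \<le> \<P>(\<omega> in M. C \<omega>)"
proof
  assume "holds_with_prob_at_least p C"
  then obtain E where E: "E \<in> events" "\<And>\<omega>. \<omega> \<in> E \<Longrightarrow> C \<omega>" "p \<le> prob E"
    unfolding holds_with_prob_at_least_def by metis
  have "E \<subseteq> {\<omega> \<in> space M. C \<omega>}"
    using E(2) sets.sets_into_space[OF E(1)] by (simp add: subset_iff)
  from finite_measure_mono[OF this assms] E(3) show "p \<le> \<P>(\<omega> in M. C \<omega>)"
    by linarith
next
  assume p: "p \<le> \<P>(\<omega> in M. C \<omega>)"
  show "holds_with_prob_at_least p C"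
    unfolding holds_with_prob_at_least_def
    by (rule bexI[OF _ assms], rule conjI, simp, rule p)
qed

definition Sigma_lead :: "nat \<Rightarrow> (nat \<Rightarrow> real) \<Rightarrow> real mat" where
  "Sigma_lead r \<sigma> = mat_diag r (\<lambda>j. \<sigma> (j + 1))"

definition Sigma_perp :: "nat \<Rightarrow> nat \<Rightarrow> nat \<Rightarrow> (nat \<Rightarrow> real) \<Rightarrow> real mat" where
  "Sigma_perp r m n \<sigma> = mat_diag (n - r) (\<lambda>j. \<sigma> (r + j + 1)) @\<^sub>r 0\<^sub>m (m - n) (n - r)"

end

theory Submission
  imports Defs
begin

text \<open>
  Let \<open>P = X X\<^sup>+\<close> be the orthogonal projector onto the range of \<open>X\<close>, which is the range of \<open>M H\<close>; the error is
  \<open>(1 - P) M\<close>. In part (ii), \<open>H\<close> may be replaced by a matrix \<open>Z = H S\<close> with orthonormal columns and the same range,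
  and \<open>\<kappa>(H) \<ge> 1\<close> makes the claim weaker than the bound without \<open>\<kappa>(H)\<close>. So both parts concern a fixed
  \<open>n \<times> l\<close> matrix \<open>Z\<close> with orthonormal columns.

  The deterministic half is \<open>low_rank_error_bound\<close>. Let \<open>F\<close> be a right inverse of \<open>Q\<^sup>T Z\<close>. Since
  \<open>(1 - P) M Z = 0\<close>, the error equals \<open>(1 - P) M J\<close> with \<open>J = 1 - Z F Q\<^sup>T\<close>. As \<open>Q\<^sup>T J = 0\<close>, the leading singular
  values of \<open>M\<close> drop out, and what remains has norm at most \<open>sqrt (1 + |F|\<^sup>2)\<close> times the norm of the tail
  \<open>diag (\<sigma>\<^sub>j)\<^sub>j\<^sub>>\<^sub>r\<close>. The latter is at most \<open>\<tau>\<^sub>r\<^sub>+\<^sub>1(M)\<close> by the lower bound of the Eckart-Young theorem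
  (\<open>nrm_rect_diag_le_tau\<close>). Writing \<open>G = R Q\<^sup>T\<close> one finds an \<open>F\<close> whose norm is at most the norm of \<open>G\<close> divided by
  the least singular value of \<open>G Z\<close> (\<open>oblique_factor_exists\<close>), and this no longer mentions \<open>Q\<close>.

  It remains to see (\<open>gaussian_conditioning\<close>) that, except with the allowed probability, the norm of \<open>G\<close> is at most
  \<open>4/3 * sqrt n\<close> and the least singular value of \<open>G Z\<close> is at least \<open>sqrt l / 3\<close>. For a fixed vector \<open>x\<close> the
  quotient \<open>|(G Z)\<^sup>T x|\<^sup>2 / |x|\<^sup>2\<close> is a chi-square variable with \<open>l\<close> degrees of freedom, so its Laplace transform is
  explicit (\<open>chi_square_directions_gaussian\<close>). To treat all \<open>x\<close> at once, the exponential of a multiple of this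
  quotient is integrated over \<open>x\<close> with a Gaussian weight. The mean of the integral is explicit by Fubini,
  while one direction with an exceptional quotient forces the integral to be large, because neighbouring
  vectors are then exceptional as well; Markov's inequality does the rest (\<open>image_sqn_le_with_prob\<close>,
  \<open>image_sqn_ge_with_prob\<close>). The cost of passing from one direction to all is exponential in \<open>r\<close> only, and the
  assumptions \<open>n > 36 r\<close> and \<open>l > 22 (r - 1)\<close> make it affordable.
\<close>

section \<open>Gaussian integrals over product measures\<close>

lemma nn_integral_exp_quadratic:
  fixes a c :: real
  assumes "0 < a"
  shows "(\<integral>\<^sup>+x. ennreal (exp (c * x - a / 2 * x\<^sup>2)) \<partial>lborel) =
    ennreal (sqrt (2 * pi / a) * exp (c\<^sup>2 / (2 * a)))"
proof -
  have eq: "exp (c * x - a / 2 * x\<^sup>2) =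
      (sqrt (2 * pi / a) * exp (c\<^sup>2 / (2 * a))) * normal_density (c / a) (1 / sqrt a) x" for x
  proof -
    have "sqrt (2 * pi / a) * normal_density (c / a) (1 / sqrt a) x = exp (- (a / 2 * (x - c / a)\<^sup>2))"
      using assms by (simp add: normal_density_def power_divide real_sqrt_divide real_sqrt_mult)
    moreover have "c * x - a / 2 * x\<^sup>2 = c\<^sup>2 / (2 * a) + - (a / 2 * (x - c / a)\<^sup>2)"
      using assms by (simp add: field_simps power2_eq_square)
    ultimately show ?thesis
      by (simp only: exp_add) (simp add: mult_ac)
  qed
  have "(\<integral>\<^sup>+x. ennreal (normal_density (c / a) (1 / sqrt a) x) \<partial>lborel) = 1"
    using assms by (subst nn_integral_eq_integral) auto
  then show ?thesis
    unfolding eq using assms by (simp add: ennreal_mult nn_integral_cmult)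
qed

lemma nn_integral_exp_quadratic_PiM:
  fixes a :: real and c :: "'i \<Rightarrow> real"
  assumes "0 < a" "finite I"
  shows "(\<integral>\<^sup>+x. ennreal (exp ((\<Sum>i\<in>I. c i * x i) - a / 2 * (\<Sum>i\<in>I. (x i)\<^sup>2))) \<partial>PiM I (\<lambda>_. lborel)) =
    ennreal (sqrt (2 * pi / a) ^ card I * exp ((\<Sum>i\<in>I. (c i)\<^sup>2) / (2 * a)))"
proof -
  interpret product_sigma_finite "\<lambda>_::'i. lborel :: real measure"
    by standard
  have "(\<integral>\<^sup>+x. ennreal (exp ((\<Sum>i\<in>I. c i * x i) - a / 2 * (\<Sum>i\<in>I. (x i)\<^sup>2))) \<partial>PiM I (\<lambda>_. lborel))
      = (\<integral>\<^sup>+x. (\<Prod>i\<in>I. ennreal (exp (c i * x i - a / 2 * (x i)\<^sup>2))) \<partial>PiM I (\<lambda>_. lborel))"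
    using assms by (simp add: prod_ennreal exp_sum[symmetric] sum_subtractf sum_distrib_left)
  also have "\<dots> = (\<Prod>i\<in>I. \<integral>\<^sup>+t. ennreal (exp (c i * t - a / 2 * t\<^sup>2)) \<partial>lborel)"
    using assms by (subst product_nn_integral_prod) auto
  also have "\<dots> = ennreal (\<Prod>i\<in>I. sqrt (2 * pi / a) * exp ((c i)\<^sup>2 / (2 * a)))"
    using assms by (simp only: nn_integral_exp_quadratic) (simp add: prod_ennreal)
  also have "(\<Prod>i\<in>I. sqrt (2 * pi / a) * exp ((c i)\<^sup>2 / (2 * a))) =
      sqrt (2 * pi / a) ^ card I * exp ((\<Sum>i\<in>I. (c i)\<^sup>2) / (2 * a))"
    using assms by (simp add: prod.distrib exp_sum sum_divide_distrib)
  finally show ?thesis .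
qed

lemma nn_integral_exp_shifted_square_PiM:
  fixes a :: real and v :: "'i \<Rightarrow> real"
  assumes "0 < a" "finite I"
  shows "(\<integral>\<^sup>+x. ennreal (exp (- (a / 2) * (\<Sum>i\<in>I. (x i - v i)\<^sup>2))) \<partial>PiM I (\<lambda>_. lborel)) =
    ennreal (sqrt (2 * pi / a) ^ card I)"
proof -
  let ?V = "\<Sum>i\<in>I. (v i)\<^sup>2"
  have eq: "exp (- (a / 2) * (\<Sum>i\<in>I. (x i - v i)\<^sup>2)) =
      exp (- (a / 2) * ?V) * exp ((\<Sum>i\<in>I. (a * v i) * x i) - a / 2 * (\<Sum>i\<in>I. (x i)\<^sup>2))" for x
    by (simp add: power2_diff sum.distrib sum_subtractf sum_distrib_left sum_negf algebra_simps
        flip: exp_add sum_divide_distrib)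
  have sq: "(\<Sum>i\<in>I. (a * v i)\<^sup>2) / (2 * a) = a / 2 * ?V"
    using assms by (simp add: power_mult_distrib power2_eq_square[of a] flip: sum_distrib_left)
  have "(\<integral>\<^sup>+x. ennreal (exp (- (a / 2) * (\<Sum>i\<in>I. (x i - v i)\<^sup>2))) \<partial>PiM I (\<lambda>_. lborel)) =
      ennreal (exp (- (a / 2) * ?V)) *
        ennreal (sqrt (2 * pi / a) ^ card I * exp ((\<Sum>i\<in>I. (a * v i)\<^sup>2) / (2 * a)))"
    unfolding eq by (subst nn_integral_exp_quadratic_PiM[OF assms, symmetric])
      (simp add: ennreal_mult' nn_integral_cmult)
  also have "\<dots> = ennreal (sqrt (2 * pi / a) ^ card I)"
    using assms by (simp only: sq ennreal_mult'[symmetric] exp_ge_zero) (simp add: exp_minus)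
  finally show ?thesis .
qed

lemma measure_preserving_reflection_PiM:
  fixes v :: "'i \<Rightarrow> real"
  assumes "finite I"
  shows "distr (PiM I (\<lambda>_. lborel)) (PiM I (\<lambda>_. lborel)) (\<lambda>x. \<lambda>i\<in>I. 2 * v i - x i) = PiM I (\<lambda>_. lborel)"
proof -
  interpret product_sigma_finite "\<lambda>_::'i. lborel :: real measure"
    by standard
  let ?T = "\<lambda>x. \<lambda>i\<in>I. 2 * v i - x i"
  have T[measurable]: "?T \<in> PiM I (\<lambda>_. lborel) \<rightarrow>\<^sub>M PiM I (\<lambda>_. lborel)"
    by measurable
  have refl: "distr lborel lborel (\<lambda>t. c - t) = (lborel :: real measure)" for c :: real
  proof -
    have "lborel = density (distr lborel borel (\<lambda>x. c + (-1) * x)) (\<lambda>_. ennreal \<bar>-1::real\<bar>)"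
      by (rule lborel_real_affine) simp
    then show ?thesis
      by (simp add: density_1 cong: distr_cong)
  qed
  show ?thesis
  proof (rule PiM_eqI)
    fix A :: "'i \<Rightarrow> real set" assume A: "\<And>i. i \<in> I \<Longrightarrow> A i \<in> sets lborel"
    have "?T -` Pi\<^sub>E I A \<inter> space (PiM I (\<lambda>_. lborel)) = Pi\<^sub>E I (\<lambda>i. (\<lambda>t. 2 * v i - t) -` A i)"
      by (auto simp: space_PiM PiE_iff extensional_def)
    then have "emeasure (distr (PiM I (\<lambda>_. lborel)) (PiM I (\<lambda>_. lborel)) ?T) (Pi\<^sub>E I A) =
        emeasure (PiM I (\<lambda>_. lborel)) (Pi\<^sub>E I (\<lambda>i. (\<lambda>t. 2 * v i - t) -` A i))"
      using A assms by (simp add: emeasure_distr)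
    also have "\<dots> = (\<Prod>i\<in>I. emeasure lborel ((\<lambda>t. 2 * v i - t) -` A i))"
    proof (subst emeasure_PiM)
      show "(\<lambda>t. 2 * v i - t) -` A i \<in> sets lborel" if "i \<in> I" for i
        using measurable_sets[of "\<lambda>t. 2 * v i - t" lborel lborel "A i"] A[OF that] by simp
    qed (use assms in auto)
    also have "\<dots> = (\<Prod>i\<in>I. emeasure (distr lborel lborel (\<lambda>t. 2 * v i - t)) (A i))"
      using A by (intro prod.cong) (auto simp: emeasure_distr)
    also have "\<dots> = (\<Prod>i\<in>I. emeasure lborel (A i))"
      by (simp add: refl)
    finally show "emeasure (distr (PiM I (\<lambda>_. lborel)) (PiM I (\<lambda>_. lborel)) ?T) (Pi\<^sub>E I A) =
      (\<Prod>i\<in>I. emeasure lborel (A i))" .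
  qed (use assms in auto)
qed

section \<open>Squared lengths of orthonormal projections of a Gaussian vector\<close>

text \<open>The moment generating function of a standard Gaussian vector; the characteristic function follows.
  Exponentials of linear forms are treated first because they factorise over the independent entries
  in every direction, which exponentials of quadratic forms do not.\<close>

lemma (in prob_space) nn_integral_exp_linear_std_normal:
  fixes \<xi> :: "'i \<Rightarrow> 'a \<Rightarrow> real"
  assumes "finite I" and indep: "indep_vars (\<lambda>_. borel) \<xi> I"
    and normal: "\<And>i. i \<in> I \<Longrightarrow> distributed M lborel (\<xi> i) std_normal_density"
  shows "(\<integral>\<^sup>+\<omega>. ennreal (exp (\<Sum>i\<in>I. c i * \<xi> i \<omega>)) \<partial>M) = ennreal (exp ((\<Sum>i\<in>I. (c i)\<^sup>2) / 2))"
proof -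
  have one: "(\<integral>\<^sup>+\<omega>. ennreal (exp (c i * \<xi> i \<omega>)) \<partial>M) = ennreal (exp ((c i)\<^sup>2 / 2))" if "i \<in> I" for i
  proof -
    have "(\<integral>\<^sup>+\<omega>. ennreal (exp (c i * \<xi> i \<omega>)) \<partial>M) =
        (\<integral>\<^sup>+t. ennreal (std_normal_density t) * ennreal (exp (c i * t)) \<partial>lborel)"
      by (rule distributed_nn_integral[OF normal[OF that], symmetric]) simp
    also have "\<dots> = (\<integral>\<^sup>+t. ennreal (1 / sqrt (2 * pi)) * ennreal (exp (c i * t - 1 / 2 * t\<^sup>2)) \<partial>lborel)"
      by (intro nn_integral_cong) (simp add: std_normal_density_def exp_diff exp_minus field_simps flip: ennreal_mult exp_add)
    also have "\<dots> = ennreal (exp ((c i)\<^sup>2 / 2))"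
      using nn_integral_exp_quadratic[of 1 "c i"]
      by (subst nn_integral_cmult) (auto simp flip: ennreal_mult)
    finally show ?thesis .
  qed
  have "(\<integral>\<^sup>+\<omega>. ennreal (exp (\<Sum>i\<in>I. c i * \<xi> i \<omega>)) \<partial>M) = (\<integral>\<^sup>+\<omega>. (\<Prod>i\<in>I. ennreal (exp (c i * \<xi> i \<omega>))) \<partial>M)"
    using assms by (simp add: exp_sum prod_ennreal)
  also have "\<dots> = (\<Prod>i\<in>I. \<integral>\<^sup>+\<omega>. ennreal (exp (c i * \<xi> i \<omega>)) \<partial>M)"
  proof (rule indep_vars_nn_integral)
    show "indep_vars (\<lambda>_. borel) (\<lambda>i \<omega>. ennreal (exp (c i * \<xi> i \<omega>))) I"
      by (rule indep_vars_compose2[OF indep]) simp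
  qed (use assms in auto)
  also have "\<dots> = ennreal (exp ((\<Sum>i\<in>I. (c i)\<^sup>2) / 2))"
    using assms by (simp add: one prod_ennreal exp_sum sum_divide_distrib)
  finally show ?thesis .
qed

lemma (in prob_space) integral_iexp_linear_std_normal:
  fixes \<xi> :: "'i \<Rightarrow> 'a \<Rightarrow> real"
  assumes "finite I" and indep: "indep_vars (\<lambda>_. borel) \<xi> I"
    and normal: "\<And>i. i \<in> I \<Longrightarrow> distributed M lborel (\<xi> i) std_normal_density"
  shows "(\<integral>\<omega>. iexp (\<Sum>i\<in>I. c i * \<xi> i \<omega>) \<partial>M) = complex_of_real (exp (- (\<Sum>i\<in>I. (c i)\<^sup>2) / 2))"
proof -
  have one: "(\<integral>\<omega>. iexp (c i * \<xi> i \<omega>) \<partial>M) = complex_of_real (exp (- (c i)\<^sup>2 / 2))" if "i \<in> I" for i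
  proof -
    have "(\<integral>\<omega>. iexp (c i * \<xi> i \<omega>) \<partial>M) = char (distr M lborel (\<xi> i)) (c i)"
      unfolding char_def using distributed_measurable[OF normal[OF that]]
      by (subst integral_distr) auto
    also have "\<dots> = char std_normal_distribution (c i)"
      using distributed_distr_eq_density[OF normal[OF that]] by simp
    finally show ?thesis
      by (simp add: char_std_normal_distribution)
  qed
  have "(\<integral>\<omega>. iexp (\<Sum>i\<in>I. c i * \<xi> i \<omega>) \<partial>M) = (\<integral>\<omega>. (\<Prod>i\<in>I. iexp (c i * \<xi> i \<omega>)) \<partial>M)"
    using assms by (simp add: exp_sum sum_distrib_left)
  also have "\<dots> = (\<Prod>i\<in>I. \<integral>\<omega>. iexp (c i * \<xi> i \<omega>) \<partial>M)"
  proof (rule indep_vars_lebesgue_integral)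
    show "indep_vars (\<lambda>_. borel) (\<lambda>i \<omega>. iexp (c i * \<xi> i \<omega>)) I"
      by (rule indep_vars_compose2[OF indep]) simp
    show "integrable M (\<lambda>\<omega>. iexp (c i * \<xi> i \<omega>))" if "i \<in> I" for i
      using distributed_measurable[OF normal[OF that]]
      by (intro integrable_const_bound[where B = 1]) (auto simp: norm_exp_i_times)
  qed (use assms in auto)
  also have "\<dots> = complex_of_real (exp (- (\<Sum>i\<in>I. (c i)\<^sup>2) / 2))"
    using assms(1) by (subst prod.cong[OF refl one]) (simp_all add: exp_sum sum_divide_distrib flip: of_real_prod sum_negf)
  finally show ?thesis .
qed

lemma nn_integral_exp_square_std_normal:
  fixes \<rho> :: real
  assumes "\<rho> < 1"
  shows "(\<integral>\<^sup>+z. ennreal (exp (\<rho> / 2 * z\<^sup>2)) \<partial>std_normal_distribution) = ennreal (1 / sqrt (1 - \<rho>))"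
proof -
  have "(\<integral>\<^sup>+z. ennreal (exp (\<rho> / 2 * z\<^sup>2)) \<partial>std_normal_distribution) =
      (\<integral>\<^sup>+z. ennreal (std_normal_density z) * ennreal (exp (\<rho> / 2 * z\<^sup>2)) \<partial>lborel)"
    by (simp add: nn_integral_density)
  also have "\<dots> = (\<integral>\<^sup>+z. ennreal (1 / sqrt (2 * pi)) * ennreal (exp (0 * z - (1 - \<rho>) / 2 * z\<^sup>2)) \<partial>lborel)"
  proof (intro nn_integral_cong)
    fix z
    have "exp (- z\<^sup>2 / 2) * exp (\<rho> / 2 * z\<^sup>2) = exp (0 * z - (1 - \<rho>) / 2 * z\<^sup>2)"
      by (simp add: algebra_simps diff_divide_distrib flip: exp_add)
    then show "ennreal (std_normal_density z) * ennreal (exp (\<rho> / 2 * z\<^sup>2)) =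
        ennreal (1 / sqrt (2 * pi)) * ennreal (exp (0 * z - (1 - \<rho>) / 2 * z\<^sup>2))"
      by (simp add: std_normal_density_def flip: ennreal_mult)
  qed
  also have "\<dots> = ennreal (1 / sqrt (2 * pi)) * ennreal (sqrt (2 * pi / (1 - \<rho>)))"
    using nn_integral_exp_quadratic[of "1 - \<rho>" 0] assms by (subst nn_integral_cmult) auto
  also have "\<dots> = ennreal (1 / sqrt (1 - \<rho>))"
    using assms by (simp add: real_sqrt_divide flip: ennreal_mult)
  finally show ?thesis .
qed

abbreviation std_normal_PiM :: "'k set \<Rightarrow> ('k \<Rightarrow> real) measure" where
  "std_normal_PiM K \<equiv> PiM K (\<lambda>_. std_normal_distribution)"

lemma prob_space_std_normal: "prob_space std_normal_distribution"
  by (rule prob_space_normal_density) simp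

lemma sets_std_normal_PiM [measurable_cong]:
  "sets (std_normal_PiM K) = sets (PiM K (\<lambda>_. borel))"
  by (intro sets_PiM_cong) auto

lemma nn_integral_exp_square_std_normal_PiM:
  fixes \<rho> :: real
  assumes "\<rho> < 1" "finite K"
  shows "(\<integral>\<^sup>+z. ennreal (exp (\<rho> / 2 * (\<Sum>k\<in>K. (z k)\<^sup>2))) \<partial>std_normal_PiM K) =
    ennreal ((1 / sqrt (1 - \<rho>)) ^ card K)"
proof -
  interpret prob_space "std_normal_distribution" by (rule prob_space_std_normal)
  interpret product_sigma_finite "\<lambda>_::'a. std_normal_distribution"
    by standard
  have "(\<integral>\<^sup>+z. ennreal (exp (\<rho> / 2 * (\<Sum>k\<in>K. (z k)\<^sup>2))) \<partial>std_normal_PiM K)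
      = (\<integral>\<^sup>+z. (\<Prod>k\<in>K. ennreal (exp (\<rho> / 2 * (z k)\<^sup>2))) \<partial>std_normal_PiM K)"
    using assms by (simp add: prod_ennreal exp_sum[symmetric] sum_distrib_left)
  also have "\<dots> = (\<Prod>k\<in>K. \<integral>\<^sup>+t. ennreal (exp (\<rho> / 2 * t\<^sup>2)) \<partial>std_normal_distribution)"
    using assms by (subst product_nn_integral_prod) auto
  also have "\<dots> = ennreal ((1 / sqrt (1 - \<rho>)) ^ card K)"
    unfolding nn_integral_exp_square_std_normal[OF assms(1)] using assms by (simp add: prod_ennreal ennreal_power)
  finally show ?thesis .
qed

lemma std_normal_PiM_coordinates:
  assumes "finite K"
  shows "prob_space (std_normal_PiM K)"
    and "prob_space.indep_vars (std_normal_PiM K) (\<lambda>_. borel) (\<lambda>k z. z k) K"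
    and "k \<in> K \<Longrightarrow> distributed (std_normal_PiM K) lborel (\<lambda>z. z k) std_normal_density"
proof -
  show P: "prob_space (std_normal_PiM K)"
    by (intro prob_space_PiM prob_space_std_normal)
  have component: "distr (std_normal_PiM K) borel (\<lambda>z. z k) = std_normal_distribution" if "k \<in> K" for k
    using distr_PiM_component[of K "\<lambda>_. std_normal_distribution" k] that prob_space_std_normal
    by (simp cong: distr_cong)
  show "distributed (std_normal_PiM K) lborel (\<lambda>z. z k) std_normal_density" if "k \<in> K" for k
    unfolding distributed_def using component[OF that] that by (auto cong: distr_cong)
  show "prob_space.indep_vars (std_normal_PiM K) (\<lambda>_. borel) (\<lambda>k z. z k) K"
  proof (cases "K = {}")
    case True
    then show ?thesis
      using P by (simp add: prob_space.indep_vars_def prob_space.indep_sets_def)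
  next
    case False
    have "distr (std_normal_PiM K) (PiM K (\<lambda>_. borel)) (\<lambda>z. \<lambda>k\<in>K. z k) =
        distr (std_normal_PiM K) (std_normal_PiM K) (\<lambda>z. z)"
      by (intro distr_cong sets_std_normal_PiM[symmetric]) (auto simp: space_PiM PiE_restrict)
    also have "\<dots> = std_normal_PiM K"
      by simp
    also have "\<dots> = PiM K (\<lambda>k. distr (std_normal_PiM K) borel (\<lambda>z. z k))"
      by (intro PiM_cong) (auto simp: component)
    finally show ?thesis
      using False P by (subst prob_space.indep_vars_iff_distr_eq_PiM') auto
  qed
qed

text \<open>A matrix with orthonormal columns \<open>S i k\<close> is an isometry.\<close>

lemma sum_square_orthonormal_combination:
  fixes S :: "'i \<Rightarrow> 'k \<Rightarrow> real"
  assumes "finite K"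
    and "\<And>k k'. k \<in> K \<Longrightarrow> k' \<in> K \<Longrightarrow> (\<Sum>i\<in>I. S i k * S i k') = (if k = k' then 1 else 0)"
  shows "(\<Sum>i\<in>I. (\<Sum>k\<in>K. z k * S i k)\<^sup>2) = (\<Sum>k\<in>K. (z k)\<^sup>2)"
proof -
  have "(\<Sum>i\<in>I. (\<Sum>k\<in>K. z k * S i k)\<^sup>2) = (\<Sum>i\<in>I. \<Sum>k\<in>K. \<Sum>k'\<in>K. z k * z k' * (S i k * S i k'))"
    by (simp add: power2_eq_square sum_product mult_ac)
  also have "\<dots> = (\<Sum>k\<in>K. \<Sum>k'\<in>K. \<Sum>i\<in>I. z k * z k' * (S i k * S i k'))"
    by (subst sum.swap, intro sum.cong refl, subst sum.swap, rule refl)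
  also have "\<dots> = (\<Sum>k\<in>K. \<Sum>k'\<in>K. z k * z k' * (if k = k' then 1 else 0))"
    by (intro sum.cong refl) (simp add: assms(2) flip: sum_distrib_left)
  also have "\<dots> = (\<Sum>k\<in>K. (z k)\<^sup>2)"
    using assms(1) by (simp add: power2_eq_square if_distrib cong: if_cong)
  finally show ?thesis .
qed

text \<open>The coordinates of a standard Gaussian vector \<open>\<xi>\<close> along an orthonormal family are again independent
  standard Gaussians. For the Laplace transform of the sum \<open>q\<close> of their squares this
  follows by linearisation instead of a rotation of the Gaussian measure: with an independent
  standard Gaussian vector \<open>z\<close>, the variable \<open>exp (\<rho> / 2 * q)\<close> is the mean over \<open>z\<close> of the exponential of a
  form that is linear in \<open>\<xi>\<close>. After exchanging the two means, the mean over \<open>\<xi>\<close> only sees the norm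
  of the coefficients, and that norm is the norm of \<open>z\<close>. For negative \<open>\<rho>\<close> the linear form is
  imaginary, so that case runs over characteristic functions and the Bochner integral.\<close>

lemma (in prob_space) nn_integral_exp_square_orthonormal:
  fixes \<xi> :: "'i \<Rightarrow> 'a \<Rightarrow> real" and S :: "'i \<Rightarrow> 'k \<Rightarrow> real"
  assumes "finite I" "finite K" and indep: "indep_vars (\<lambda>_. borel) \<xi> I"
    and normal: "\<And>i. i \<in> I \<Longrightarrow> distributed M lborel (\<xi> i) std_normal_density"
    and orthonormal: "\<And>k k'. k \<in> K \<Longrightarrow> k' \<in> K \<Longrightarrow> (\<Sum>i\<in>I. S i k * S i k') = (if k = k' then 1 else 0)"
    and "\<rho> < 1"
  shows "(\<integral>\<^sup>+\<omega>. ennreal (exp (\<rho> / 2 * (\<Sum>k\<in>K. (\<Sum>i\<in>I. S i k * \<xi> i \<omega>)\<^sup>2))) \<partial>M) =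
    ennreal ((1 / sqrt (1 - \<rho>)) ^ card K)"
proof -
  let ?\<gamma> = "std_normal_PiM K"
  interpret \<gamma>: prob_space ?\<gamma>
    by (rule std_normal_PiM_coordinates(1)[OF \<open>finite K\<close>])
  note coordinates = \<gamma>.nn_integral_exp_linear_std_normal[OF \<open>finite K\<close> std_normal_PiM_coordinates(2,3)[OF \<open>finite K\<close>]]
    \<gamma>.integral_iexp_linear_std_normal[OF \<open>finite K\<close> std_normal_PiM_coordinates(2,3)[OF \<open>finite K\<close>]]
  interpret pair: pair_prob_space M ?\<gamma> ..
  have \<xi>[measurable]: "\<xi> i \<in> borel_measurable M" if "i \<in> I" for i
    using distributed_measurable[OF normal[OF that]] by simp
  let ?a = "\<lambda>k \<omega>. \<Sum>i\<in>I. S i k * \<xi> i \<omega>"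
  define s where "s = sqrt \<bar>\<rho>\<bar>"
  have s: "s * s = \<bar>\<rho>\<bar>"
    by (simp add: s_def)
  have exchange: "(\<Sum>k\<in>K. s * ?a k \<omega> * z k) = (\<Sum>i\<in>I. (s * (\<Sum>k\<in>K. z k * S i k)) * \<xi> i \<omega>)" for \<omega> z
    by (simp add: sum_distrib_left sum_distrib_right) (subst sum.swap, simp add: mult_ac)
  have norm_S: "(\<Sum>i\<in>I. (s * (\<Sum>k\<in>K. z k * S i k))\<^sup>2) = \<bar>\<rho>\<bar> * (\<Sum>k\<in>K. (z k)\<^sup>2)" for z
    using sum_square_orthonormal_combination[OF \<open>finite K\<close> orthonormal, of z]
    by (simp add: power_mult_distrib power2_eq_square[of s] s flip: sum_distrib_left)
  have norm_a: "(\<Sum>k\<in>K. (s * ?a k \<omega>)\<^sup>2) = \<bar>\<rho>\<bar> * (\<Sum>k\<in>K. (?a k \<omega>)\<^sup>2)" for \<omega>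
    by (simp add: power_mult_distrib power2_eq_square[of s] s flip: sum_distrib_left)
  show ?thesis
  proof (cases "0 \<le> \<rho>")
    case True
    have "(\<integral>\<^sup>+\<omega>. ennreal (exp (\<rho> / 2 * (\<Sum>k\<in>K. (?a k \<omega>)\<^sup>2))) \<partial>M) =
        (\<integral>\<^sup>+\<omega>. (\<integral>\<^sup>+z. ennreal (exp (\<Sum>k\<in>K. s * ?a k \<omega> * z k)) \<partial>?\<gamma>) \<partial>M)"
    proof (intro nn_integral_cong)
      fix \<omega>
      show "ennreal (exp (\<rho> / 2 * (\<Sum>k\<in>K. (?a k \<omega>)\<^sup>2))) =
          (\<integral>\<^sup>+z. ennreal (exp (\<Sum>k\<in>K. s * ?a k \<omega> * z k)) \<partial>?\<gamma>)"
        using coordinates(1)[of "\<lambda>k. s * ?a k \<omega>"] norm_a[of \<omega>] True by simp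
    qed
    also have "\<dots> = (\<integral>\<^sup>+z. (\<integral>\<^sup>+\<omega>. ennreal (exp (\<Sum>k\<in>K. s * ?a k \<omega> * z k)) \<partial>M) \<partial>?\<gamma>)"
      by (rule pair.Fubini'[symmetric]) measurable
    also have "\<dots> = (\<integral>\<^sup>+z. ennreal (exp (\<rho> / 2 * (\<Sum>k\<in>K. (z k)\<^sup>2))) \<partial>?\<gamma>)"
    proof (intro nn_integral_cong)
      fix z
      show "(\<integral>\<^sup>+\<omega>. ennreal (exp (\<Sum>k\<in>K. s * ?a k \<omega> * z k)) \<partial>M) =
          ennreal (exp (\<rho> / 2 * (\<Sum>k\<in>K. (z k)\<^sup>2)))"
        using nn_integral_exp_linear_std_normal[OF \<open>finite I\<close> indep normal,
            of "\<lambda>i. s * (\<Sum>k\<in>K. z k * S i k)"] norm_S[of z] True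
        unfolding exchange by simp
    qed
    also have "\<dots> = ennreal ((1 / sqrt (1 - \<rho>)) ^ card K)"
      by (rule nn_integral_exp_square_std_normal_PiM) fact+
    finally show ?thesis .
  next
    case False
    have "complex_of_real (\<integral>\<omega>. exp (\<rho> / 2 * (\<Sum>k\<in>K. (?a k \<omega>)\<^sup>2)) \<partial>M) =
        (\<integral>\<omega>. complex_of_real (exp (\<rho> / 2 * (\<Sum>k\<in>K. (?a k \<omega>)\<^sup>2))) \<partial>M)"
      by simp
    also have "\<dots> = (\<integral>\<omega>. (\<integral>z. iexp (\<Sum>k\<in>K. s * ?a k \<omega> * z k) \<partial>?\<gamma>) \<partial>M)"
    proof (intro Bochner_Integration.integral_cong refl)
      fix \<omega>
      have "(\<integral>z. iexp (\<Sum>k\<in>K. s * ?a k \<omega> * z k) \<partial>?\<gamma>) =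
          complex_of_real (exp (- (\<Sum>k\<in>K. (s * ?a k \<omega>)\<^sup>2) / 2))"
        by (rule coordinates(2))
      also have "- (\<Sum>k\<in>K. (s * ?a k \<omega>)\<^sup>2) / 2 = \<rho> / 2 * (\<Sum>k\<in>K. (?a k \<omega>)\<^sup>2)"
        unfolding norm_a using False by simp
      finally show "complex_of_real (exp (\<rho> / 2 * (\<Sum>k\<in>K. (?a k \<omega>)\<^sup>2))) =
          (\<integral>z. iexp (\<Sum>k\<in>K. s * ?a k \<omega> * z k) \<partial>?\<gamma>)" ..
    qed
    also have "\<dots> = (\<integral>z. (\<integral>\<omega>. iexp (\<Sum>k\<in>K. s * ?a k \<omega> * z k) \<partial>M) \<partial>?\<gamma>)"
      by (rule pair.Fubini_integral[symmetric],
          rule pair.P.integrable_const_bound[where B = 1])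
        (rule AE_I2, simp only: split_beta norm_exp_i_times order_refl, measurable)
    also have "\<dots> = (\<integral>z. complex_of_real (exp (\<rho> / 2 * (\<Sum>k\<in>K. (z k)\<^sup>2))) \<partial>?\<gamma>)"
    proof (intro Bochner_Integration.integral_cong refl)
      fix z
      have "(\<integral>\<omega>. iexp (\<Sum>k\<in>K. s * ?a k \<omega> * z k) \<partial>M) =
          complex_of_real (exp (- (\<Sum>i\<in>I. (s * (\<Sum>k\<in>K. z k * S i k))\<^sup>2) / 2))"
        unfolding exchange by (rule integral_iexp_linear_std_normal[OF \<open>finite I\<close> indep normal])
      also have "- (\<Sum>i\<in>I. (s * (\<Sum>k\<in>K. z k * S i k))\<^sup>2) / 2 = \<rho> / 2 * (\<Sum>k\<in>K. (z k)\<^sup>2)"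
        unfolding norm_S using False by simp
      finally show "(\<integral>\<omega>. iexp (\<Sum>k\<in>K. s * ?a k \<omega> * z k) \<partial>M) =
          complex_of_real (exp (\<rho> / 2 * (\<Sum>k\<in>K. (z k)\<^sup>2)))" .
    qed
    finally have "(\<integral>\<omega>. exp (\<rho> / 2 * (\<Sum>k\<in>K. (?a k \<omega>)\<^sup>2)) \<partial>M) =
        (\<integral>z. exp (\<rho> / 2 * (\<Sum>k\<in>K. (z k)\<^sup>2)) \<partial>?\<gamma>)"
      by (simp only: integral_complex_of_real of_real_eq_iff)
    moreover have "integrable M (\<lambda>\<omega>. exp (\<rho> / 2 * (\<Sum>k\<in>K. (?a k \<omega>)\<^sup>2)))"
      using False by (intro integrable_const_bound[where B = 1])
        (auto intro!: mult_nonpos_nonneg sum_nonneg)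
    moreover have "integrable ?\<gamma> (\<lambda>z. exp (\<rho> / 2 * (\<Sum>k\<in>K. (z k)\<^sup>2)))"
      using False by (intro \<gamma>.integrable_const_bound[where B = 1])
        (auto intro!: mult_nonpos_nonneg sum_nonneg)
    ultimately show ?thesis
      using nn_integral_exp_square_std_normal_PiM[OF \<open>\<rho> < 1\<close> \<open>finite K\<close>]
      by (simp add: nn_integral_eq_integral)
  qed
qed

section \<open>Singular values of a Gaussian matrix\<close>

text \<open>Vectors are functions on the natural numbers in the probabilistic part, because they are points
  of product measures there; the dimension is an explicit argument.\<close>

definition sqn :: "nat \<Rightarrow> (nat \<Rightarrow> real) \<Rightarrow> real" where
  "sqn r x = (\<Sum>i<r. (x i)\<^sup>2)"

text \<open>The squared norm of the transpose of the \<open>r \<times> l\<close> matrix \<open>B\<close>, applied to \<open>x\<close>.\<close>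

definition image_sqn :: "nat \<Rightarrow> nat \<Rightarrow> (nat \<Rightarrow> nat \<Rightarrow> real) \<Rightarrow> (nat \<Rightarrow> real) \<Rightarrow> real" where
  "image_sqn r l B x = sqn l (\<lambda>k. \<Sum>i<r. x i * B i k)"

lemma sqn_nonneg [simp]: "0 \<le> sqn r x"
  by (simp add: sqn_def sum_nonneg)

lemma image_sqn_nonneg [simp]: "0 \<le> image_sqn r l B x"
  by (simp add: image_sqn_def)

lemma sqn_scale: "sqn r (\<lambda>i. c * x i) = c\<^sup>2 * sqn r x"
  by (simp add: sqn_def power_mult_distrib sum_distrib_left)

lemma image_sqn_scale: "image_sqn r l B (\<lambda>i. c * x i) = c\<^sup>2 * image_sqn r l B x"
  by (simp add: image_sqn_def mult.assoc sqn_scale flip: sum_distrib_left)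

lemma sqn_eq_0_iff: "sqn r x = 0 \<longleftrightarrow> (\<forall>i<r. x i = 0)"
  by (auto simp: sqn_def sum_nonneg_eq_0_iff)

lemma image_sqn_eq_0: "sqn r x = 0 \<Longrightarrow> image_sqn r l B x = 0"
  by (auto simp: sqn_eq_0_iff image_sqn_def)

text \<open>Young's inequality, with a free parameter that decides how the cross term is shared.\<close>

lemma sqn_add_le:
  assumes "0 < \<eta>"
  shows "sqn r (\<lambda>i. x i + y i) \<le> (1 + \<eta>) * sqn r x + (1 + 1 / \<eta>) * sqn r y"
proof -
  have "(a + b)\<^sup>2 \<le> (1 + \<eta>) * a\<^sup>2 + (1 + 1 / \<eta>) * b\<^sup>2" for a b :: real
  proof -
    have "0 \<le> (\<eta> * a - b)\<^sup>2 / \<eta>"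
      using assms by simp
    also have "\<dots> = (1 + \<eta>) * a\<^sup>2 + (1 + 1 / \<eta>) * b\<^sup>2 - (a + b)\<^sup>2"
      using assms by (simp add: power2_eq_square field_simps)
    finally show ?thesis by simp
  qed
  then have "sqn r (\<lambda>i. x i + y i) \<le> (\<Sum>i<r. (1 + \<eta>) * (x i)\<^sup>2 + (1 + 1 / \<eta>) * (y i)\<^sup>2)"
    unfolding sqn_def by (intro sum_mono)
  then show ?thesis
    by (simp add: sqn_def sum.distrib sum_distrib_left)
qed

lemma image_sqn_add_le:
  assumes "0 < \<eta>"
  shows "image_sqn r l B (\<lambda>i. x i + y i) \<le> (1 + \<eta>) * image_sqn r l B x + (1 + 1 / \<eta>) * image_sqn r l B y"
  using sqn_add_le[OF assms, of l "\<lambda>k. \<Sum>i<r. x i * B i k" "\<lambda>k. \<Sum>i<r. y i * B i k"]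
  by (simp add: image_sqn_def distrib_right sum.distrib)

lemma Cauchy_Schwarz_sqn: "(\<Sum>i<r. x i * y i)\<^sup>2 \<le> sqn r x * sqn r y"
  unfolding sqn_def by (rule Cauchy_Schwarz_ineq_sum)

lemma sum_mult_le_sqrt_sqn: "(\<Sum>i<r. x i * y i) \<le> sqrt (sqn r x) * sqrt (sqn r y)"
  using Cauchy_Schwarz_sqn[of x y r]
  by (metis abs_le_D1 real_sqrt_abs real_sqrt_le_mono real_sqrt_mult)

text \<open>All that the tail bounds use about the random matrix \<open>B\<close>: in every fixed direction \<open>x\<close> the Rayleigh
  quotient of the transpose of \<open>B\<close> has the Laplace transform of a chi-square variable with \<open>l\<close>
  degrees of freedom.\<close>

definition (in prob_space) chi_square_directions ::
    "nat \<Rightarrow> nat \<Rightarrow> ('a \<Rightarrow> nat \<Rightarrow> nat \<Rightarrow> real) \<Rightarrow> bool" where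
  "chi_square_directions r l B \<longleftrightarrow>
     (\<forall>i<r. \<forall>k<l. (\<lambda>\<omega>. B \<omega> i k) \<in> borel_measurable M) \<and>
     (\<forall>x \<rho>. sqn r x \<noteq> 0 \<longrightarrow> \<rho> < 1 \<longrightarrow>
       (\<integral>\<^sup>+\<omega>. ennreal (exp (\<rho> / 2 * (image_sqn r l (B \<omega>) x / sqn r x))) \<partial>M) =
       ennreal ((1 / sqrt (1 - \<rho>)) ^ l))"

lemma (in prob_space) chi_square_directions_mgf:
  assumes "chi_square_directions r l B" "sqn r x \<noteq> 0" "\<rho> < 1"
  shows "(\<integral>\<^sup>+\<omega>. ennreal (exp (\<rho> / 2 * (image_sqn r l (B \<omega>) x / sqn r x))) \<partial>M) =
    ennreal ((1 / sqrt (1 - \<rho>)) ^ l)"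
  using assms unfolding chi_square_directions_def by blast

text \<open>For a Gaussian matrix \<open>\<xi>\<close> and a matrix \<open>Z\<close> with orthonormal columns, the product of \<open>\<xi>\<close> and \<open>Z\<close>
  behaves in each direction like an \<open>r \<times> l\<close> Gaussian matrix: for a unit vector \<open>x\<close>, the matrices
  with entries \<open>x i * Z j k\<close> are orthonormal, one for each \<open>k\<close>, in the space of \<open>r \<times> n\<close> matrices.\<close>

lemma (in prob_space) chi_square_directions_gaussian:
  fixes \<xi> :: "nat \<times> nat \<Rightarrow> 'a \<Rightarrow> real" and Z :: "nat \<Rightarrow> nat \<Rightarrow> real"
  assumes indep: "indep_vars (\<lambda>_. borel) \<xi> ({..<r} \<times> {..<n})"
    and normal: "\<And>i j. i < r \<Longrightarrow> j < n \<Longrightarrow> distributed M lborel (\<xi> (i, j)) std_normal_density"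
    and Z: "\<And>k k'. k < l \<Longrightarrow> k' < l \<Longrightarrow> (\<Sum>j<n. Z j k * Z j k') = (if k = k' then 1 else 0)"
  shows "chi_square_directions r l (\<lambda>\<omega> i k. \<Sum>j<n. \<xi> (i, j) \<omega> * Z j k)"
  unfolding chi_square_directions_def
proof (intro conjI allI impI)
  have \<xi>[measurable]: "\<xi> (i, j) \<in> borel_measurable M" if "i < r" "j < n" for i j
    using distributed_measurable[OF normal[OF that]] by simp
  show "(\<lambda>\<omega>. \<Sum>j<n. \<xi> (i, j) \<omega> * Z j k) \<in> borel_measurable M" if "i < r" "k < l" for i k
    using that by measurable
next
  fix x and \<rho> :: real assume x: "sqn r x \<noteq> 0" and "\<rho> < 1"
  define S where "S = (\<lambda>ij k. x (fst ij) / sqrt (sqn r x) * Z (snd ij) k)"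
  have "(\<Sum>ij\<in>{..<r} \<times> {..<n}. S ij k * S ij k') = (if k = k' then 1 else 0)"
    if "k \<in> {..<l}" "k' \<in> {..<l}" for k k'
  proof -
    have "(\<Sum>ij\<in>{..<r} \<times> {..<n}. S ij k * S ij k') =
        (\<Sum>i<r. \<Sum>j<n. (x i / sqrt (sqn r x))\<^sup>2 * (Z j k * Z j k'))"
      by (simp add: S_def power2_eq_square mult_ac sum.cartesian_product split_beta)
    also have "\<dots> = (\<Sum>i<r. (x i / sqrt (sqn r x))\<^sup>2) * (\<Sum>j<n. Z j k * Z j k')"
      by (simp add: sum_product)
    also have "(\<Sum>i<r. (x i / sqrt (sqn r x))\<^sup>2) = 1"
      using x by (simp add: power_divide flip: sum_divide_distrib) (simp add: sqn_def)
    finally show ?thesis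
      using Z that by simp
  qed
  moreover have "(\<Sum>k<l. (\<Sum>ij\<in>{..<r} \<times> {..<n}. S ij k * \<xi> ij \<omega>)\<^sup>2) =
      image_sqn r l (\<lambda>i k. \<Sum>j<n. \<xi> (i, j) \<omega> * Z j k) x / sqn r x" for \<omega>
  proof -
    have "(\<Sum>ij\<in>{..<r} \<times> {..<n}. S ij k * \<xi> ij \<omega>) =
        1 / sqrt (sqn r x) * (\<Sum>i<r. x i * (\<Sum>j<n. \<xi> (i, j) \<omega> * Z j k))" for k
      by (simp add: S_def sum_distrib_left mult_ac sum.cartesian_product split_beta)
    then show ?thesis
      by (simp add: image_sqn_def power_mult_distrib power_divide sqn_def[of l] flip: sum_divide_distrib)
  qed
  ultimately show "(\<integral>\<^sup>+\<omega>. ennreal (exp (\<rho> / 2 *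
      (image_sqn r l (\<lambda>i k. \<Sum>j<n. \<xi> (i, j) \<omega> * Z j k) x / sqn r x))) \<partial>M) =
      ennreal ((1 / sqrt (1 - \<rho>)) ^ l)"
    using nn_integral_exp_square_orthonormal[OF _ _ indep _ _ \<open>\<rho> < 1\<close>, where S = S and K = "{..<l}"] normal
    by auto
qed

text \<open>Markov's inequality, stated for the complementary event.\<close>

lemma (in prob_space) prob_less_ge:
  assumes [measurable]: "\<Psi> \<in> borel_measurable M"
    and "(\<integral>\<^sup>+\<omega>. \<Psi> \<omega> \<partial>M) \<le> ennreal a" "0 \<le> a" "0 < t"
  shows "{\<omega> \<in> space M. \<Psi> \<omega> < ennreal t} \<in> events" and "1 - a / t \<le> prob {\<omega> \<in> space M. \<Psi> \<omega> < ennreal t}"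
proof -
  let ?E = "{\<omega> \<in> space M. \<Psi> \<omega> < ennreal t}"
  show E: "?E \<in> events" by measurable
  have "emeasure M {\<omega> \<in> space M. 1 \<le> ennreal (1 / t) * \<Psi> \<omega>} \<le>
      ennreal (1 / t) * (\<integral>\<^sup>+\<omega>. \<Psi> \<omega> * indicator (space M) \<omega> \<partial>M)"
    by (rule nn_integral_Markov_inequality) auto
  also have "(\<integral>\<^sup>+\<omega>. \<Psi> \<omega> * indicator (space M) \<omega> \<partial>M) = (\<integral>\<^sup>+\<omega>. \<Psi> \<omega> \<partial>M)"
    by (intro nn_integral_cong) auto
  also have "ennreal (1 / t) * (\<integral>\<^sup>+\<omega>. \<Psi> \<omega> \<partial>M) \<le> ennreal (1 / t) * ennreal a"
    by (intro mult_left_mono assms) simp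
  also have "\<dots> = ennreal (a / t)"
    using assms by (simp flip: ennreal_mult)
  finally have "emeasure M {\<omega> \<in> space M. 1 \<le> ennreal (1 / t) * \<Psi> \<omega>} \<le> ennreal (a / t)" .
  then have bound: "prob {\<omega> \<in> space M. 1 \<le> ennreal (1 / t) * \<Psi> \<omega>} \<le> a / t"
    using assms by (simp add: emeasure_eq_measure)
  have "1 \<le> ennreal (1 / t) * \<Psi> \<omega>" if "ennreal t \<le> \<Psi> \<omega>" for \<omega>
  proof -
    have "1 = ennreal (1 / t) * ennreal t"
      using assms by (simp flip: ennreal_mult)
    also have "\<dots> \<le> ennreal (1 / t) * \<Psi> \<omega>"
      using that by (intro mult_left_mono) auto
    finally show ?thesis .
  qed
  then have "space M - ?E \<subseteq> {\<omega> \<in> space M. 1 \<le> ennreal (1 / t) * \<Psi> \<omega>}"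
    by (auto simp: not_less)
  then have "prob (space M - ?E) \<le> a / t"
    using bound by (intro order_trans[OF finite_measure_mono bound]) auto
  then show "1 - a / t \<le> prob ?E"
    using prob_compl[OF E] by simp
qed

lemma measurable_image_sqn:
  assumes "\<And>i k. i < r \<Longrightarrow> k < l \<Longrightarrow> (\<lambda>\<omega>. B \<omega> i k) \<in> borel_measurable M"
  shows "(\<lambda>(\<omega>, x). image_sqn r l (B \<omega>) x) \<in> borel_measurable (M \<Otimes>\<^sub>M PiM {..<r} (\<lambda>_. lborel))"
proof -
  have [measurable]: "(\<lambda>\<omega>. B \<omega> i k) \<in> borel_measurable M" if "i < r" "k < l" for i k
    by (rule assms) fact+
  show ?thesis
    unfolding image_sqn_def sqn_def by measurable
qed

lemma measurable_sqn [measurable]: "sqn r \<in> borel_measurable (PiM {..<r} (\<lambda>_. lborel))"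
  unfolding sqn_def by measurable

text \<open>Put \<open>\<Psi> = \<integral> exp (- (1 - p) / 2 * |x|\<^sup>2 + \<theta> / 2 * q x) dx\<close>, where \<open>q x\<close> is the Rayleigh quotient. By Fubini
  its mean is explicit. If some direction has a quotient above \<open>\<beta>\<close>, let \<open>u\<close> be the unit
  vector along the image of that direction. The arithmetic-geometric mean inequality
  bounds \<open>p / 2 * |x|\<^sup>2 + \<theta> / 2 * q x\<close> below by \<open>sqrt (p * \<theta>)\<close> times the length of the image of \<open>x\<close>, and hence
  by the linear form in \<open>x\<close> with coefficients \<open>sqrt (p * \<theta>) * c\<close>, where \<open>c = B u\<close>. The Gaussian integral of that form is large since
  \<open>|c|\<^sup>2 \<ge> \<beta>\<close>. Then Markov's inequality applies to \<open>\<Psi>\<close>.\<close>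

lemma (in prob_space) image_sqn_le_with_prob:
  assumes B: "chi_square_directions r l B"
    and p: "0 < p" "p < 1" and \<theta>: "0 < \<theta>" "\<theta> < 1" and "0 \<le> \<beta>"
  shows "\<exists>E\<in>events. (\<forall>\<omega>\<in>E. \<forall>x. image_sqn r l (B \<omega>) x \<le> \<beta> * sqn r x) \<and>
    1 - (1 / sqrt (1 - p)) ^ r * (1 / sqrt (1 - \<theta>)) ^ l * exp (- (p * \<theta> * \<beta> / 2)) \<le> prob E"
proof -
  let ?L = "PiM {..<r} (\<lambda>_. lborel :: real measure)"
  interpret L: product_sigma_finite "\<lambda>_::nat. lborel :: real measure" by standard
  interpret L': sigma_finite_measure ?L by (rule L.sigma_finite) simp
  interpret pair: pair_sigma_finite M ?L ..
  have Bm: "(\<lambda>\<omega>. B \<omega> i k) \<in> borel_measurable M" if "i < r" "k < l" for i k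
    using B that by (auto simp: chi_square_directions_def)
  note [measurable] = measurable_image_sqn[OF Bm, unfolded split_beta']
  define f where "f = (\<lambda>\<omega> x. exp (- ((1 - p) / 2) * sqn r x + \<theta> / 2 * (image_sqn r l (B \<omega>) x / sqn r x)))"
  have f[measurable]: "(\<lambda>(\<omega>, x). f \<omega> x) \<in> borel_measurable (M \<Otimes>\<^sub>M ?L)"
    unfolding f_def split_beta' by measurable
  define \<Psi> where "\<Psi> \<omega> = (\<integral>\<^sup>+x. ennreal (f \<omega> x) \<partial>?L)" for \<omega>
  have \<Psi>: "\<Psi> \<in> borel_measurable M"
    unfolding \<Psi>_def by measurable
  have inner: "(\<integral>\<^sup>+\<omega>. ennreal (f \<omega> x) \<partial>M) \<le>
      ennreal ((1 / sqrt (1 - \<theta>)) ^ l) * ennreal (exp (- ((1 - p) / 2) * sqn r x))" for x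
  proof (cases "sqn r x = 0")
    case True
    then show ?thesis
      using \<theta> by (simp add: f_def emeasure_space_1 one_le_power)
  next
    case False
    have "(\<integral>\<^sup>+\<omega>. ennreal (f \<omega> x) \<partial>M) = (\<integral>\<^sup>+\<omega>. ennreal (exp (- ((1 - p) / 2) * sqn r x)) *
        ennreal (exp (\<theta> / 2 * (image_sqn r l (B \<omega>) x / sqn r x))) \<partial>M)"
      unfolding f_def exp_add by (simp add: ennreal_mult)
    also have "\<dots> = ennreal (exp (- ((1 - p) / 2) * sqn r x)) *
        (\<integral>\<^sup>+\<omega>. ennreal (exp (\<theta> / 2 * (image_sqn r l (B \<omega>) x / sqn r x))) \<partial>M)"
    proof (rule nn_integral_cmult)
      show "(\<lambda>\<omega>. ennreal (exp (\<theta> / 2 * (image_sqn r l (B \<omega>) x / sqn r x)))) \<in> borel_measurable M"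
        using Bm unfolding image_sqn_def sqn_def by measurable
    qed
    also have "\<dots> = ennreal ((1 / sqrt (1 - \<theta>)) ^ l) * ennreal (exp (- ((1 - p) / 2) * sqn r x))"
      using chi_square_directions_mgf[OF B False \<theta>(2)] by (simp add: mult.commute)
    finally show ?thesis by simp
  qed
  have "(\<integral>\<^sup>+\<omega>. \<Psi> \<omega> \<partial>M) = (\<integral>\<^sup>+x. (\<integral>\<^sup>+\<omega>. ennreal (f \<omega> x) \<partial>M) \<partial>?L)"
    unfolding \<Psi>_def by (rule pair.Fubini'[symmetric]) measurable
  also have "\<dots> \<le> (\<integral>\<^sup>+x. ennreal ((1 / sqrt (1 - \<theta>)) ^ l) * ennreal (exp (- ((1 - p) / 2) * sqn r x)) \<partial>?L)"
    by (intro nn_integral_mono inner)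
  also have "\<dots> = ennreal ((1 / sqrt (1 - \<theta>)) ^ l) * ennreal (sqrt (2 * pi / (1 - p)) ^ r)"
    using nn_integral_exp_quadratic_PiM[of "1 - p" "{..<r}" "\<lambda>_. 0"] p
    by (subst nn_integral_cmult) (simp_all add: sqn_def)
  also have "\<dots> = ennreal ((1 / sqrt (1 - \<theta>)) ^ l * sqrt (2 * pi / (1 - p)) ^ r)"
    using p \<theta> by (simp add: ennreal_mult)
  finally have mean: "(\<integral>\<^sup>+\<omega>. \<Psi> \<omega> \<partial>M) \<le> ennreal ((1 / sqrt (1 - \<theta>)) ^ l * sqrt (2 * pi / (1 - p)) ^ r)" .
  define t where "t = sqrt (2 * pi) ^ r * exp (p * \<theta> * \<beta> / 2)"
  have large: "ennreal t \<le> \<Psi> \<omega>" if v: "\<beta> * sqn r v < image_sqn r l (B \<omega>) v" for \<omega> v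
  proof -
    \<comment> \<open>Here \<open>a\<close> is the image of the bad direction \<open>v\<close>, \<open>u\<close> its normalisation, and the pairing
      of \<open>v\<close> with \<open>c\<close> equals \<open>|a|\<close>, so Cauchy-Schwarz makes \<open>c\<close> long.\<close>
    define a where "a k = (\<Sum>i<r. v i * B \<omega> i k)" for k
    define u where "u k = a k / sqrt (sqn l a)" for k
    define c where "c i = (\<Sum>k<l. B \<omega> i k * u k)" for i
    have a: "image_sqn r l (B \<omega>) v = sqn l a"
      by (simp add: image_sqn_def a_def[abs_def])
    have pos: "0 < sqn l a"
      using v \<open>0 \<le> \<beta>\<close> a by (smt (verit) mult_nonneg_nonneg sqn_nonneg)
    have u: "sqn l u = 1"
      using pos by (simp add: sqn_def u_def power_divide flip: sum_divide_distrib)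
    have xc: "(\<Sum>i<r. x i * c i) = (\<Sum>k<l. (\<Sum>i<r. x i * B \<omega> i k) * u k)" for x
      by (simp add: c_def sum_distrib_left sum_distrib_right mult.assoc sum.swap[of _ "{..<l}"])
    have "(\<Sum>i<r. v i * c i) = sqrt (sqn l a)"
      unfolding xc a_def[symmetric] using pos
      by (simp add: u_def power2_eq_square[symmetric] real_div_sqrt flip: sum_divide_distrib sqn_def)
    then have "sqn l a \<le> sqn r v * sqn r c"
      using Cauchy_Schwarz_sqn[of v c r] pos by simp
    with v a have "\<beta> * sqn r v < sqn r c * sqn r v"
      by (simp add: mult.commute)
    then have c: "\<beta> \<le> sqn r c"
      by (smt (verit) mult_right_mono sqn_nonneg)
    have xc_le: "(\<Sum>i<r. x i * c i) \<le> sqrt (image_sqn r l (B \<omega>) x)" for x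
      using sum_mult_le_sqrt_sqn[of "\<lambda>k. \<Sum>i<r. x i * B \<omega> i k" u l] u
      unfolding xc image_sqn_def by simp
    have point: "exp ((\<Sum>i<r. (sqrt (p * \<theta>) * c i) * x i) - 1 / 2 * (\<Sum>i<r. (x i)\<^sup>2)) \<le> f \<omega> x" for x
    proof -
      let ?R = "image_sqn r l (B \<omega>) x" and ?s = "sqn r x"
      have "sqrt (p * \<theta>) * sqrt ?R \<le> p / 2 * ?s + \<theta> / 2 * (?R / ?s)"
      proof (cases "?s = 0")
        case True
        then show ?thesis by (simp add: image_sqn_eq_0)
      next
        case False
        then have "0 < ?s" using sqn_nonneg[of r x] by linarith
        have "0 \<le> (sqrt (p * ?s) - sqrt (\<theta> * (?R / ?s)))\<^sup>2" by simp
        also have "\<dots> = p * ?s + \<theta> * (?R / ?s) - 2 * (sqrt (p * ?s) * sqrt (\<theta> * (?R / ?s)))"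
          using p \<theta> by (simp add: power2_diff)
        also have "sqrt (p * ?s) * sqrt (\<theta> * (?R / ?s)) = sqrt (p * \<theta>) * sqrt ?R"
          using \<open>0 < ?s\<close> by (simp add: real_sqrt_mult real_sqrt_divide)
        finally show ?thesis by simp
      qed
      moreover have "sqrt (p * \<theta>) * (\<Sum>i<r. x i * c i) \<le> sqrt (p * \<theta>) * sqrt ?R"
        using p \<theta> by (intro mult_left_mono xc_le) simp
      ultimately have "sqrt (p * \<theta>) * (\<Sum>i<r. x i * c i) - 1 / 2 * ?s \<le>
          - ((1 - p) / 2) * ?s + \<theta> / 2 * (?R / ?s)"
        by (simp add: algebra_simps diff_divide_distrib)
      then show ?thesis
        unfolding f_def by (simp add: sum_distrib_left mult_ac sqn_def)
    qed
    have "t \<le> sqrt (2 * pi) ^ r * exp (p * \<theta> * sqn r c / 2)"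
      unfolding t_def using c p \<theta> by (intro mult_left_mono) (simp_all add: mult_left_mono)
    also have "p * \<theta> * sqn r c / 2 = (\<Sum>i<r. (sqrt (p * \<theta>) * c i)\<^sup>2) / (2 * 1)"
      using p \<theta> by (simp add: power_mult_distrib sqn_def flip: sum_distrib_left)
    finally have "ennreal t \<le> ennreal (sqrt (2 * pi / 1) ^ card {..<r} * exp ((\<Sum>i<r. (sqrt (p * \<theta>) * c i)\<^sup>2) / (2 * 1)))"
      by (intro ennreal_leI) simp
    also have "\<dots> = (\<integral>\<^sup>+x. ennreal (exp ((\<Sum>i<r. (sqrt (p * \<theta>) * c i) * x i) - 1 / 2 * (\<Sum>i<r. (x i)\<^sup>2))) \<partial>?L)"
      by (rule nn_integral_exp_quadratic_PiM[symmetric]) auto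
    also have "\<dots> \<le> \<Psi> \<omega>"
      unfolding \<Psi>_def by (intro nn_integral_mono ennreal_leI point)
    finally show ?thesis .
  qed
  let ?a = "(1 / sqrt (1 - \<theta>)) ^ l * sqrt (2 * pi / (1 - p)) ^ r"
  have "?a / t = (1 / sqrt (1 - p)) ^ r * (1 / sqrt (1 - \<theta>)) ^ l * exp (- (p * \<theta> * \<beta> / 2))"
    unfolding t_def by (simp add: real_sqrt_divide power_divide exp_minus field_simps)
  moreover have "0 < t" "0 \<le> ?a"
    using p \<theta> by (auto simp: t_def)
  ultimately have ratio: "?a / t = (1 / sqrt (1 - p)) ^ r * (1 / sqrt (1 - \<theta>)) ^ l * exp (- (p * \<theta> * \<beta> / 2))"
    and "0 < t" "0 \<le> ?a" by auto
  note Markov = prob_less_ge[OF \<Psi> mean \<open>0 \<le> ?a\<close> \<open>0 < t\<close>]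
  show ?thesis
  proof (intro bexI[OF _ Markov(1)] conjI ballI allI)
    fix \<omega> x assume \<omega>: "\<omega> \<in> {\<omega> \<in> space M. \<Psi> \<omega> < ennreal t}"
    show "image_sqn r l (B \<omega>) x \<le> \<beta> * sqn r x"
    proof (rule leI, rule notI)
      assume "\<beta> * sqn r x < image_sqn r l (B \<omega>) x"
      then have "ennreal t \<le> \<Psi> \<omega>"
        by (rule large)
      then show False
        using \<omega> by (simp add: leD)
    qed
  qed (use Markov(2) ratio in simp)
qed

text \<open>The reflection at \<open>v\<close> swaps the half space \<open>{x. v \<bullet> (x - v) \<ge> 0}\<close> with its complement, up to the
  boundary, and preserves the Gaussian centred at \<open>v\<close>; so this half space carries at least half of the
  mass.\<close>

lemma half_nn_integral_exp_square_half_space: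
  fixes v :: "'i \<Rightarrow> real"
  assumes "finite I" "0 < K"
  shows "ennreal (sqrt (2 * pi / K) ^ card I / 2) \<le>
    (\<integral>\<^sup>+x. ennreal (exp (- (K / 2) * (\<Sum>i\<in>I. (x i - v i)\<^sup>2))) *
      indicator {x. 0 \<le> (\<Sum>i\<in>I. v i * (x i - v i))} x \<partial>PiM I (\<lambda>_. lborel))"
proof -
  let ?L = "PiM I (\<lambda>_. lborel :: real measure)"
  let ?g = "\<lambda>x. ennreal (exp (- (K / 2) * (\<Sum>i\<in>I. (x i - v i)\<^sup>2)))"
  let ?h = "\<lambda>x. \<Sum>i\<in>I. v i * (x i - v i)"
  let ?T = "\<lambda>x. \<lambda>i\<in>I. 2 * v i - x i"
  have gT: "?g (?T x) = ?g x" for x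
  proof -
    have "(\<Sum>i\<in>I. (?T x i - v i)\<^sup>2) = (\<Sum>i\<in>I. (x i - v i)\<^sup>2)"
      by (intro sum.cong refl) (simp add: power2_eq_square algebra_simps)
    then show ?thesis by (simp only:)
  qed
  have hT: "?h (?T x) = - ?h x" for x
    by (simp add: sum_negf[symmetric] algebra_simps cong: sum.cong)
  have Tm[measurable]: "?T \<in> ?L \<rightarrow>\<^sub>M ?L" by measurable
  have "(\<integral>\<^sup>+x. ?g x * indicator {x. ?h x < 0} x \<partial>?L) =
      (\<integral>\<^sup>+x. ?g x * indicator {x. ?h x < 0} x \<partial>distr ?L ?L ?T)"
    by (simp only: measure_preserving_reflection_PiM[OF assms(1)])
  also have "\<dots> = (\<integral>\<^sup>+x. ?g (?T x) * indicator {x. ?h x < 0} (?T x) \<partial>?L)"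
    by (rule nn_integral_distr[OF Tm]) (simp add: indicator_def, measurable)
  also have "\<dots> \<le> (\<integral>\<^sup>+x. ?g x * indicator {x. 0 \<le> ?h x} x \<partial>?L)"
  proof (intro nn_integral_mono)
    fix x
    show "?g (?T x) * indicator {x. ?h x < 0} (?T x) \<le> ?g x * indicator {x. 0 \<le> ?h x} x"
      unfolding gT indicator_def mem_Collect_eq hT by (intro mult_left_mono) auto
  qed
  finally have neg: "(\<integral>\<^sup>+x. ?g x * indicator {x. ?h x < 0} x \<partial>?L) \<le>
      (\<integral>\<^sup>+x. ?g x * indicator {x. 0 \<le> ?h x} x \<partial>?L)" (is "_ \<le> ?J") .
  have "ennreal (sqrt (2 * pi / K) ^ card I) = (\<integral>\<^sup>+x. ?g x \<partial>?L)"
    using nn_integral_exp_shifted_square_PiM[OF assms(2,1), of v] by simp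
  also have "\<dots> = (\<integral>\<^sup>+x. ?g x * indicator {x. 0 \<le> ?h x} x + ?g x * indicator {x. ?h x < 0} x \<partial>?L)"
    by (intro nn_integral_cong) (auto simp: indicator_def)
  also have "\<dots> = ?J + (\<integral>\<^sup>+x. ?g x * indicator {x. ?h x < 0} x \<partial>?L)"
    by (rule nn_integral_add) (simp add: indicator_def, measurable)+
  also have "\<dots> \<le> ?J + ?J"
    by (intro add_left_mono neg)
  finally have "ennreal (sqrt (2 * pi / K) ^ card I) \<le> 2 * ?J"
    by (simp only: mult_2)
  then have "ennreal (1 / 2) * ennreal (sqrt (2 * pi / K) ^ card I) \<le> ennreal (1 / 2) * (2 * ?J)"
    by (intro mult_left_mono) auto
  also have "\<dots> = (ennreal (1 / 2) * ennreal 2) * ?J"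
    by (simp add: mult.assoc)
  also have "\<dots> = ?J"
    by (subst ennreal_mult[symmetric]) auto
  finally have "ennreal (1 / 2) * ennreal (sqrt (2 * pi / K) ^ card I) \<le> ?J" .
  moreover have "ennreal (1 / 2) * ennreal (sqrt (2 * pi / K) ^ card I) = ennreal (sqrt (2 * pi / K) ^ card I / 2)"
    using assms by (subst ennreal_mult[symmetric]) auto
  ultimately show ?thesis by (simp only:)
qed

text \<open>The counterpart of the previous tail bound for small quotients, with a negative exponent in front of
  the Rayleigh quotient. If \<open>v\<close> is a unit vector whose image is short, then points \<open>x\<close> near \<open>v\<close> also have short
  images, because the image of \<open>x - v\<close> is controlled by the bound \<open>\<beta>\<close>. On the half space where
  \<open>v \<bullet> (x - v) \<ge> 0\<close> moreover \<open>|x| \<ge> 1\<close>, so that the quotient is at most the squared length of the image.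
  Thus the integrand dominates a Gaussian centred at \<open>v\<close>, and the integral is large. Restricting the
  integral to \<open>|x| \<ge> 1\<close> keeps the origin, where the quotient is a division by zero, out of the mean.
  The parameter \<open>\<eta>\<close> is that of Young's inequality for \<open>x = v + (x - v)\<close>.\<close>

lemma (in prob_space) image_sqn_ge_with_prob:
  assumes B: "chi_square_directions r l B"
    and \<theta>: "0 < \<theta>" and \<epsilon>: "0 < \<epsilon>" and \<eta>: "0 < \<eta>" and "0 \<le> \<beta>" "0 \<le> \<delta>"
  defines "K \<equiv> (1 + 1 / \<eta>) * (\<epsilon> + \<theta> * \<beta>)"
  shows "\<exists>E\<in>events.
      (\<forall>\<omega>\<in>E. (\<forall>x. image_sqn r l (B \<omega>) x \<le> \<beta> * sqn r x) \<longrightarrow> (\<forall>x. \<delta> * sqn r x \<le> image_sqn r l (B \<omega>) x)) \<and>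
      1 - 2 * exp ((1 + \<eta>) / 2 * (\<epsilon> + \<theta> * \<delta>)) * (1 / sqrt (1 + \<theta>)) ^ l * sqrt (K / \<epsilon>) ^ r \<le> prob E"
proof -
  let ?L = "PiM {..<r} (\<lambda>_. lborel :: real measure)"
  interpret L: product_sigma_finite "\<lambda>_::nat. lborel :: real measure" by standard
  interpret L': sigma_finite_measure ?L by (rule L.sigma_finite) simp
  interpret pair: pair_sigma_finite M ?L ..
  have "0 < K"
    using assms by (simp add: K_def add_pos_nonneg)
  have Bm: "(\<lambda>\<omega>. B \<omega> i k) \<in> borel_measurable M" if "i < r" "k < l" for i k
    using B that by (auto simp: chi_square_directions_def)
  note [measurable] = measurable_image_sqn[OF Bm, unfolded split_beta']
  define f where "f = (\<lambda>\<omega> x. exp (- (\<epsilon> / 2) * sqn r x - \<theta> / 2 * (image_sqn r l (B \<omega>) x / sqn r x)) *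
    indicator {1..} (sqn r x))"
  have f[measurable]: "(\<lambda>(\<omega>, x). f \<omega> x) \<in> borel_measurable (M \<Otimes>\<^sub>M ?L)"
    unfolding f_def split_beta' by measurable
  define \<Psi> where "\<Psi> \<omega> = (\<integral>\<^sup>+x. ennreal (f \<omega> x) \<partial>?L)" for \<omega>
  have \<Psi>: "\<Psi> \<in> borel_measurable M"
    unfolding \<Psi>_def by measurable
  have inner: "(\<integral>\<^sup>+\<omega>. ennreal (f \<omega> x) \<partial>M) \<le>
      ennreal ((1 / sqrt (1 + \<theta>)) ^ l) * ennreal (exp (- (\<epsilon> / 2) * sqn r x))" for x
  proof (cases "1 \<le> sqn r x")
    case False
    then show ?thesis by (simp add: f_def)
  next
    case True
    then have "sqn r x \<noteq> 0" by auto
    have "(\<integral>\<^sup>+\<omega>. ennreal (f \<omega> x) \<partial>M) = (\<integral>\<^sup>+\<omega>. ennreal (exp (- (\<epsilon> / 2) * sqn r x)) *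
        ennreal (exp (- \<theta> / 2 * (image_sqn r l (B \<omega>) x / sqn r x))) \<partial>M)"
      using True by (intro nn_integral_cong) (simp add: f_def flip: ennreal_mult exp_add)
    also have "\<dots> = ennreal (exp (- (\<epsilon> / 2) * sqn r x)) *
        (\<integral>\<^sup>+\<omega>. ennreal (exp (- \<theta> / 2 * (image_sqn r l (B \<omega>) x / sqn r x))) \<partial>M)"
    proof (rule nn_integral_cmult)
      show "(\<lambda>\<omega>. ennreal (exp (- \<theta> / 2 * (image_sqn r l (B \<omega>) x / sqn r x)))) \<in> borel_measurable M"
        using Bm unfolding image_sqn_def sqn_def by measurable
    qed
    also have "(\<integral>\<^sup>+\<omega>. ennreal (exp (- \<theta> / 2 * (image_sqn r l (B \<omega>) x / sqn r x))) \<partial>M) =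
        ennreal ((1 / sqrt (1 - - \<theta>)) ^ l)"
      using B \<open>sqn r x \<noteq> 0\<close> \<theta> by (intro chi_square_directions_mgf) auto
    finally show ?thesis by (simp add: mult.commute)
  qed
  have "(\<integral>\<^sup>+\<omega>. \<Psi> \<omega> \<partial>M) = (\<integral>\<^sup>+x. (\<integral>\<^sup>+\<omega>. ennreal (f \<omega> x) \<partial>M) \<partial>?L)"
    unfolding \<Psi>_def by (rule pair.Fubini'[symmetric]) measurable
  also have "\<dots> \<le> (\<integral>\<^sup>+x. ennreal ((1 / sqrt (1 + \<theta>)) ^ l) * ennreal (exp (- (\<epsilon> / 2) * sqn r x)) \<partial>?L)"
    by (intro nn_integral_mono inner)
  also have "\<dots> = ennreal ((1 / sqrt (1 + \<theta>)) ^ l) * ennreal (sqrt (2 * pi / \<epsilon>) ^ r)"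
    using nn_integral_exp_quadratic_PiM[of \<epsilon> "{..<r}" "\<lambda>_. 0"] \<epsilon>
    by (subst nn_integral_cmult) (simp_all add: sqn_def)
  also have "\<dots> = ennreal ((1 / sqrt (1 + \<theta>)) ^ l * sqrt (2 * pi / \<epsilon>) ^ r)"
    using \<epsilon> \<theta> by (simp add: ennreal_mult)
  finally have mean: "(\<integral>\<^sup>+\<omega>. \<Psi> \<omega> \<partial>M) \<le> ennreal ((1 / sqrt (1 + \<theta>)) ^ l * sqrt (2 * pi / \<epsilon>) ^ r)" .
  define C where "C = exp (- ((1 + \<eta>) / 2 * (\<epsilon> + \<theta> * \<delta>)))"
  define t where "t = C * (sqrt (2 * pi / K) ^ r / 2)"
  have large: "ennreal t \<le> \<Psi> \<omega>"
    if upper: "\<And>x. image_sqn r l (B \<omega>) x \<le> \<beta> * sqn r x"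
      and v0: "image_sqn r l (B \<omega>) v0 < \<delta> * sqn r v0" for \<omega> v0
  proof -
    have "0 < sqn r v0"
    proof (rule ccontr)
      assume "\<not> 0 < sqn r v0"
      then have "sqn r v0 = 0"
        using sqn_nonneg[of r v0] by linarith
      then show False
        using v0 image_sqn_nonneg[of r l "B \<omega>" v0] by simp
    qed
    define v where "v i = (1 / sqrt (sqn r v0)) * v0 i" for i
    have v: "sqn r v = 1" "image_sqn r l (B \<omega>) v \<le> \<delta>"
      unfolding v_def[abs_def] sqn_scale image_sqn_scale using \<open>0 < sqn r v0\<close> v0
      by (simp_all add: power_divide pos_divide_le_eq)
    have combine: "- (h / 2 * (e + t * d)) + - (c * (e + t * b) / 2) * S \<le> - (e / 2) * X - t / 2 * W"
      if "t / 2 * W \<le> t / 2 * (h * d + c * (b * S))" "e / 2 * X \<le> e / 2 * (h + c * S)"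
      for t W h d c b S e X :: real
      using that by (simp add: field_simps)
    have point: "C * (exp (- (K / 2) * (\<Sum>i<r. (x i - v i)\<^sup>2)) *
        indicator {x. 0 \<le> (\<Sum>i<r. v i * (x i - v i))} x) \<le> f \<omega> x" for x
    proof (cases "0 \<le> (\<Sum>i<r. v i * (x i - v i))")
      case False
      then show ?thesis by (simp add: f_def)
    next
      case True
      define y where "y i = x i - v i" for i
      have x: "x = (\<lambda>i. v i + y i)"
        by (simp add: y_def)
      have "sqn r x = sqn r v + 2 * (\<Sum>i<r. v i * y i) + sqn r y"
        unfolding x by (simp add: sqn_def power2_sum sum.distrib sum_distrib_left mult_ac)
      then have ge_1: "1 \<le> sqn r x"
        using True v sqn_nonneg[of r y] by (simp add: y_def)
      have norm_x: "sqn r x \<le> (1 + \<eta>) + (1 + 1 / \<eta>) * sqn r y"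
        using sqn_add_le[OF \<eta>, of r v y] v(1) unfolding x by simp
      have "image_sqn r l (B \<omega>) x \<le> (1 + \<eta>) * image_sqn r l (B \<omega>) v + (1 + 1 / \<eta>) * image_sqn r l (B \<omega>) y"
        using image_sqn_add_le[OF \<eta>, of r l "B \<omega>" v y] unfolding x .
      also have "\<dots> \<le> (1 + \<eta>) * \<delta> + (1 + 1 / \<eta>) * (\<beta> * sqn r y)"
        using \<eta> by (intro add_mono mult_left_mono v upper) auto
      finally have "image_sqn r l (B \<omega>) x \<le> (1 + \<eta>) * \<delta> + (1 + 1 / \<eta>) * (\<beta> * sqn r y)" .
      moreover have "image_sqn r l (B \<omega>) x / sqn r x \<le> image_sqn r l (B \<omega>) x"
        using ge_1 mult_left_mono[OF ge_1 image_sqn_nonneg[of r l "B \<omega>" x]] by (simp add: pos_divide_le_eq)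
      ultimately have "\<theta> / 2 * (image_sqn r l (B \<omega>) x / sqn r x) \<le>
          \<theta> / 2 * ((1 + \<eta>) * \<delta> + (1 + 1 / \<eta>) * (\<beta> * sqn r y))"
        using \<theta> by (intro mult_left_mono) simp_all
      moreover have "\<epsilon> / 2 * sqn r x \<le> \<epsilon> / 2 * ((1 + \<eta>) + (1 + 1 / \<eta>) * sqn r y)"
        using \<epsilon> norm_x by (intro mult_left_mono) simp_all
      ultimately have "- ((1 + \<eta>) / 2 * (\<epsilon> + \<theta> * \<delta>)) + - (K / 2) * sqn r y \<le>
          - (\<epsilon> / 2) * sqn r x - \<theta> / 2 * (image_sqn r l (B \<omega>) x / sqn r x)"
        unfolding K_def by (rule combine)
      then show ?thesis
        using True ge_1 unfolding f_def C_def
        by (simp add: sqn_def y_def flip: exp_add)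
    qed
    have "ennreal t = ennreal C * ennreal (sqrt (2 * pi / K) ^ card {..<r} / 2)"
      using \<open>0 < K\<close> by (simp add: t_def C_def flip: ennreal_mult)
    also have "\<dots> \<le> ennreal C * (\<integral>\<^sup>+x. ennreal (exp (- (K / 2) * (\<Sum>i<r. (x i - v i)\<^sup>2))) *
        indicator {x. 0 \<le> (\<Sum>i<r. v i * (x i - v i))} x \<partial>?L)"
      by (intro mult_left_mono half_nn_integral_exp_square_half_space \<open>0 < K\<close>) auto
    also have "\<dots> = (\<integral>\<^sup>+x. ennreal C * (ennreal (exp (- (K / 2) * (\<Sum>i<r. (x i - v i)\<^sup>2))) *
        indicator {x. 0 \<le> (\<Sum>i<r. v i * (x i - v i))} x) \<partial>?L)"
      by (rule nn_integral_cmult[symmetric]) (simp add: indicator_def, measurable)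
    also have "\<dots> \<le> \<Psi> \<omega>"
      unfolding \<Psi>_def
    proof (intro nn_integral_mono)
      fix x
      have "ennreal C * (ennreal (exp (- (K / 2) * (\<Sum>i<r. (x i - v i)\<^sup>2))) *
          indicator {x. 0 \<le> (\<Sum>i<r. v i * (x i - v i))} x) =
          ennreal (C * (exp (- (K / 2) * (\<Sum>i<r. (x i - v i)\<^sup>2)) *
          indicator {x. 0 \<le> (\<Sum>i<r. v i * (x i - v i))} x))"
        by (auto simp: indicator_def C_def ennreal_mult)
      also have "\<dots> \<le> ennreal (f \<omega> x)"
        by (intro ennreal_leI point)
      finally show "ennreal C * (ennreal (exp (- (K / 2) * (\<Sum>i<r. (x i - v i)\<^sup>2))) *
          indicator {x. 0 \<le> (\<Sum>i<r. v i * (x i - v i))} x) \<le> ennreal (f \<omega> x)" .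
    qed
    finally show ?thesis .
  qed
  let ?a = "(1 / sqrt (1 + \<theta>)) ^ l * sqrt (2 * pi / \<epsilon>) ^ r"
  have quotient: "b * s ^ r / (exp (- h) * (s' ^ r / 2)) = 2 * exp h * b * (s / s') ^ r" for b s s' h :: real
  proof -
    have "inverse (exp (- h)) = exp h"
      by (simp flip: exp_minus)
    then show ?thesis
      by (simp only: divide_inverse power_mult_distrib power_inverse inverse_mult_distrib inverse_inverse_eq mult_ac)
  qed
  have "?a / t = 2 * exp ((1 + \<eta>) / 2 * (\<epsilon> + \<theta> * \<delta>)) * (1 / sqrt (1 + \<theta>)) ^ l * (sqrt (2 * pi / \<epsilon>) / sqrt (2 * pi / K)) ^ r"
    unfolding t_def C_def by (rule quotient)
  also have "sqrt (2 * pi / \<epsilon>) / sqrt (2 * pi / K) = sqrt (K / \<epsilon>)"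
    using \<open>0 < K\<close> \<epsilon> by (simp add: real_sqrt_divide)
  finally have ratio: "?a / t = 2 * exp ((1 + \<eta>) / 2 * (\<epsilon> + \<theta> * \<delta>)) * (1 / sqrt (1 + \<theta>)) ^ l * sqrt (K / \<epsilon>) ^ r" .
  have "0 < t" "0 \<le> ?a"
    using \<open>0 < K\<close> \<epsilon> \<theta> by (auto simp: t_def C_def)
  note Markov = prob_less_ge[OF \<Psi> mean \<open>0 \<le> ?a\<close> \<open>0 < t\<close>]
  show ?thesis
  proof (intro bexI[OF _ Markov(1)] conjI ballI impI allI)
    fix \<omega> x assume \<omega>: "\<omega> \<in> {\<omega> \<in> space M. \<Psi> \<omega> < ennreal t}"
      and upper: "\<forall>x. image_sqn r l (B \<omega>) x \<le> \<beta> * sqn r x"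
    show "\<delta> * sqn r x \<le> image_sqn r l (B \<omega>) x"
    proof (rule leI, rule notI)
      assume "image_sqn r l (B \<omega>) x < \<delta> * sqn r x"
      then have "ennreal t \<le> \<Psi> \<omega>"
        using upper by (intro large) auto
      then show False
        using \<omega> by (simp add: leD)
    qed
  qed (use Markov(2) ratio in simp)
qed

text \<open>Chernoff's bound for one fixed direction. It settles the case \<open>r = 1\<close>, in which all directions
  are proportional and the constants lost by the integral argument would be too large for small \<open>l\<close>.\<close>

lemma (in prob_space) image_sqn_ge_single_direction:
  assumes B: "chi_square_directions r l B" and x: "sqn r x \<noteq> 0" and \<theta>: "0 < \<theta>"
  shows "\<exists>E\<in>events. (\<forall>\<omega>\<in>E. \<delta> * sqn r x \<le> image_sqn r l (B \<omega>) x) \<and>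
    1 - exp (\<theta> * \<delta> / 2) * (1 / sqrt (1 + \<theta>)) ^ l \<le> prob E"
proof -
  have Bm: "(\<lambda>\<omega>. B \<omega> i k) \<in> borel_measurable M" if "i < r" "k < l" for i k
    using B that by (auto simp: chi_square_directions_def)
  define \<Psi> where "\<Psi> \<omega> = ennreal (exp (- \<theta> / 2 * (image_sqn r l (B \<omega>) x / sqn r x)))" for \<omega>
  have \<Psi>: "\<Psi> \<in> borel_measurable M"
    using Bm unfolding \<Psi>_def image_sqn_def sqn_def by measurable
  have "(\<integral>\<^sup>+\<omega>. \<Psi> \<omega> \<partial>M) = ennreal ((1 / sqrt (1 - - \<theta>)) ^ l)"
    unfolding \<Psi>_def using B x \<theta> by (intro chi_square_directions_mgf) auto
  then have mean: "(\<integral>\<^sup>+\<omega>. \<Psi> \<omega> \<partial>M) \<le> ennreal ((1 / sqrt (1 + \<theta>)) ^ l)"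
    by simp
  have nonneg: "0 \<le> (1 / sqrt (1 + \<theta>)) ^ l"
    using \<theta> by simp
  note Markov = prob_less_ge[OF \<Psi> mean nonneg exp_gt_zero[of "- \<theta> / 2 * \<delta>"]]
  have "0 < sqn r x" using x sqn_nonneg[of r x] by linarith
  show ?thesis
  proof (intro bexI[OF _ Markov(1)] conjI ballI)
    fix \<omega> assume "\<omega> \<in> {\<omega> \<in> space M. \<Psi> \<omega> < ennreal (exp (- \<theta> / 2 * \<delta>))}"
    then show "\<delta> * sqn r x \<le> image_sqn r l (B \<omega>) x"
      using \<theta> \<open>0 < sqn r x\<close> by (simp add: \<Psi>_def ennreal_less_iff pos_less_divide_eq)
  next
    have "exp (- \<theta> / 2 * \<delta>) = inverse (exp (\<theta> * \<delta> / 2))"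
      by (simp flip: exp_minus)
    then have "(1 / sqrt (1 + \<theta>)) ^ l / exp (- \<theta> / 2 * \<delta>) = exp (\<theta> * \<delta> / 2) * (1 / sqrt (1 + \<theta>)) ^ l"
      by (simp only: divide_inverse inverse_inverse_eq mult.commute)
    then show "1 - exp (\<theta> * \<delta> / 2) * (1 / sqrt (1 + \<theta>)) ^ l \<le>
        prob {\<omega> \<in> space M. \<Psi> \<omega> < ennreal (exp (- \<theta> / 2 * \<delta>))}"
      using Markov(2) by (simp only:)
  qed
qed

section \<open>Explicit constants\<close>

lemma inverse_sqrt_power_le_exp:
  assumes "0 < c" "1 / c \<le> exp h"
  shows "(1 / sqrt c) ^ k \<le> exp (h / 2 * real k)"
proof -
  have "1 / sqrt c = sqrt (1 / c)"
    by (simp add: real_sqrt_divide)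
  also have "\<dots> \<le> sqrt (exp h)"
    using assms(2) by (rule real_sqrt_le_mono)
  also have "sqrt (exp h) = exp (h / 2)"
    by (rule real_sqrt_unique) (simp_all flip: exp_double)
  finally have "(1 / sqrt c) ^ k \<le> exp (h / 2) ^ k"
    using assms by (intro power_mono) auto
  then show ?thesis
    by (simp only: exp_of_nat2_mult)
qed

text \<open>Lower bounds for \<open>exp x\<close> at rational \<open>x\<close> that reduce to rational arithmetic: the quadratic Taylor
  polynomial at \<open>x / k\<close>, raised to the power \<open>k\<close>.\<close>

lemma le_exp_of_quadratic_Taylor_power:
  fixes x :: real
  assumes "0 \<le> x" and "c \<le> (1 + x / real k + (x / real k)\<^sup>2 / 2) ^ k" "0 < k"
  shows "c \<le> exp x"
proof -
  have "(1 + x / real k + (x / real k)\<^sup>2 / 2) ^ k \<le> exp (x / real k) ^ k"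
    using assms by (intro power_mono exp_lower_Taylor_quadratic) auto
  also have "\<dots> = exp x"
    using assms by (simp flip: exp_of_nat_mult)
  finally show ?thesis using assms by linarith
qed

lemma exp_le_half_exp:
  fixes a t :: real
  assumes "a + 1 \<le> t"
  shows "exp a \<le> exp t / 2"
proof -
  have "2 * exp a \<le> exp 1 * exp a"
    using exp_ge_add_one_self[of 1] by (intro mult_right_mono) auto
  also have "\<dots> \<le> exp t"
    using assms by (simp flip: exp_add)
  finally show ?thesis by simp
qed

lemma (in prob_space) prob_Int_ge:
  assumes "A \<in> events" "B \<in> events" "1 - a \<le> prob A" "1 - b \<le> prob B"
  shows "A \<inter> B \<in> events" and "1 - a - b \<le> prob (A \<inter> B)"
proof -
  show "A \<inter> B \<in> events" using assms by auto
  have "prob (A \<union> B) = prob A + prob B - prob (A \<inter> B)"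
    using assms by (intro measure_Un3) (auto simp: fmeasurable_eq_sets)
  then show "1 - a - b \<le> prob (A \<inter> B)"
    using assms prob_le_1[of "A \<union> B"] by linarith
qed

text \<open>For \<open>r \<ge> 2\<close> the failure probability is split in halves between the a priori upper bound
  \<open>4 * l\<close> for the Rayleigh quotient and the lower bound \<open>l / 9\<close> that builds on it. The assumption
  \<open>22 * (r - 1) < l\<close> makes the factor that is exponential in \<open>r\<close>, the price for having to treat all directions at
  once, small against the one that is exponential in \<open>l\<close>.\<close>

lemma (in prob_space) image_sqn_ge_ninth_with_prob:
  assumes B: "chi_square_directions r l B" and dims: "0 < r" "22 * (r - 1) < l"
  shows "\<exists>E\<in>events. (\<forall>\<omega>\<in>E. \<forall>x. real l / 9 * sqn r x \<le> image_sqn r l (B \<omega>) x) \<and>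
    1 - exp (- ((real l - real r) / 20)) \<le> prob E"
proof (cases "r = 1")
  case True
  obtain E where E: "E \<in> events" "\<And>\<omega>. \<omega> \<in> E \<Longrightarrow> real l / 9 * sqn r (\<lambda>_. 1) \<le> image_sqn r l (B \<omega>) (\<lambda>_. 1)"
    and prob: "1 - exp (8 * (real l / 9) / 2) * (1 / sqrt (1 + 8)) ^ l \<le> prob E"
    using image_sqn_ge_single_direction[OF B, of "\<lambda>_. 1" 8 "real l / 9"] True by (auto simp: sqn_def)
  have "(1 / sqrt (1 + 8)) ^ l = (1 / 3 :: real) ^ l"
    using real_sqrt_abs[of 3] by simp
  also have "\<dots> \<le> exp (- 1) ^ l"
    using exp_le by (intro power_mono) (simp_all add: exp_minus field_simps)
  finally have "exp (8 * (real l / 9) / 2) * (1 / sqrt (1 + 8)) ^ l \<le> exp (8 * (real l / 9) / 2) * exp (- real l)"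
    by (intro mult_left_mono) (simp_all flip: exp_of_nat_mult)
  also have "\<dots> \<le> exp (- ((real l - real r) / 20))"
    using True by (simp flip: exp_add)
  finally have "1 - exp (- ((real l - real r) / 20)) \<le> prob E"
    using prob by linarith
  moreover have "real l / 9 * sqn r x \<le> image_sqn r l (B \<omega>) x" if "\<omega> \<in> E" for \<omega> x
    using mult_left_mono[OF E(2)[OF that], of "(x 0)\<^sup>2"] True
      sqn_scale[of r "x 0" "\<lambda>_. 1"] image_sqn_scale[of r l "B \<omega>" "x 0" "\<lambda>_. 1"]
    by (simp add: sqn_def image_sqn_def mult_ac)
  ultimately show ?thesis
    using E(1) by blast
next
  case False
  with dims have r: "2 \<le> r" by linarith
  have l: "22 * real r - 21 \<le> real l"
  proof -
    have "22 * r \<le> l + 21" using dims by linarith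
    then have "real (22 * r) \<le> real (l + 21)" by (simp only: of_nat_le_iff)
    then show ?thesis by simp
  qed
  have "0 < l" using dims by simp
  \<comment> \<open>The values \<open>p = 4/5\<close> and \<open>\<theta> = 7/10\<close> leave a rate of about \<open>0.47 * l\<close> against \<open>0.88 * r\<close>.\<close>
  let ?t = "- ((real l - real r) / 20)"
  obtain E1 where E1: "E1 \<in> events" "\<And>\<omega> x. \<omega> \<in> E1 \<Longrightarrow> image_sqn r l (B \<omega>) x \<le> 4 * real l * sqn r x"
    and prob1: "1 - (1 / sqrt (1 - 4 / 5)) ^ r * (1 / sqrt (1 - 7 / 10)) ^ l *
      exp (- (4 / 5 * (7 / 10) * (4 * real l) / 2)) \<le> prob E1"
    using image_sqn_le_with_prob[OF B, of "4 / 5" "7 / 10" "4 * real l"] by auto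
  have num: "1 / (1 - 4 / 5) \<le> exp (7 / 4 :: real)" "1 / (1 - 7 / 10) \<le> exp (13 / 10 :: real)"
      "1 / (1 / 1243) \<le> exp (29 / 4 :: real)" "4 \<le> exp (7 / 5 :: real)"
    by (rule le_exp_of_quadratic_Taylor_power[where k = 32], simp, simp add: power2_eq_square power_divide, simp)+
  have "(1 / sqrt (1 - 4 / 5)) ^ r * (1 / sqrt (1 - 7 / 10)) ^ l * exp (- (4 / 5 * (7 / 10) * (4 * real l) / 2)) \<le>
      exp (7 / 4 / 2 * real r) * exp (13 / 10 / 2 * real l) * exp (- (4 / 5 * (7 / 10) * (4 * real l) / 2))"
    by (intro mult_mono inverse_sqrt_power_le_exp num(1,2)) simp_all
  also have "\<dots> = exp (7 / 8 * real r - 47 / 100 * real l)"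
    by (simp flip: exp_add)
  also have "\<dots> \<le> exp ?t / 2"
    using l r by (intro exp_le_half_exp) (simp add: field_simps)
  finally have prob1': "1 - exp ?t / 2 \<le> prob E1"
    using prob1 by linarith
  \<comment> \<open>The values \<open>\<theta> = 7\<close>, \<open>\<epsilon> = l / 4\<close> and \<open>\<eta> = 1 / 10\<close> are tuned to the tightest case
    \<open>r = 2\<close>, \<open>l = 23\<close>; they give \<open>K / \<epsilon> = 11 * 113 = 1243\<close>.\<close>
  let ?K = "(1 + 1 / (1 / 10)) * (real l / 4 + 7 * (4 * real l))"
  obtain E2 where E2: "E2 \<in> events"
      "\<And>\<omega> x. \<omega> \<in> E2 \<Longrightarrow> (\<And>x. image_sqn r l (B \<omega>) x \<le> 4 * real l * sqn r x) \<Longrightarrow>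
        real l / 9 * sqn r x \<le> image_sqn r l (B \<omega>) x"
    and prob2: "1 - 2 * exp ((1 + 1 / 10) / 2 * (real l / 4 + 7 * (real l / 9))) * (1 / sqrt (1 + 7)) ^ l *
      sqrt (?K / (real l / 4)) ^ r \<le> prob E2"
    using image_sqn_ge_with_prob[OF B, of 7 "real l / 4" "1 / 10" "4 * real l" "real l / 9"] \<open>0 < l\<close>
    by auto
  have ln8: "1 / (1 + 7) \<le> exp (- 2 :: real)"
  proof -
    have "exp 2 = exp 1 * exp (1 :: real)"
      by (simp flip: exp_add)
    also have "\<dots> \<le> 2.72 * 2.72"
      using e_less_272 by (intro mult_mono) auto
    finally show ?thesis
      by (simp add: exp_minus field_simps)
  qed
  have "sqrt (?K / (real l / 4)) = 1 / sqrt (1 / 1243)"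
    using \<open>0 < l\<close> by (simp add: real_sqrt_divide)
  then have "2 * exp ((1 + 1 / 10) / 2 * (real l / 4 + 7 * (real l / 9))) * (1 / sqrt (1 + 7)) ^ l *
      sqrt (?K / (real l / 4)) ^ r =
    2 * exp ((1 + 1 / 10) / 2 * (real l / 4 + 7 * (real l / 9))) * (1 / sqrt (1 + 7)) ^ l *
      (1 / sqrt (1 / 1243)) ^ r"
    by (simp only:)
  also have "\<dots> \<le> (exp (7 / 5) / 2) * exp ((1 + 1 / 10) / 2 * (real l / 4 + 7 * (real l / 9))) *
      exp (- 2 / 2 * real l) * exp (29 / 4 / 2 * real r)"
    using num(4) by (intro mult_mono inverse_sqrt_power_le_exp num(3) ln8) simp_all
  also have "\<dots> = exp (7 / 5 + 11 / 20 * (37 / 36) * real l - real l + 29 / 8 * real r) / 2"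
    by (simp add: exp_add[symmetric] field_simps)
  also have "\<dots> \<le> exp ?t / 2"
    using l r by (simp add: field_simps)
  finally have prob2': "1 - exp ?t / 2 \<le> prob E2"
    using prob2 by linarith
  note E = prob_Int_ge[OF E1(1) E2(1) prob1' prob2']
  show ?thesis
  proof (intro bexI[OF _ E(1)] conjI ballI allI)
    fix \<omega> x assume "\<omega> \<in> E1 \<inter> E2"
    then show "real l / 9 * sqn r x \<le> image_sqn r l (B \<omega>) x"
      using E1(2) E2(2) by auto
  qed (use E(2) in simp)
qed

text \<open>The ratio of the two bounds is \<open>16 * n / l\<close>, the quantity under the root in
  the claim: the norm of the Gaussian matrix is at most \<open>4 / 3 * sqrt n\<close>, and the least
  singular value of its product with \<open>Z\<close> is at least \<open>sqrt l / 3\<close>. The first is the general upper tail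
  bound for \<open>Z\<close> the identity matrix.\<close>

lemma (in prob_space) gaussian_conditioning:
  fixes \<xi> :: "nat \<times> nat \<Rightarrow> 'a \<Rightarrow> real" and Z :: "nat \<Rightarrow> nat \<Rightarrow> real"
  assumes indep: "indep_vars (\<lambda>_. borel) \<xi> ({..<r} \<times> {..<n})"
    and normal: "\<And>i j. i < r \<Longrightarrow> j < n \<Longrightarrow> distributed M lborel (\<xi> (i, j)) std_normal_density"
    and Z: "\<And>k k'. k < l \<Longrightarrow> k' < l \<Longrightarrow> (\<Sum>j<n. Z j k * Z j k') = (if k = k' then 1 else 0)"
    and dims: "0 < r" "36 * r < n" "22 * (r - 1) < l"
  shows "\<exists>E\<in>events.
    (\<forall>\<omega>\<in>E. (\<forall>x. image_sqn r n (\<lambda>i j. \<xi> (i, j) \<omega>) x \<le> 16 / 9 * real n * sqn r x) \<and>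
      (\<forall>x. real l / 9 * sqn r x \<le> image_sqn r l (\<lambda>i k. \<Sum>j<n. \<xi> (i, j) \<omega> * Z j k) x)) \<and>
    1 - exp (- (real n / 72)) - exp (- ((real l - real r) / 20)) \<le> prob E"
proof -
  have "chi_square_directions r n (\<lambda>\<omega> i k. \<Sum>j<n. \<xi> (i, j) \<omega> * (if j = k then 1 else 0))"
    by (rule chi_square_directions_gaussian[OF indep normal]) (auto simp: if_distrib[of "\<lambda>u. _ * u"] cong: if_cong)
  \<comment> \<open>With \<open>p\<close> close to \<open>1\<close> little is lost in the exponent of \<open>n\<close>, while \<open>(1 - p)\<close> enters only with
    the power \<open>r / 2 < n / 72\<close>.\<close>
  from image_sqn_le_with_prob[OF this, of "19 / 20" "2 / 5" "16 / 9 * real n"]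
  obtain E1 where E1: "E1 \<in> events"
      "\<And>\<omega> x. \<omega> \<in> E1 \<Longrightarrow> image_sqn r n (\<lambda>i k. \<Sum>j<n. \<xi> (i, j) \<omega> * (if j = k then 1 else 0)) x \<le> 16 / 9 * real n * sqn r x"
    and prob1: "1 - (1 / sqrt (1 - 19 / 20)) ^ r * (1 / sqrt (1 - 2 / 5)) ^ n *
      exp (- (19 / 20 * (2 / 5) * (16 / 9 * real n) / 2)) \<le> prob E1"
    by auto
  have num: "1 / (1 - 19 / 20) \<le> exp (7 / 2 :: real)" "1 / (1 - 2 / 5) \<le> exp (27 / 50 :: real)"
    by (rule le_exp_of_quadratic_Taylor_power[where k = 7], simp, simp add: power2_eq_square power_divide, simp)+
  have "(1 / sqrt (1 - 19 / 20)) ^ r * (1 / sqrt (1 - 2 / 5)) ^ n * exp (- (19 / 20 * (2 / 5) * (16 / 9 * real n) / 2))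
      \<le> exp (7 / 2 / 2 * real r) * exp (27 / 50 / 2 * real n) * exp (- (19 / 20 * (2 / 5) * (16 / 9 * real n) / 2))"
    by (intro mult_mono inverse_sqrt_power_le_exp num) simp_all
  also have "\<dots> \<le> exp (- (real n / 72))"
    using dims by (simp flip: exp_add)
  finally have prob1': "1 - exp (- (real n / 72)) \<le> prob E1"
    using prob1 by linarith
  obtain E2 where E2: "E2 \<in> events"
      "\<And>\<omega> x. \<omega> \<in> E2 \<Longrightarrow> real l / 9 * sqn r x \<le> image_sqn r l (\<lambda>i k. \<Sum>j<n. \<xi> (i, j) \<omega> * Z j k) x"
    and prob2: "1 - exp (- ((real l - real r) / 20)) \<le> prob E2"
    using image_sqn_ge_ninth_with_prob[OF chi_square_directions_gaussian[OF indep normal Z] dims(1,3)] by blast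
  note E = prob_Int_ge[OF E1(1) E2(1) prob1' prob2]
  have single: "image_sqn r n (\<lambda>i k. \<Sum>j<n. \<xi> (i, j) \<omega> * (if j = k then 1 else 0)) x =
      image_sqn r n (\<lambda>i j. \<xi> (i, j) \<omega>) x" for \<omega> x
    by (simp add: image_sqn_def sqn_def if_distrib cong: if_cong)
  show ?thesis
    using E1(2) E2(2) unfolding single by (intro bexI[OF _ E(1)] conjI ballI allI E(2)) auto
qed

section \<open>Norms of real matrices\<close>

abbreviation nsq :: "real Matrix.vec \<Rightarrow> real" where
  "nsq v \<equiv> scalar_prod v v"

lemma nsq_eq_sum: "nsq v = (\<Sum>i<dim_vec v. (v $ i)\<^sup>2)"
  by (simp add: scalar_prod_def power2_eq_square atLeast0LessThan)

lemma nsq_nonneg [simp]: "0 \<le> nsq v"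
  by (simp add: nsq_eq_sum sum_nonneg)

lemma nsq_eq_0_iff: "v \<in> carrier_vec n \<Longrightarrow> nsq v = 0 \<longleftrightarrow> v = 0\<^sub>v n"
  by (auto simp: nsq_eq_sum sum_nonneg_eq_0_iff intro!: eq_vecI)

lemma Cauchy_Schwarz_scalar_prod:
  fixes u v :: "real Matrix.vec"
  assumes "u \<in> carrier_vec n" "v \<in> carrier_vec n"
  shows "(scalar_prod u v)\<^sup>2 \<le> nsq u * nsq v"
  using assms Cauchy_Schwarz_ineq_sum[of "\<lambda>i. u $ i" "\<lambda>i. v $ i" "{0..<n}"]
  by (simp add: scalar_prod_def power2_eq_square)

lemma nsq_smult: "nsq (c \<cdot>\<^sub>v v) = c\<^sup>2 * nsq v"
  by (simp add: nsq_eq_sum power_mult_distrib sum_distrib_left)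

lemma nsq_mult_mat_vec:
  assumes "A \<in> carrier_mat m n" "x \<in> carrier_vec n"
  shows "nsq (A *\<^sub>v x) = scalar_prod x (transpose_mat A *\<^sub>v (A *\<^sub>v x))"
  using assms transpose_vec_mult_scalar[of A m n x "A *\<^sub>v x"]
  by (simp add: comm_scalar_prod[of x n])

text \<open>For \<open>c \<ge> 0\<close>, the spectral norm of \<open>A\<close> is at most \<open>sqrt c\<close>. The square of the norm is bounded, without a supremum, so that
  proofs stay within sums of squares.\<close>

definition op_bound :: "real mat \<Rightarrow> real \<Rightarrow> bool" where
  "op_bound A c \<longleftrightarrow> (\<forall>v\<in>carrier_vec (dim_col A). nsq (A *\<^sub>v v) \<le> c * nsq v)"

lemma op_boundD: "op_bound A c \<Longrightarrow> A \<in> carrier_mat m n \<Longrightarrow> v \<in> carrier_vec n \<Longrightarrow> nsq (A *\<^sub>v v) \<le> c * nsq v"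
  by (auto simp: op_bound_def)

lemma op_boundI:
  "A \<in> carrier_mat m n \<Longrightarrow> (\<And>v. v \<in> carrier_vec n \<Longrightarrow> nsq (A *\<^sub>v v) \<le> c * nsq v) \<Longrightarrow> op_bound A c"
  by (auto simp: op_bound_def)

text \<open>With \<open>z\<close> the image of \<open>y\<close> under the transpose, \<open>|z|\<^sup>2\<close> is the pairing of \<open>y\<close> with \<open>A z\<close>, and Cauchy-Schwarz
  lets one factor \<open>|z|\<close> cancel.\<close>

lemma op_bound_transpose:
  assumes "op_bound A c" "0 \<le> c"
  shows "op_bound (transpose_mat A) c"
proof (rule op_boundI)
  have A: "A \<in> carrier_mat (dim_row A) (dim_col A)" by auto
  show "transpose_mat A \<in> carrier_mat (dim_col A) (dim_row A)" by auto
  fix y :: "real Matrix.vec" assume y: "y \<in> carrier_vec (dim_row A)"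
  define z where "z = transpose_mat A *\<^sub>v y"
  have z: "z \<in> carrier_vec (dim_col A)"
    unfolding z_def using y by (intro mult_mat_vec_carrier) auto
  have "nsq z = scalar_prod y (A *\<^sub>v z)"
    using transpose_vec_mult_scalar[OF A z y] unfolding z_def[symmetric] .
  then have "nsq z * nsq z \<le> nsq y * nsq (A *\<^sub>v z)"
    using Cauchy_Schwarz_scalar_prod[OF y mult_mat_vec_carrier[OF A z]] by (simp add: power2_eq_square)
  also have "\<dots> \<le> nsq y * (c * nsq z)"
    by (intro mult_left_mono op_boundD[OF assms(1) A z]) auto
  finally have "nsq z * nsq z \<le> (c * nsq y) * nsq z"
    by (simp add: mult_ac)
  moreover have "0 \<le> c * nsq y"
    using \<open>0 \<le> c\<close> by simp
  ultimately show "nsq (transpose_mat A *\<^sub>v y) \<le> c * nsq y"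
    unfolding z_def[symmetric] using nsq_nonneg[of z] by (cases "nsq z = 0") auto
qed

lemma op_bound_mult:
  assumes "op_bound A c" "op_bound B d" "0 \<le> c" "A \<in> carrier_mat m n" "B \<in> carrier_mat n k"
  shows "op_bound (A * B) (c * d)"
proof (rule op_boundI)
  show "A * B \<in> carrier_mat m k" using assms by auto
  fix v :: "real Matrix.vec" assume v: "v \<in> carrier_vec k"
  have "nsq (A * B *\<^sub>v v) = nsq (A *\<^sub>v (B *\<^sub>v v))"
    using assms v by simp
  also have "\<dots> \<le> c * nsq (B *\<^sub>v v)"
    using assms v by (intro op_boundD) auto
  also have "\<dots> \<le> c * (d * nsq v)"
    using assms v by (intro mult_left_mono op_boundD) auto
  finally show "nsq (A * B *\<^sub>v v) \<le> c * d * nsq v" by (simp add: mult.assoc)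
qed

lemma orthonormal_columns_iff:
  assumes "A \<in> carrier_mat m n"
  shows "orthonormal_columns A \<longleftrightarrow> transpose_mat A * A = 1\<^sub>m n"
proof
  assume "orthonormal_columns A"
  then show "transpose_mat A * A = 1\<^sub>m n"
    using assms by (intro eq_matI) (auto simp: orthonormal_columns_def)
next
  assume eq: "transpose_mat A * A = 1\<^sub>m n"
  show "orthonormal_columns A"
    unfolding orthonormal_columns_def
  proof (intro allI impI)
    fix i j assume ij: "i < dim_col A" "j < dim_col A"
    have "scalar_prod (Matrix.col A i) (Matrix.col A j) = (transpose_mat A * A) $$ (i, j)"
      using ij assms by auto
    then show "scalar_prod (Matrix.col A i) (Matrix.col A j) = (if i = j then 1 else 0)"
      unfolding eq using ij assms by auto
  qed
qed

lemma nsq_isometry: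
  assumes "A \<in> carrier_mat m n" "transpose_mat A * A = 1\<^sub>m n" "v \<in> carrier_vec n"
  shows "nsq (A *\<^sub>v v) = nsq v"
proof -
  have "transpose_mat A *\<^sub>v (A *\<^sub>v v) = v"
    using assms assoc_mult_mat_vec[of "transpose_mat A" n m A n v] by simp
  then show ?thesis
    using nsq_mult_mat_vec[OF assms(1,3)] by simp
qed

lemma op_bound_isometry:
  assumes "A \<in> carrier_mat m n" "transpose_mat A * A = 1\<^sub>m n"
  shows "op_bound A 1"
  using assms by (intro op_boundI[OF assms(1)]) (simp add: nsq_isometry)

lemma op_bound_isometry_transpose:
  assumes "A \<in> carrier_mat m n" "transpose_mat A * A = 1\<^sub>m n"
  shows "op_bound (transpose_mat A) 1"
  using assms by (intro op_bound_transpose op_bound_isometry) auto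

lemma frobenius_norm_sq_rows:
  assumes "A \<in> carrier_mat m n"
  shows "(frobenius_norm A)\<^sup>2 = (\<Sum>i<m. nsq (Matrix.row A i))"
  using assms by (simp add: frobenius_norm_def sum_nonneg nsq_eq_sum)

lemma frobenius_norm_sq_cols:
  assumes "A \<in> carrier_mat m n"
  shows "(frobenius_norm A)\<^sup>2 = (\<Sum>j<n. nsq (Matrix.col A j))"
  using assms by (simp add: frobenius_norm_def sum_nonneg nsq_eq_sum) (rule sum.swap)

lemma frobenius_norm_nonneg [simp]: "0 \<le> frobenius_norm A"
  by (simp add: frobenius_norm_def sum_nonneg)

lemma frobenius_norm_transpose: "frobenius_norm (transpose_mat A) = frobenius_norm A"
  by (simp add: frobenius_norm_def) (rule sum.swap)

lemma frobenius_norm_mult_left: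
  assumes "op_bound A c" "0 \<le> c" "A \<in> carrier_mat m n" "B \<in> carrier_mat n k"
  shows "frobenius_norm (A * B) \<le> sqrt c * frobenius_norm B"
proof -
  have "(frobenius_norm (A * B))\<^sup>2 = (\<Sum>j<k. nsq (A *\<^sub>v Matrix.col B j))"
    unfolding frobenius_norm_sq_cols[OF mult_carrier_mat[OF assms(3,4)]]
    by (intro sum.cong refl) (simp only: lessThan_iff col_mult2[OF assms(3,4)])
  also have "\<dots> \<le> (\<Sum>j<k. c * nsq (Matrix.col B j))"
    using assms by (intro sum_mono op_boundD) auto
  also have "\<dots> = (sqrt c * frobenius_norm B)\<^sup>2"
    using assms frobenius_norm_sq_cols[OF assms(4)] by (simp add: power_mult_distrib sum_distrib_left)
  finally show ?thesis
    by (rule power2_le_imp_le) (use assms in simp)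
qed

lemma frobenius_norm_mult_right:
  assumes "op_bound B c" "0 \<le> c" "A \<in> carrier_mat m n" "B \<in> carrier_mat n k"
  shows "frobenius_norm (A * B) \<le> sqrt c * frobenius_norm A"
proof -
  have "transpose_mat (A * B) = transpose_mat B * transpose_mat A"
    using assms by (simp add: transpose_mult)
  then show ?thesis
    using frobenius_norm_mult_left[OF op_bound_transpose[OF assms(1,2)] assms(2), of k n "transpose_mat A" m] assms
    by (metis frobenius_norm_transpose transpose_carrier_mat)
qed

text \<open>This makes the supremum in the spectral norm finite.\<close>

lemma op_bound_frobenius: "op_bound A ((frobenius_norm A)\<^sup>2)"
proof (rule op_boundI)
  show A: "A \<in> carrier_mat (dim_row A) (dim_col A)" by auto
  fix v :: "real Matrix.vec" assume v: "v \<in> carrier_vec (dim_col A)"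
  have "nsq (A *\<^sub>v v) = (\<Sum>i<dim_row A. (scalar_prod (Matrix.row A i) v)\<^sup>2)"
    by (simp add: nsq_eq_sum)
  also have "\<dots> \<le> (\<Sum>i<dim_row A. nsq (Matrix.row A i) * nsq v)"
    using v by (intro sum_mono Cauchy_Schwarz_scalar_prod[where n = "dim_col A"]) auto
  finally show "nsq (A *\<^sub>v v) \<le> (frobenius_norm A)\<^sup>2 * nsq v"
    using frobenius_norm_sq_rows[OF A] by (simp add: sum_distrib_right)
qed

lemma spectral_norm_le_iff:
  assumes "0 \<le> c"
  shows "spectral_norm A \<le> c \<longleftrightarrow> op_bound A (c\<^sup>2)"
proof -
  let ?S = "{euclid_norm (A *\<^sub>v v) | v. v \<in> carrier_vec (dim_col A) \<and> euclid_norm v \<le> 1}"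
  have bound: "x \<le> d" if "op_bound A (d\<^sup>2)" "0 \<le> d" and x: "x \<in> ?S" for x d
  proof -
    obtain v where v: "v \<in> carrier_vec (dim_col A)" "nsq v \<le> 1" "x = sqrt (nsq (A *\<^sub>v v))"
      using x by (auto simp: euclid_norm_def)
    have "nsq (A *\<^sub>v v) \<le> d\<^sup>2 * nsq v"
      using that(1) v(1) by (auto simp: op_bound_def)
    also have "\<dots> \<le> d\<^sup>2 * 1"
      using v by (intro mult_left_mono) auto
    finally show ?thesis
      using v(3) that(2) by (simp add: real_le_lsqrt)
  qed
  have bdd: "bdd_above ?S"
    using bound[OF op_bound_frobenius frobenius_norm_nonneg] by (rule bdd_aboveI)
  have "0\<^sub>v (dim_col A) \<in> carrier_vec (dim_col A)" "euclid_norm (0\<^sub>v (dim_col A)) \<le> 1"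
    by (auto simp: euclid_norm_def)
  then have ne: "?S \<noteq> {}" by blast
  show ?thesis
  proof
    assume "op_bound A (c\<^sup>2)"
    then show "spectral_norm A \<le> c"
      unfolding spectral_norm_def using bound assms by (intro cSup_least[OF ne]) blast
  next
    assume le: "spectral_norm A \<le> c"
    show "op_bound A (c\<^sup>2)"
      unfolding op_bound_def
    proof
      fix v :: "real Matrix.vec" assume v: "v \<in> carrier_vec (dim_col A)"
      show "nsq (A *\<^sub>v v) \<le> c\<^sup>2 * nsq v"
      proof (cases "nsq v = 0")
        case True
        then have "v = 0\<^sub>v (dim_col A)"
          using nsq_eq_0_iff[OF v] by simp
        then have "A *\<^sub>v v = 0\<^sub>v (dim_row A)"
          by auto
        then show ?thesis using True by simp
      next
        case False
        define s where "s = 1 / sqrt (nsq v)"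
        have s: "s\<^sup>2 * nsq v = 1"
          using False by (simp add: s_def power_divide)
        have "euclid_norm (A *\<^sub>v (s \<cdot>\<^sub>v v)) \<in> ?S"
          using v s by (auto simp: euclid_norm_def nsq_smult intro!: exI[of _ "s \<cdot>\<^sub>v v"])
        then have "euclid_norm (A *\<^sub>v (s \<cdot>\<^sub>v v)) \<le> c"
          using le bdd unfolding spectral_norm_def by (meson cSup_upper order_trans)
        moreover have "A *\<^sub>v (s \<cdot>\<^sub>v v) = s \<cdot>\<^sub>v (A *\<^sub>v v)"
          using v by (intro mult_mat_vec) auto
        ultimately have "sqrt (s\<^sup>2 * nsq (A *\<^sub>v v)) \<le> c"
          by (simp add: euclid_norm_def nsq_smult)
        then have "s\<^sup>2 * nsq (A *\<^sub>v v) \<le> c\<^sup>2"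
          by (rule sqrt_le_D)
        then have "nsq v * (s\<^sup>2 * nsq (A *\<^sub>v v)) \<le> nsq v * c\<^sup>2"
          by (intro mult_left_mono) auto
        also have "nsq v * (s\<^sup>2 * nsq (A *\<^sub>v v)) = nsq (A *\<^sub>v v)"
          using s by (metis mult.assoc mult.commute mult_1)
        finally show ?thesis by (simp add: mult.commute)
      qed
    qed
  qed
qed

lemma spectral_norm_nonneg [simp]: "0 \<le> spectral_norm A"
proof (rule ccontr)
  assume "\<not> 0 \<le> spectral_norm A"
  then have "op_bound A (0\<^sup>2)"
    by (subst spectral_norm_le_iff[symmetric]) auto
  have "euclid_norm (A *\<^sub>v 0\<^sub>v (dim_col A)) \<le> spectral_norm A"
    unfolding spectral_norm_def
  proof (rule cSup_upper)
    show "euclid_norm (A *\<^sub>v 0\<^sub>v (dim_col A)) \<in>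
        {euclid_norm (A *\<^sub>v v) |v. v \<in> carrier_vec (dim_col A) \<and> euclid_norm v \<le> 1}"
      by (intro CollectI exI[of _ "0\<^sub>v (dim_col A)"]) (auto simp: euclid_norm_def)
    show "bdd_above {euclid_norm (A *\<^sub>v v) |v. v \<in> carrier_vec (dim_col A) \<and> euclid_norm v \<le> 1}"
    proof (rule bdd_aboveI)
      fix x assume "x \<in> {euclid_norm (A *\<^sub>v v) |v. v \<in> carrier_vec (dim_col A) \<and> euclid_norm v \<le> 1}"
      then show "x \<le> 0"
        using \<open>op_bound A (0\<^sup>2)\<close> by (auto simp: op_bound_def euclid_norm_def)
    qed
  qed
  then show False
    using \<open>\<not> 0 \<le> spectral_norm A\<close> real_sqrt_ge_zero[OF nsq_nonneg[of "A *\<^sub>v 0\<^sub>v (dim_col A)"]]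
    unfolding euclid_norm_def by linarith
qed

lemma op_bound_spectral_norm: "op_bound A ((spectral_norm A)\<^sup>2)"
  using spectral_norm_le_iff[of "spectral_norm A" A] by simp

lemma spectral_norm_mult_left:
  assumes "op_bound A c" "0 \<le> c" "A \<in> carrier_mat m n" "B \<in> carrier_mat n k"
  shows "spectral_norm (A * B) \<le> sqrt c * spectral_norm B"
  using assms op_bound_mult[OF assms(1) op_bound_spectral_norm[of B] assms(2-4)]
  by (subst spectral_norm_le_iff) (auto simp: power_mult_distrib)

lemma spectral_norm_mult_right:
  assumes "op_bound B c" "0 \<le> c" "A \<in> carrier_mat m n" "B \<in> carrier_mat n k"
  shows "spectral_norm (A * B) \<le> sqrt c * spectral_norm A"
  using assms op_bound_mult[OF op_bound_spectral_norm[of A] assms(1) _ assms(3,4)]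
  by (subst spectral_norm_le_iff) (auto simp: power_mult_distrib mult.commute)

section \<open>Orthonormal systems, rank and the pseudo inverse\<close>

text \<open>Padding with zero rows gives a singular square matrix, with the same kernel.\<close>

lemma wide_matrix_kernel:
  fixes C :: "real mat"
  assumes C: "C \<in> carrier_mat p q" and "p < q"
  shows "\<exists>x\<in>carrier_vec q. x \<noteq> 0\<^sub>v q \<and> C *\<^sub>v x = 0\<^sub>v p"
proof -
  define D where "D = Matrix.mat q q (\<lambda>(i, j). if i < p then C $$ (i, j) else 0)"
  have D: "D \<in> carrier_mat q q" by (simp add: D_def)
  have "transpose_mat D *\<^sub>v unit_vec q (q - 1) = 0\<^sub>v q"
    using \<open>p < q\<close> by (intro eq_vecI) (auto simp: D_def scalar_prod_def sum.delta' unit_vec_def if_distrib cong: if_cong)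
  moreover have "unit_vec q (q - 1) \<noteq> (0\<^sub>v q :: real Matrix.vec)"
    using \<open>p < q\<close> by (metis diff_less index_unit_vec(2) index_zero_vec(1) less_nat_zero_code less_one not_gr_zero zero_neq_one)
  ultimately have "Determinant.det (transpose_mat D) = 0"
    using D by (intro det_0_iff_vec_prod_zero_field[THEN iffD2, of _ q] exI[of _ "unit_vec q (q - 1)"]) auto
  then have "Determinant.det D = 0"
    using det_transpose[OF D] by simp
  then obtain x where x: "x \<in> carrier_vec q" "x \<noteq> 0\<^sub>v q" "D *\<^sub>v x = 0\<^sub>v q"
    using det_0_iff_vec_prod_zero_field[OF D] by auto
  have "C *\<^sub>v x = 0\<^sub>v p"
  proof (rule eq_vecI)
    fix i assume i: "i < dim_vec (0\<^sub>v p :: real Matrix.vec)"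
    have "(C *\<^sub>v x) $ i = (D *\<^sub>v x) $ i"
      using i C x(1) \<open>p < q\<close> by (auto simp: D_def scalar_prod_def intro!: sum.cong)
    then show "(C *\<^sub>v x) $ i = 0\<^sub>v p $ i"
      using x(3) i \<open>p < q\<close> by simp
  qed (use C in auto)
  then show ?thesis using x by blast
qed

lemma injective_square_matrix_inverse:
  fixes A :: "real mat"
  assumes A: "A \<in> carrier_mat n n" and inj: "\<And>x. x \<in> carrier_vec n \<Longrightarrow> A *\<^sub>v x = 0\<^sub>v n \<Longrightarrow> x = 0\<^sub>v n"
  obtains B where "B \<in> carrier_mat n n" "A * B = 1\<^sub>m n" "B * A = 1\<^sub>m n"
proof -
  have "Determinant.det A \<noteq> 0"
    using det_0_iff_vec_prod_zero_field[OF A] inj by blast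
  from det_non_zero_imp_unit[OF A this] obtain B where "B \<in> carrier_mat n n" "B * A = 1\<^sub>m n"
    unfolding Units_def ring_mat_def by auto
  then show thesis
    using that mat_mult_left_right_inverse[of B n A] A by blast
qed

text \<open>Gram-Schmidt by counting dimensions: as long as fewer than \<open>q - p\<close> vectors have been found,
  the conditions of lying in the kernel of \<open>C\<close> and of being orthogonal, after applying \<open>H\<close>, to the
  vectors found so far are fewer than \<open>q\<close> linear equations, so they have a nonzero solution. Taking for \<open>C\<close> a
  matrix without rows orthonormalises the columns of an injective \<open>H\<close>; taking for \<open>H\<close> the identity gives
  an orthonormal system in the kernel of \<open>C\<close>.\<close>

lemma orthonormal_family_in_kernel:
  fixes C H :: "real mat"
  assumes C: "C \<in> carrier_mat p q" and H: "H \<in> carrier_mat n q"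
    and inj: "\<And>x. x \<in> carrier_vec q \<Longrightarrow> C *\<^sub>v x = 0\<^sub>v p \<Longrightarrow> H *\<^sub>v x = 0\<^sub>v n \<Longrightarrow> x = 0\<^sub>v q"
    and "p + k \<le> q"
  shows "\<exists>s. (\<forall>i<k. s i \<in> carrier_vec q \<and> C *\<^sub>v s i = 0\<^sub>v p) \<and>
    (\<forall>i<k. \<forall>j<k. scalar_prod (H *\<^sub>v s i) (H *\<^sub>v s j) = (if i = j then 1 else 0))"
  using \<open>p + k \<le> q\<close>
proof (induction k)
  case 0
  then show ?case by simp
next
  case (Suc k)
  then obtain s where s: "\<And>i. i < k \<Longrightarrow> s i \<in> carrier_vec q" "\<And>i. i < k \<Longrightarrow> C *\<^sub>v s i = 0\<^sub>v p"
    "\<And>i j. i < k \<Longrightarrow> j < k \<Longrightarrow> scalar_prod (H *\<^sub>v s i) (H *\<^sub>v s j) = (if i = j then 1 else 0)"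
    by auto
  define D where "D = Matrix.mat k q (\<lambda>(i, j). (transpose_mat H *\<^sub>v (H *\<^sub>v s i)) $ j)"
  have D: "D \<in> carrier_mat k q" by (simp add: D_def)
  have "C @\<^sub>r D \<in> carrier_mat (p + k) q"
    using C D by (rule carrier_append_rows)
  then obtain x where x: "x \<in> carrier_vec q" "x \<noteq> 0\<^sub>v q" "(C @\<^sub>r D) *\<^sub>v x = 0\<^sub>v (p + k)"
    using wide_matrix_kernel[of "C @\<^sub>r D" "p + k" q] Suc.prems by auto
  have "C *\<^sub>v x @\<^sub>v D *\<^sub>v x = 0\<^sub>v p @\<^sub>v 0\<^sub>v k"
  proof -
    have "0\<^sub>v (p + k) = 0\<^sub>v p @\<^sub>v (0\<^sub>v k :: real Matrix.vec)"
      by (intro eq_vecI) auto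
    then show ?thesis
      using x(3) mat_mult_append[OF C D x(1)] by simp
  qed
  then have Cx: "C *\<^sub>v x = 0\<^sub>v p" and Dx: "D *\<^sub>v x = 0\<^sub>v k"
    using append_vec_eq[of "C *\<^sub>v x" p "0\<^sub>v p" "D *\<^sub>v x" "0\<^sub>v k"] mult_mat_vec_carrier[OF C x(1)] by auto
  have orth: "scalar_prod (H *\<^sub>v s i) (H *\<^sub>v x) = 0" if "i < k" for i
  proof -
    have "(D *\<^sub>v x) $ i = scalar_prod (transpose_mat H *\<^sub>v (H *\<^sub>v s i)) x"
    proof -
      have "Matrix.row D i = transpose_mat H *\<^sub>v (H *\<^sub>v s i)"
        using that H by (intro eq_vecI) (auto simp: D_def)
      then show ?thesis using that D by simp
    qed
    also have "\<dots> = scalar_prod (H *\<^sub>v s i) (H *\<^sub>v x)"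
      using H x(1) s(1)[OF that] by (intro transpose_vec_mult_scalar) auto
    finally show ?thesis using Dx that by simp
  qed
  have Hx: "H *\<^sub>v x \<in> carrier_vec n" using H x(1) by auto
  have "nsq (H *\<^sub>v x) \<noteq> 0"
    using inj[OF x(1) Cx] x(2) nsq_eq_0_iff[OF Hx] by blast
  define c where "c = 1 / sqrt (nsq (H *\<^sub>v x))"
  have c: "c\<^sup>2 * nsq (H *\<^sub>v x) = 1"
    using \<open>nsq (H *\<^sub>v x) \<noteq> 0\<close> by (simp add: c_def power_divide)
  define s' where "s' i = (if i < k then s i else c \<cdot>\<^sub>v x)" for i
  have Hs': "H *\<^sub>v s' i = (if i < k then H *\<^sub>v s i else c \<cdot>\<^sub>v (H *\<^sub>v x))" for i
    using H x(1) by (simp add: s'_def mult_mat_vec)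
  have Hs: "H *\<^sub>v s i \<in> carrier_vec n" if "i < k" for i
    using H s(1)[OF that] by auto
  have orth': "scalar_prod (H *\<^sub>v x) (H *\<^sub>v s i) = 0" if "i < k" for i
    using orth[OF that] comm_scalar_prod[OF Hx Hs[OF that]] by simp
  have "scalar_prod (H *\<^sub>v s' i) (H *\<^sub>v s' j) = (if i = j then 1 else 0)" if "i < Suc k" "j < Suc k" for i j
    unfolding Hs' using that s(3) orth orth' Hx Hs c
    by (auto simp: less_Suc_eq power2_eq_square mult.assoc
        smult_scalar_prod_distrib[OF Hx] scalar_prod_smult_distrib[OF Hs Hx]
        smult_scalar_prod_distrib[OF Hx Hs] scalar_prod_smult_distrib[OF Hx Hx] smult_scalar_prod_distrib[OF Hx smult_carrier_vec[THEN iffD2, OF Hx]])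
  moreover have "s' i \<in> carrier_vec q \<and> C *\<^sub>v s' i = 0\<^sub>v p" if "i < Suc k" for i
  proof (cases "i < k")
    case True
    then show ?thesis using s by (simp add: s'_def)
  next
    case False
    have "C *\<^sub>v (c \<cdot>\<^sub>v x) = c \<cdot>\<^sub>v (C *\<^sub>v x)"
      using C x(1) by (rule mult_mat_vec)
    also have "\<dots> = 0\<^sub>v p"
      unfolding Cx by (intro eq_vecI) auto
    finally show ?thesis using False x(1) by (simp add: s'_def)
  qed
  ultimately show ?case by blast
qed

lemma orthonormal_columns_in_kernel:
  fixes C H :: "real mat"
  assumes C: "C \<in> carrier_mat p q" and H: "H \<in> carrier_mat n q"
    and inj: "\<And>x. x \<in> carrier_vec q \<Longrightarrow> C *\<^sub>v x = 0\<^sub>v p \<Longrightarrow> H *\<^sub>v x = 0\<^sub>v n \<Longrightarrow> x = 0\<^sub>v q"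
    and "p + k \<le> q"
  obtains S where "S \<in> carrier_mat q k" "C * S = 0\<^sub>m p k" "transpose_mat (H * S) * (H * S) = 1\<^sub>m k"
proof -
  obtain s where s: "\<And>i. i < k \<Longrightarrow> s i \<in> carrier_vec q" "\<And>i. i < k \<Longrightarrow> C *\<^sub>v s i = 0\<^sub>v p"
    "\<And>i j. i < k \<Longrightarrow> j < k \<Longrightarrow> scalar_prod (H *\<^sub>v s i) (H *\<^sub>v s j) = (if i = j then 1 else 0)"
    using orthonormal_family_in_kernel[OF assms] by blast
  define S where "S = Matrix.mat q k (\<lambda>(i, j). s j $ i)"
  have S: "S \<in> carrier_mat q k" by (simp add: S_def)
  have col: "Matrix.col S j = s j" if "j < k" for j
    using s(1)[OF that] that by (intro eq_vecI) (auto simp: S_def)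
  have "C * S = 0\<^sub>m p k"
  proof (rule eq_matI)
    fix i j assume "i < dim_row (0\<^sub>m p k :: real mat)" "j < dim_col (0\<^sub>m p k :: real mat)"
    then have ij: "i < p" "j < k" by auto
    have "(C * S) $$ (i, j) = (C *\<^sub>v s j) $ i"
      using ij C S col by simp
    then show "(C * S) $$ (i, j) = 0\<^sub>m p k $$ (i, j)"
      using s(2) ij by simp
  qed (use C S in auto)
  moreover have "orthonormal_columns (H * S)"
    unfolding orthonormal_columns_def
    using s(3) col_mult2[OF H S] col S by simp
  then have "transpose_mat (H * S) * (H * S) = 1\<^sub>m k"
    using orthonormal_columns_iff[of "H * S" n k] H S by simp
  ultimately show thesis using that S by blast
qed

lemma mult_mat_vec_eq_0_if_mult_eq_1:
  fixes B :: "real mat"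
  assumes "L \<in> carrier_mat k m" "B \<in> carrier_mat m k" "L * B = 1\<^sub>m k" "x \<in> carrier_vec k" "B *\<^sub>v x = 0\<^sub>v m"
  shows "x = 0\<^sub>v k"
proof -
  have "x = L * B *\<^sub>v x" using assms by simp
  also have "\<dots> = L *\<^sub>v (B *\<^sub>v x)" using assms(1,2,4) by (rule assoc_mult_mat_vec)
  also have "\<dots> = 0\<^sub>v k" unfolding assms(5) using assms(1) by (intro eq_vecI) auto
  finally show ?thesis .
qed

lemma mult_mat_unit_vec:
  fixes A :: "real mat"
  assumes "A \<in> carrier_mat m n" "j < n"
  shows "A *\<^sub>v unit_vec n j = Matrix.col A j"
  using assms by (intro eq_vecI) auto

text \<open>The columns of \<open>B\<close> form a maximal linearly independent set of columns of \<open>A\<close>, and \<open>W\<close>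
  selects their positions in \<open>A\<close>: since \<open>B = A W = B (C W)\<close>, injectivity of \<open>B\<close> makes \<open>W\<close> a right inverse of
  \<open>C\<close>.\<close>

lemma rank_factorization:
  assumes A: "A \<in> carrier_mat m n"
  obtains B C W where "B \<in> carrier_mat m (mat_rank A)" "C \<in> carrier_mat (mat_rank A) n" "W \<in> carrier_mat n (mat_rank A)"
    "A = B * C" "C * W = 1\<^sub>m (mat_rank A)"
    "\<And>x. x \<in> carrier_vec (mat_rank A) \<Longrightarrow> B *\<^sub>v x = 0\<^sub>v m \<Longrightarrow> x = 0\<^sub>v (mat_rank A)"
proof -
  interpret vec_space "TYPE(real)" m .
  let ?P = "\<lambda>T. T \<subseteq> set (cols A) \<and> lin_indpt T"
  have cols: "set (cols A) \<subseteq> carrier_vec m"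
    using A cols_dim by blast
  obtain S where S: "maximal S ?P"
    using maximal_exists_superset[of "set (cols A)" ?P "{}"] lindep_span by (auto simp: lin_dep_def)
  then have SA: "S \<subseteq> set (cols A)" and indpt: "lin_indpt S"
    by (auto simp: maximal_def)
  define k where "k = card S"
  have rank: "mat_rank A = k"
    using rank_card_indpt[OF A S] A by (simp add: k_def)
  have "finite S" using SA finite_subset by blast
  then obtain xs where xs: "set xs = S" "distinct xs"
    using finite_distinct_list by blast
  have len: "length xs = k"
    using xs by (metis k_def distinct_card)
  define B where "B = mat_of_cols m xs"
  have B: "B \<in> carrier_mat m k"
    using mat_of_cols_carrier(1)[of m xs] unfolding B_def len .
  have cols_B: "cols B = xs"
    unfolding B_def using xs SA cols by (intro cols_mat_of_cols) auto
  have inj: "x = 0\<^sub>v k" if "x \<in> carrier_vec k" "B *\<^sub>v x = 0\<^sub>v m" for x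
    using lin_depI[OF B that(1) _ that(2)] indpt xs unfolding cols_B by blast
  have "\<exists>y\<in>carrier_vec k. B *\<^sub>v y = a" if a: "a \<in> set (cols A)" for a
  proof -
    have "a \<in> span S"
    proof (cases "a \<in> S")
      case True
      then show ?thesis using SA cols in_own_span by blast
    next
      case False
      then have "\<not> ?P (insert a S)"
        using S unfolding maximal_def by blast
      then have "lin_dep (S \<union> {a})"
        using a SA by simp
      then show ?thesis
        using lin_dep_iff_in_span[of S a] False a SA cols indpt by blast
    qed
    then have "a \<in> col_space B"
      by (simp add: col_space_def cols_B xs)
    then show ?thesis
      using col_space_eq[OF B] B by auto
  qed
  then have "\<forall>j<n. \<exists>y\<in>carrier_vec k. B *\<^sub>v y = Matrix.col A j"
    using A by (simp add: cols_def)
  then obtain c where c: "\<And>j. j < n \<Longrightarrow> c j \<in> carrier_vec k" "\<And>j. j < n \<Longrightarrow> B *\<^sub>v c j = Matrix.col A j"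
    by metis
  define C where "C = Matrix.mat k n (\<lambda>(i, j). c j $ i)"
  have C: "C \<in> carrier_mat k n" by (simp add: C_def)
  have col_C: "Matrix.col C j = c j" if "j < n" for j
    using c(1)[OF that] that by (intro eq_vecI) (auto simp: C_def)
  have ABC: "A = B * C"
  proof (rule eq_matI)
    fix i j assume ij: "i < dim_row (B * C)" "j < dim_col (B * C)"
    have "(B * C) $$ (i, j) = (B *\<^sub>v c j) $ i"
      using ij B C col_C by simp
    also have "\<dots> = A $$ (i, j)"
      using c(2) ij A B C by simp
    finally show "A $$ (i, j) = (B * C) $$ (i, j)" ..
  qed (use A B C in auto)
  have "\<forall>i<k. \<exists>j<n. Matrix.col A j = Matrix.col B i"
  proof (intro allI impI)
    fix i assume "i < k"
    then have "Matrix.col B i \<in> S"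
      using xs cols_B B len by (metis cols_length cols_nth nth_mem carrier_matD(2))
    then have "Matrix.col B i \<in> set (cols A)"
      using SA by blast
    then show "\<exists>j<n. Matrix.col A j = Matrix.col B i"
      using A by (auto simp: cols_def)
  qed
  then obtain w where w: "\<And>i. i < k \<Longrightarrow> w i < n" "\<And>i. i < k \<Longrightarrow> Matrix.col A (w i) = Matrix.col B i"
    by metis
  define W where "W = Matrix.mat n k (\<lambda>(j, i). if j = w i then 1 else 0 :: real)"
  have W: "W \<in> carrier_mat n k" by (simp add: W_def)
  have col_W: "Matrix.col W i = unit_vec n (w i)" if "i < k" for i
    using that by (intro eq_vecI) (auto simp: W_def unit_vec_def)
  have CW: "C * W = 1\<^sub>m k"
  proof -
    have "Matrix.col (C * W) i = unit_vec k i" if i: "i < k" for i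
    proof -
      have "Matrix.col (C * W) i = C *\<^sub>v unit_vec n (w i)"
        using col_mult2[OF C W i] col_W[OF i] by simp
      also have "\<dots> = c (w i)"
        using mult_mat_unit_vec[OF C w(1)[OF i]] col_C[OF w(1)[OF i]] by simp
      finally have eq: "Matrix.col (C * W) i = c (w i)" .
      have "B *\<^sub>v (c (w i) - unit_vec k i) = B *\<^sub>v c (w i) - B *\<^sub>v unit_vec k i"
        using B c(1) w(1)[OF i] by (intro mult_minus_distrib_mat_vec) auto
      also have "\<dots> = 0\<^sub>v m"
        using mult_mat_unit_vec[OF B i] c(2) w(1,2)[OF i] B by auto
      finally have "B *\<^sub>v (c (w i) - unit_vec k i) = 0\<^sub>v m" .
      then have diff: "c (w i) - unit_vec k i = 0\<^sub>v k"
        using c(1) w(1)[OF i] by (intro inj) auto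
      have "c (w i) = unit_vec k i"
      proof (rule eq_vecI)
        fix a assume a: "a < dim_vec (unit_vec k i :: real Matrix.vec)"
        have "(c (w i) - unit_vec k i) $ a = 0"
          unfolding diff using a by simp
        then show "c (w i) $ a = unit_vec k i $ a"
          using a c(1)[OF w(1)[OF i]] by simp
      qed (use c(1)[OF w(1)[OF i]] in auto)
      then show ?thesis using eq by simp
    qed
    then show ?thesis
      using C W by (intro mat_col_eqI) auto
  qed
  show thesis
    using that[unfolded rank] B C W ABC CW inj by blast
qed

text \<open>The least squares solution operator: the inverse of the Gram matrix of \<open>B\<close>, times the transpose of \<open>B\<close>.\<close>

lemma left_inverse_symmetric_projection:
  fixes B :: "real mat"
  assumes B: "B \<in> carrier_mat m k" and inj: "\<And>x. x \<in> carrier_vec k \<Longrightarrow> B *\<^sub>v x = 0\<^sub>v m \<Longrightarrow> x = 0\<^sub>v k"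
  obtains L where "L \<in> carrier_mat k m" "L * B = 1\<^sub>m k" "transpose_mat (B * L) = B * L"
proof -
  let ?K = "transpose_mat B * B"
  have K: "?K \<in> carrier_mat k k" using B by auto
  have K_inj: "x = 0\<^sub>v k" if x: "x \<in> carrier_vec k" and Kx: "?K *\<^sub>v x = 0\<^sub>v k" for x
  proof -
    have "nsq (B *\<^sub>v x) = scalar_prod x (transpose_mat B *\<^sub>v (B *\<^sub>v x))"
      using B x by (rule nsq_mult_mat_vec)
    also have "transpose_mat B *\<^sub>v (B *\<^sub>v x) = 0\<^sub>v k"
      using Kx assoc_mult_mat_vec[of "transpose_mat B" k m B k x] B x by simp
    finally have "nsq (B *\<^sub>v x) = 0" using x by simp
    then show ?thesis
      using inj[OF x] nsq_eq_0_iff[of "B *\<^sub>v x" m] B x by auto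
  qed
  obtain K' where K': "K' \<in> carrier_mat k k" "?K * K' = 1\<^sub>m k" "K' * ?K = 1\<^sub>m k"
    using injective_square_matrix_inverse[OF K K_inj] by blast
  have K_sym: "transpose_mat ?K = ?K"
    using B by (simp add: transpose_mult[of _ k m])
  have K'_sym: "transpose_mat K' = K'"
  proof -
    have "transpose_mat K' * ?K = 1\<^sub>m k"
      using arg_cong[OF K'(2), of transpose_mat] transpose_mult[OF K K'(1)] K_sym by simp
    then have "transpose_mat K' = transpose_mat K' * (?K * K')"
      using K' by simp
    also have "\<dots> = transpose_mat K' * ?K * K'"
      using K K' by (intro assoc_mult_mat[symmetric]) auto
    also have "\<dots> = K'"
      using \<open>transpose_mat K' * ?K = 1\<^sub>m k\<close> K' by simp
    finally show ?thesis .
  qed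
  define L where "L = K' * transpose_mat B"
  have L: "L \<in> carrier_mat k m" using K' B by (simp add: L_def)
  have "L * B = K' * ?K"
    unfolding L_def using K' B by (intro assoc_mult_mat) auto
  moreover have "transpose_mat (B * L) = B * L"
  proof -
    have "transpose_mat (B * L) = transpose_mat L * transpose_mat B"
      using B L by (rule transpose_mult)
    also have "transpose_mat L = B * K'"
      unfolding L_def using K' B K'_sym by (subst transpose_mult[of _ k k]) auto
    also have "B * K' * transpose_mat B = B * L"
      unfolding L_def using B K' by (intro assoc_mult_mat) auto
    finally show ?thesis .
  qed
  ultimately show thesis using that L K' by simp
qed

lemma is_pseudo_inverse_unique:
  assumes B: "is_pseudo_inverse A B" and C: "is_pseudo_inverse A C"
  shows "B = C"
proof -
  define m n where "m = dim_row A" and "n = dim_col A"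
  have carr: "A \<in> carrier_mat m n" "B \<in> carrier_mat n m" "C \<in> carrier_mat n m"
    using B C by (auto simp: m_def n_def is_pseudo_inverse_def)
  note B' = B[unfolded is_pseudo_inverse_def] and C' = C[unfolded is_pseudo_inverse_def]
  have AB: "A * B = A * C"
  proof -
    have "A * B = transpose_mat (A * C * A * B)"
      using B' C' by simp
    also have "A * C * A * B = (A * C) * (A * B)"
      using carr by (intro assoc_mult_mat) auto
    also have "transpose_mat \<dots> = transpose_mat (A * B) * transpose_mat (A * C)"
      using carr by (intro transpose_mult) auto
    also have "\<dots> = (A * B) * (A * C)"
      using B' C' by simp
    also have "\<dots> = A * B * A * C"
      using carr by (intro assoc_mult_mat[symmetric]) auto
    finally show ?thesis using B' by simp
  qed
  have BA: "B * A = C * A"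
  proof -
    have "B * A = B * (A * C * A)"
      using C' by simp
    also have "\<dots> = B * (A * (C * A))"
      using carr by (simp add: assoc_mult_mat[of A m n C m A n])
    also have "\<dots> = (B * A) * (C * A)"
      using carr by (intro assoc_mult_mat[symmetric]) auto
    also have "\<dots> = transpose_mat (B * A) * transpose_mat (C * A)"
      using B' C' by simp
    also have "\<dots> = transpose_mat ((C * A) * (B * A))"
      using carr by (intro transpose_mult[symmetric]) auto
    also have "(C * A) * (B * A) = C * (A * (B * A))"
      using carr by (intro assoc_mult_mat) auto
    also have "A * (B * A) = A * B * A"
      using carr by (intro assoc_mult_mat[symmetric]) auto
    finally show ?thesis using B' C' by simp
  qed
  have "B = B * A * B" using B' by simp
  also have "\<dots> = C * A * B" by (simp add: BA)
  also have "\<dots> = C * (A * B)" using carr by (intro assoc_mult_mat) auto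
  also have "\<dots> = C * (A * C)" by (simp add: AB)
  also have "\<dots> = C * A * C" using carr by (intro assoc_mult_mat[symmetric]) auto
  finally show ?thesis using C' by simp
qed

text \<open>For a rank factorisation \<open>A = B C\<close>, the product \<open>R L\<close> of a right inverse of \<open>C\<close> and a left inverse of
  \<open>B\<close> is the pseudo inverse, provided that \<open>R C\<close> and \<open>B L\<close> are symmetric. So it exists for every matrix,
  also for an \<open>X\<close> whose columns are dependent because \<open>M\<close> has rank less than \<open>l\<close>.\<close>

lemma is_pseudo_inverse_pseudo_inverse: "is_pseudo_inverse A (pseudo_inverse A)"
proof -
  define m n k where "m = dim_row A" and "n = dim_col A" and "k = mat_rank A"
  have A: "A \<in> carrier_mat m n" by (auto simp: m_def n_def)
  obtain B C W where B: "B \<in> carrier_mat m k" and C: "C \<in> carrier_mat k n" and W: "W \<in> carrier_mat n k"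
    and ABC: "A = B * C" and CW: "C * W = 1\<^sub>m k"
    and inj: "\<And>x. x \<in> carrier_vec k \<Longrightarrow> B *\<^sub>v x = 0\<^sub>v m \<Longrightarrow> x = 0\<^sub>v k"
    using rank_factorization[OF A] unfolding k_def by blast
  obtain L where L: "L \<in> carrier_mat k m" "L * B = 1\<^sub>m k" "transpose_mat (B * L) = B * L"
    using left_inverse_symmetric_projection[OF B inj] by blast
  have "transpose_mat W * transpose_mat C = 1\<^sub>m k"
    using arg_cong[OF CW, of transpose_mat] transpose_mult[OF C W] by simp
  then have "x = 0\<^sub>v k" if "x \<in> carrier_vec k" "transpose_mat C *\<^sub>v x = 0\<^sub>v n" for x
    using mult_mat_vec_eq_0_if_mult_eq_1[of "transpose_mat W" k n "transpose_mat C" x] W C that by simp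
  then obtain L' where L': "L' \<in> carrier_mat k n" "L' * transpose_mat C = 1\<^sub>m k"
      "transpose_mat (transpose_mat C * L') = transpose_mat C * L'"
    using left_inverse_symmetric_projection[of "transpose_mat C" n k] C by auto
  define R where "R = transpose_mat L'"
  have R: "R \<in> carrier_mat n k" using L' by (simp add: R_def)
  have CR: "C * R = 1\<^sub>m k"
    using arg_cong[OF L'(2), of transpose_mat] transpose_mult[of L' k n "transpose_mat C" k] L'(1) C
    by (simp add: R_def)
  have RC: "transpose_mat (R * C) = R * C"
    using L'(3) transpose_mult[of "transpose_mat C" n k L' n] L'(1) C by (simp add: R_def)
  have "is_pseudo_inverse A (R * L)"
    unfolding is_pseudo_inverse_def
  proof (intro conjI)
    show "R * L \<in> carrier_mat (dim_col A) (dim_row A)" using R L A by auto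
    have ARL: "A * (R * L) = B * L"
    proof -
      have "A * (R * L) = B * (C * (R * L))"
        unfolding ABC using B C R L by (intro assoc_mult_mat) auto
      also have "C * (R * L) = C * R * L"
        using C R L by (intro assoc_mult_mat[symmetric]) auto
      finally show ?thesis using CR L by simp
    qed
    have RLA: "(R * L) * A = R * C"
    proof -
      have "(R * L) * A = R * (L * (B * C))"
        unfolding ABC using B C R L by (intro assoc_mult_mat) auto
      also have "L * (B * C) = L * B * C"
        using B C L by (intro assoc_mult_mat[symmetric]) auto
      finally show ?thesis using C L by simp
    qed
    have "B * L * (B * C) = B * (L * (B * C))"
      using B C L by (intro assoc_mult_mat) auto
    also have "L * (B * C) = L * B * C"
      using B C L by (intro assoc_mult_mat[symmetric]) auto
    finally show "A * (R * L) * A = A"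
      unfolding ARL using ABC L C by simp
    have "R * C * (R * L) = R * (C * (R * L))"
      using R C L by (intro assoc_mult_mat) auto
    also have "C * (R * L) = C * R * L"
      using C R L by (intro assoc_mult_mat[symmetric]) auto
    finally show "R * L * A * (R * L) = R * L"
      unfolding RLA using CR L by simp
    show "transpose_mat (A * (R * L)) = A * (R * L)" unfolding ARL by (rule L(3))
    show "transpose_mat (R * L * A) = R * L * A" unfolding RLA by (rule RC)
  qed
  then show ?thesis
    unfolding pseudo_inverse_def using is_pseudo_inverse_unique by (metis theI)
qed

section \<open>Lower bounds for the error of low rank approximation\<close>

lemma minus_zero_mat:
  fixes A :: "real mat"
  assumes "A \<in> carrier_mat m n"
  shows "A - 0\<^sub>m m n = A"
  using assms by (intro eq_matI) auto

lemma nrm_mult_left: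
  assumes "nrm = spectral_norm \<or> nrm = frobenius_norm"
    and "op_bound A c" "0 \<le> c" "A \<in> carrier_mat m n" "B \<in> carrier_mat n k"
  shows "nrm (A * B) \<le> sqrt c * nrm B"
  using assms spectral_norm_mult_left frobenius_norm_mult_left by blast

lemma nrm_mult_right:
  assumes "nrm = spectral_norm \<or> nrm = frobenius_norm"
    and "op_bound B c" "0 \<le> c" "A \<in> carrier_mat m n" "B \<in> carrier_mat n k"
  shows "nrm (A * B) \<le> sqrt c * nrm A"
  using assms spectral_norm_mult_right frobenius_norm_mult_right by blast

definition rect_diag :: "nat \<Rightarrow> nat \<Rightarrow> (nat \<Rightarrow> real) \<Rightarrow> real mat" where
  "rect_diag m n d = Matrix.mat m n (\<lambda>(i, j). if i = j then d i else 0)"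

lemma rect_diag_carrier [simp]: "rect_diag m n d \<in> carrier_mat m n"
  by (simp add: rect_diag_def)

lemma row_rect_diag_mult:
  assumes "K \<in> carrier_mat n q" "i < n" "i < m"
  shows "Matrix.row (rect_diag m n d * K) i = d i \<cdot>\<^sub>v Matrix.row K i"
  using assms by (intro eq_vecI) (auto simp: rect_diag_def scalar_prod_def if_distrib[of "\<lambda>u. u * _"] sum.delta cong: if_cong)

lemma rect_diag_mult_index:
  assumes "K \<in> carrier_mat n q" "i < m" "j < q"
  shows "(rect_diag m n d * K) $$ (i, j) = (if i < n then d i * K $$ (i, j) else 0)"
  using assms by (auto simp: rect_diag_def scalar_prod_def if_distrib[of "\<lambda>u. u * _"] sum.delta cong: if_cong)

lemma rect_diag_mult_vec:
  assumes "v \<in> carrier_vec n" "i < m"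
  shows "(rect_diag m n d *\<^sub>v v) $ i = (if i < n then d i * v $ i else 0)"
  using assms by (auto simp: rect_diag_def scalar_prod_def if_distrib[of "\<lambda>u. u * _"] sum.delta cong: if_cong)

lemma nsq_rect_diag_mult_vec:
  assumes "v \<in> carrier_vec n" "n \<le> m"
  shows "nsq (rect_diag m n d *\<^sub>v v) = (\<Sum>i<n. (d i)\<^sup>2 * (v $ i)\<^sup>2)"
proof -
  have "nsq (rect_diag m n d *\<^sub>v v) = (\<Sum>i<m. (if i < n then d i * v $ i else 0)\<^sup>2)"
    unfolding nsq_eq_sum dim_mult_mat_vec carrier_matD(1)[OF rect_diag_carrier]
    by (intro sum.cong refl) (simp add: rect_diag_mult_vec[OF assms(1)])
  also have "\<dots> = (\<Sum>i<n. (if i < n then d i * v $ i else 0)\<^sup>2)"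
    using assms by (intro sum.mono_neutral_right) auto
  finally show ?thesis
    by (simp add: power_mult_distrib)
qed

lemma spectral_norm_rect_diag_le:
  assumes "n \<le> m" "0 \<le> s" "\<And>i. i < n \<Longrightarrow> \<bar>d i\<bar> \<le> s"
  shows "spectral_norm (rect_diag m n d) \<le> s"
proof (subst spectral_norm_le_iff[OF assms(2)], rule op_boundI[OF rect_diag_carrier])
  fix v :: "real Matrix.vec" assume v: "v \<in> carrier_vec n"
  have "(\<Sum>i<n. (d i)\<^sup>2 * (v $ i)\<^sup>2) \<le> (\<Sum>i<n. s\<^sup>2 * (v $ i)\<^sup>2)"
    using assms by (intro sum_mono mult_right_mono) (auto simp: abs_le_square_iff[symmetric])
  then show "nsq (rect_diag m n d *\<^sub>v v) \<le> s\<^sup>2 * nsq v"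
    unfolding nsq_rect_diag_mult_vec[OF v assms(1)] using v by (simp add: nsq_eq_sum[of v] sum_distrib_left)
qed

text \<open>A matrix of rank \<open>k \<le> r\<close> kills a nonzero vector that is supported on the first \<open>r + 1\<close> coordinates, and the
  diagonal matrix expands such a vector by at least the factor \<open>s\<close>. The matrix \<open>E\<close> in the proof expresses the condition on
  the support.\<close>

lemma spectral_norm_diff_ge:
  assumes "n \<le> m" "r < n" "k \<le> r" and C: "C \<in> carrier_mat k n" and B: "B \<in> carrier_mat m k"
    and "0 \<le> s" "\<And>i. i \<le> r \<Longrightarrow> s \<le> d i"
  shows "s \<le> spectral_norm (rect_diag m n d - B * C)"
proof -
  define E where "E = Matrix.mat (n - r - 1) n (\<lambda>(i, j). if j = r + 1 + i then 1 else 0 :: real)"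
  have E: "E \<in> carrier_mat (n - r - 1) n" by (simp add: E_def)
  have "C @\<^sub>r E \<in> carrier_mat (k + (n - r - 1)) n"
    using C E by (rule carrier_append_rows)
  moreover have "k + (n - r - 1) < n" using assms by linarith
  ultimately obtain x where x: "x \<in> carrier_vec n" "x \<noteq> 0\<^sub>v n" "(C @\<^sub>r E) *\<^sub>v x = 0\<^sub>v (k + (n - r - 1))"
    using wide_matrix_kernel by blast
  have split: "0\<^sub>v (k + (n - r - 1)) = 0\<^sub>v k @\<^sub>v (0\<^sub>v (n - r - 1) :: real Matrix.vec)"
    by (intro eq_vecI) auto
  have "C *\<^sub>v x @\<^sub>v E *\<^sub>v x = 0\<^sub>v k @\<^sub>v 0\<^sub>v (n - r - 1)"
    using x(3) mat_mult_append[OF C E x(1)] unfolding split by simp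
  then have Cx: "C *\<^sub>v x = 0\<^sub>v k" and Ex: "E *\<^sub>v x = 0\<^sub>v (n - r - 1)"
    using append_vec_eq[of "C *\<^sub>v x" k "0\<^sub>v k" "E *\<^sub>v x" "0\<^sub>v (n - r - 1)"] mult_mat_vec_carrier[OF C x(1)] by auto
  have tail: "x $ j = 0" if "r < j" "j < n" for j
  proof -
    have "(E *\<^sub>v x) $ (j - r - 1) = x $ j"
      using that x(1) by (auto simp: E_def scalar_prod_def if_distrib[of "\<lambda>u. u * _"] sum.delta cong: if_cong)
    then show ?thesis using Ex that by simp
  qed
  have BCx: "(rect_diag m n d - B * C) *\<^sub>v x = rect_diag m n d *\<^sub>v x"
  proof -
    have "B * C *\<^sub>v x = B *\<^sub>v 0\<^sub>v k"
      using assoc_mult_mat_vec[OF B C x(1)] Cx by simp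
    also have "\<dots> = 0\<^sub>v m"
      using B by (intro eq_vecI) auto
    finally have "B * C *\<^sub>v x = 0\<^sub>v m" .
    moreover have "(rect_diag m n d - B * C) *\<^sub>v x = rect_diag m n d *\<^sub>v x - B * C *\<^sub>v x"
      using B C x(1) by (intro minus_mult_distrib_mat_vec) auto
    ultimately show ?thesis
      using mult_mat_vec_carrier[OF rect_diag_carrier x(1), of m d] by simp
  qed
  have "s\<^sup>2 * nsq x = (\<Sum>i<n. s\<^sup>2 * (x $ i)\<^sup>2)"
    using x(1) by (simp add: nsq_eq_sum sum_distrib_left)
  also have "\<dots> \<le> (\<Sum>i<n. (d i)\<^sup>2 * (x $ i)\<^sup>2)"
  proof (intro sum_mono)
    fix i assume "i \<in> {..<n}"
    then show "s\<^sup>2 * (x $ i)\<^sup>2 \<le> (d i)\<^sup>2 * (x $ i)\<^sup>2"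
      using assms(6,7) tail[of i] by (cases "i \<le> r") (auto intro!: mult_right_mono power_mono)
  qed
  also have "\<dots> = nsq ((rect_diag m n d - B * C) *\<^sub>v x)"
    unfolding BCx nsq_rect_diag_mult_vec[OF x(1) assms(1)] ..
  also have "\<dots> \<le> (spectral_norm (rect_diag m n d - B * C))\<^sup>2 * nsq x"
    using B C x(1) by (intro op_boundD[OF op_bound_spectral_norm]) auto
  finally have "s\<^sup>2 * nsq x \<le> (spectral_norm (rect_diag m n d - B * C))\<^sup>2 * nsq x" .
  moreover have "0 < nsq x"
    using nsq_eq_0_iff[OF x(1)] x(2) nsq_nonneg[of x] by linarith
  ultimately have "s\<^sup>2 \<le> (spectral_norm (rect_diag m n d - B * C))\<^sup>2"
    by simp
  then show ?thesis
    by (rule power2_le_imp_le) simp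
qed

text \<open>Weights between \<open>0\<close> and \<open>1\<close> with total \<open>n - r\<close> give the smallest weighted sum of a decreasing sequence
  when they sit on its last \<open>n - r\<close> terms.\<close>

lemma sum_tail_le_weighted_sum:
  fixes s c :: "nat \<Rightarrow> real"
  assumes "r < n" and decreasing: "\<And>i j. i \<le> j \<Longrightarrow> j < n \<Longrightarrow> s j \<le> s i"
    and c: "\<And>i. i < n \<Longrightarrow> 0 \<le> c i" "\<And>i. i < n \<Longrightarrow> c i \<le> 1" "(\<Sum>i<n. c i) = real (n - r)"
  shows "(\<Sum>i<n. if r \<le> i then s i else 0) \<le> (\<Sum>i<n. s i * c i)"
proof -
  have "0 = s r * ((\<Sum>i<n. c i) - (\<Sum>i<n. if r \<le> i then 1 else 0))"
  proof -
    have "(\<Sum>i<n. if r \<le> i then 1 else 0 :: real) = real (card {i \<in> {..<n}. r \<le> i})"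
      by (simp add: sum.If_cases Int_def)
    also have "{i \<in> {..<n}. r \<le> i} = {r..<n}" by auto
    finally show ?thesis using c(3) by simp
  qed
  also have "\<dots> = (\<Sum>i<n. s r * (c i - (if r \<le> i then 1 else 0)))"
    by (simp add: sum_subtractf sum_distrib_left right_diff_distrib)
  also have "\<dots> \<le> (\<Sum>i<n. s i * (c i - (if r \<le> i then 1 else 0)))"
  proof (intro sum_mono)
    fix i assume i: "i \<in> {..<n}"
    show "s r * (c i - (if r \<le> i then 1 else 0)) \<le> s i * (c i - (if r \<le> i then 1 else 0))"
    proof (cases "r \<le> i")
      case True
      then show ?thesis
        using c(2)[of i] decreasing[of r i] i by (auto intro!: mult_right_mono_neg)
    next
      case False
      then show ?thesis
        using c(1)[of i] decreasing[of i r] i \<open>r < n\<close> by (auto intro!: mult_right_mono)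
    qed
  qed
  also have "\<dots> = (\<Sum>i<n. s i * c i) - (\<Sum>i<n. if r \<le> i then s i else 0)"
    unfolding sum_subtractf[symmetric] by (intro sum.cong refl) (simp add: right_diff_distrib)
  finally show ?thesis by simp
qed

text \<open>Let the \<open>n - r\<close> columns of \<open>S\<close> be orthonormal and lie in the kernel of \<open>C\<close>. Multiplication by \<open>S\<close> does not
  increase the Frobenius norm and removes \<open>B C\<close>, and the squared norm of the diagonal matrix times \<open>S\<close> is the sum
  of the \<open>(d i)\<^sup>2\<close> weighted with the squared row norms of \<open>S\<close>. These weights are at most \<open>1\<close> and sum up
  to \<open>n - r\<close>.\<close>

lemma frobenius_norm_diff_ge:
  assumes "n \<le> m" "r < n" "k \<le> r" and C: "C \<in> carrier_mat k n" and B: "B \<in> carrier_mat m k"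
    and decreasing: "\<And>i j. i \<le> j \<Longrightarrow> j < n \<Longrightarrow> d j \<le> d i" and nonneg: "\<And>i. i < n \<Longrightarrow> 0 \<le> d i"
  shows "frobenius_norm (rect_diag m n (\<lambda>i. if r \<le> i then d i else 0)) \<le> frobenius_norm (rect_diag m n d - B * C)"
proof -
  let ?D = "rect_diag m n d"
  have dim: "k + (n - r) \<le> n" using assms(2,3) by linarith
  obtain S where S: "S \<in> carrier_mat n (n - r)" "C * S = 0\<^sub>m k (n - r)"
    "transpose_mat (1\<^sub>m n * S) * (1\<^sub>m n * S) = 1\<^sub>m (n - r)"
    using orthonormal_columns_in_kernel[OF C one_carrier_mat _ dim] by auto
  then have iso: "transpose_mat S * S = 1\<^sub>m (n - r)" by simp
  have "(?D - B * C) * S = ?D * S"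
  proof -
    have "B * C * S = B * (C * S)"
      using B C S(1) by (rule assoc_mult_mat)
    also have "\<dots> = 0\<^sub>m m (n - r)"
      unfolding S(2) using B by simp
    finally have "B * C * S = 0\<^sub>m m (n - r)" .
    moreover have "(?D - B * C) * S = ?D * S - B * C * S"
      using B C S(1) by (intro minus_mult_distrib_mat) auto
    ultimately show ?thesis
      using minus_zero_mat[OF mult_carrier_mat[OF rect_diag_carrier S(1)], of m d] by simp
  qed
  moreover have diff: "?D - B * C \<in> carrier_mat m n"
    using B C by auto
  ultimately have le: "frobenius_norm (?D * S) \<le> frobenius_norm (?D - B * C)"
    using frobenius_norm_mult_right[OF op_bound_isometry[OF S(1) iso] _ diff S(1)] by simp
  define c where "c i = nsq (Matrix.row S i)" for i
  have c_le: "c i \<le> 1" if "i < n" for i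
  proof -
    have "c i = nsq (transpose_mat S *\<^sub>v unit_vec n i)"
      using that S(1) by (simp add: c_def mult_mat_unit_vec[of "transpose_mat S" "n - r" n])
    also have "\<dots> \<le> 1 * nsq (unit_vec n i :: real Matrix.vec)"
      using S(1) by (intro op_boundD[OF op_bound_isometry_transpose[OF S(1) iso]]) auto
    finally show ?thesis using that by simp
  qed
  have "(\<Sum>i<n. c i) = (frobenius_norm S)\<^sup>2"
    unfolding c_def frobenius_norm_sq_rows[OF S(1)] ..
  also have "\<dots> = (\<Sum>j<n - r. nsq (Matrix.col S j))"
    by (rule frobenius_norm_sq_cols[OF S(1)])
  also have "\<dots> = (\<Sum>j<n - r. 1)"
    using orthonormal_columns_iff[OF S(1)] iso S(1) by (intro sum.cong) (auto simp: orthonormal_columns_def)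
  finally have sum_c: "(\<Sum>i<n. c i) = real (n - r)" by simp
  have "(frobenius_norm (?D * S))\<^sup>2 = (\<Sum>i<m. nsq (Matrix.row (?D * S) i))"
    using S(1) by (intro frobenius_norm_sq_rows) (rule mult_carrier_mat[OF rect_diag_carrier])
  also have "\<dots> \<ge> (\<Sum>i<n. nsq (Matrix.row (?D * S) i))"
    using assms(1) by (intro sum_mono2) auto
  also have "(\<Sum>i<n. nsq (Matrix.row (?D * S) i)) = (\<Sum>i<n. (d i)\<^sup>2 * c i)"
    using assms(1) row_rect_diag_mult[OF S(1)] by (intro sum.cong refl) (simp add: nsq_smult c_def)
  finally have "(\<Sum>i<n. (d i)\<^sup>2 * c i) \<le> (frobenius_norm (?D * S))\<^sup>2" .
  moreover have "(\<Sum>i<n. if r \<le> i then (d i)\<^sup>2 else 0) \<le> (\<Sum>i<n. (d i)\<^sup>2 * c i)"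
    using assms(2) c_le sum_c decreasing nonneg
    by (intro sum_tail_le_weighted_sum) (auto simp: c_def intro!: power_mono)
  moreover have "(frobenius_norm (rect_diag m n (\<lambda>i. if r \<le> i then d i else 0)))\<^sup>2 = (\<Sum>i<n. if r \<le> i then (d i)\<^sup>2 else 0)"
  proof -
    let ?D2 = "rect_diag m n (\<lambda>i. if r \<le> i then d i else 0)"
    have "(frobenius_norm ?D2)\<^sup>2 = (\<Sum>j<n. nsq (?D2 *\<^sub>v unit_vec n j))"
      unfolding frobenius_norm_sq_cols[OF rect_diag_carrier]
      by (intro sum.cong refl) (simp add: mult_mat_unit_vec[OF rect_diag_carrier])
    also have "\<dots> = (\<Sum>j<n. if r \<le> j then (d j)\<^sup>2 else 0)"
    proof (intro sum.cong refl)
      fix j assume "j \<in> {..<n}"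
      then have "nsq (?D2 *\<^sub>v unit_vec n j) = (\<Sum>i<n. if i = j then (if r \<le> j then (d j)\<^sup>2 else 0) else 0)"
        unfolding nsq_rect_diag_mult_vec[OF unit_vec_carrier assms(1)]
        by (intro sum.cong refl) (auto simp: unit_vec_def)
      then show "nsq (?D2 *\<^sub>v unit_vec n j) = (if r \<le> j then (d j)\<^sup>2 else 0)"
        using \<open>j \<in> {..<n}\<close> by simp
    qed
    finally show ?thesis .
  qed
  ultimately have "(frobenius_norm (rect_diag m n (\<lambda>i. if r \<le> i then d i else 0)))\<^sup>2 \<le> (frobenius_norm (?D * S))\<^sup>2"
    by linarith
  then have "frobenius_norm (rect_diag m n (\<lambda>i. if r \<le> i then d i else 0)) \<le> frobenius_norm (?D * S)"
    by (rule power2_le_imp_le) simp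
  with le show ?thesis by simp
qed

lemma nrm_diff_ge:
  assumes nrm: "nrm = spectral_norm \<or> nrm = frobenius_norm"
    and "n \<le> m" "r < n" "k \<le> r" and C: "C \<in> carrier_mat k n" and B: "B \<in> carrier_mat m k"
    and decreasing: "\<And>i j. i \<le> j \<Longrightarrow> j < n \<Longrightarrow> d j \<le> d i" and nonneg: "\<And>i. i < n \<Longrightarrow> 0 \<le> d i"
  shows "nrm (rect_diag m n (\<lambda>i. if r \<le> i then d i else 0)) \<le> nrm (rect_diag m n d - B * C)"
  using nrm
proof
  assume "nrm = frobenius_norm"
  then show ?thesis using frobenius_norm_diff_ge[OF assms(2-)] by simp
next
  assume "nrm = spectral_norm"
  moreover have "spectral_norm (rect_diag m n (\<lambda>i. if r \<le> i then d i else 0)) \<le> d r"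
    using assms by (intro spectral_norm_rect_diag_le) auto
  moreover have "d r \<le> spectral_norm (rect_diag m n d - B * C)"
    using assms by (intro spectral_norm_diff_ge[OF assms(2-4) C B]) auto
  ultimately show ?thesis by simp
qed

text \<open>The lower bound of the Eckart-Young theorem: orthogonal factors can be moved to the approximating
  matrix, without increase of its rank or of the error.\<close>

lemma nrm_rect_diag_le_tau:
  assumes nrm: "nrm = spectral_norm \<or> nrm = frobenius_norm"
    and "n \<le> m" "r < n"
    and decreasing: "\<And>i j. i \<le> j \<Longrightarrow> j < n \<Longrightarrow> d j \<le> d i" and nonneg: "\<And>i. i < n \<Longrightarrow> 0 \<le> d i"
    and U: "U \<in> carrier_mat m m" "transpose_mat U * U = 1\<^sub>m m"
    and V: "V \<in> carrier_mat n n" "transpose_mat V * V = 1\<^sub>m n"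
  shows "nrm (rect_diag m n (\<lambda>i. if r \<le> i then d i else 0)) \<le> tau nrm (r + 1) (U * rect_diag m n d * transpose_mat V)"
proof -
  let ?D = "rect_diag m n d" and ?M = "U * rect_diag m n d * transpose_mat V"
  have M: "?M \<in> carrier_mat m n" using U V by auto
  have DV: "?D * transpose_mat V \<in> carrier_mat m n"
    using V by (intro mult_carrier_mat[OF rect_diag_carrier]) auto
  have zero: "mat_rank (0\<^sub>m m n) < r + 1"
    by (simp add: vec_space.rank_0I)
  show ?thesis
    unfolding tau_def
  proof (rule cInf_greatest)
    show "{nrm (?M - N) |N. N \<in> carrier_mat (dim_row ?M) (dim_col ?M) \<and> mat_rank N < r + 1} \<noteq> {}"
      using zero U V by (auto intro!: exI[of _ "0\<^sub>m m n"])
    fix y assume "y \<in> {nrm (?M - N) |N. N \<in> carrier_mat (dim_row ?M) (dim_col ?M) \<and> mat_rank N < r + 1}"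
    then obtain N where N: "N \<in> carrier_mat m n" "mat_rank N \<le> r" and y: "y = nrm (?M - N)"
      unfolding carrier_matD[OF M] by auto
    define k where "k = mat_rank N"
    obtain B C where B: "B \<in> carrier_mat m k" and C: "C \<in> carrier_mat k n" and NBC: "N = B * C"
      using rank_factorization[OF N(1)] unfolding k_def by metis
    have "transpose_mat U * (?M - N) * V = ?D - (transpose_mat U * B) * (C * V)"
    proof -
      have "transpose_mat U * ?M * V = ?D"
      proof -
        have "transpose_mat U * ?M = transpose_mat U * (U * (?D * transpose_mat V))"
          using U V by (simp add: assoc_mult_mat[of U m m ?D n "transpose_mat V" n])
        also have "\<dots> = transpose_mat U * U * (?D * transpose_mat V)"
          by (rule assoc_mult_mat[OF _ U(1) DV, symmetric]) (use U in auto)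
        also have "\<dots> = ?D * transpose_mat V"
          unfolding U(2) by (rule left_mult_one_mat[OF DV])
        also have "\<dots> * V = ?D * (transpose_mat V * V)"
          by (rule assoc_mult_mat[OF rect_diag_carrier _ V(1)]) (use V in auto)
        finally show ?thesis
          unfolding V(2) right_mult_one_mat[OF rect_diag_carrier] .
      qed
      moreover have "transpose_mat U * N * V = (transpose_mat U * B) * (C * V)"
      proof -
        have "transpose_mat U * N = transpose_mat U * B * C"
          unfolding NBC using U B C by (intro assoc_mult_mat[symmetric]) auto
        also have "\<dots> * V = (transpose_mat U * B) * (C * V)"
          using U B C V by (intro assoc_mult_mat) auto
        finally show ?thesis .
      qed
      moreover have "transpose_mat U * (?M - N) * V = transpose_mat U * ?M * V - transpose_mat U * N * V"
      proof -
        have "transpose_mat U * (?M - N) = transpose_mat U * ?M - transpose_mat U * N"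
          using U M N by (intro mult_minus_distrib_mat) auto
        also have "\<dots> * V = transpose_mat U * ?M * V - transpose_mat U * N * V"
          using U M N V by (intro minus_mult_distrib_mat) (auto intro!: mult_carrier_mat)
        finally show ?thesis .
      qed
      ultimately show ?thesis by simp
    qed
    then have "nrm (rect_diag m n (\<lambda>i. if r \<le> i then d i else 0)) \<le> nrm (transpose_mat U * (?M - N) * V)"
      using nrm_diff_ge[OF nrm assms(2,3) N(2)[folded k_def], of "C * V" "transpose_mat U * B" d] B C U V decreasing nonneg
      by auto
    also have "\<dots> \<le> sqrt 1 * nrm (transpose_mat U * (?M - N))"
      using U V M N by (intro nrm_mult_right[OF nrm op_bound_isometry[OF V]]) (auto intro!: mult_carrier_mat)
    also have "\<dots> \<le> sqrt 1 * (sqrt 1 * nrm (?M - N))"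
      using U M N by (intro mult_left_mono nrm_mult_left[OF nrm op_bound_isometry_transpose[OF U]]) auto
    finally show "nrm (rect_diag m n (\<lambda>i. if r \<le> i then d i else 0)) \<le> y"
      by (simp add: y)
  qed
qed

section \<open>The error of the range finder\<close>

lemma nsq_minus_le:
  fixes a b :: "real Matrix.vec"
  assumes "a \<in> carrier_vec n" "b \<in> carrier_vec n" "0 < t"
  shows "nsq (a - b) \<le> (1 + t) * nsq a + (1 + 1 / t) * nsq b"
proof -
  have "(u - v)\<^sup>2 \<le> (1 + t) * u\<^sup>2 + (1 + 1 / t) * v\<^sup>2" for u v :: real
  proof -
    have "0 \<le> (t * u + v)\<^sup>2 / t"
      using assms by simp
    also have "\<dots> = (1 + t) * u\<^sup>2 + (1 + 1 / t) * v\<^sup>2 - (u - v)\<^sup>2"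
      using assms by (simp add: power2_eq_square field_simps)
    finally show ?thesis by simp
  qed
  then have "(\<Sum>i<n. (a $ i - b $ i)\<^sup>2) \<le> (\<Sum>i<n. (1 + t) * (a $ i)\<^sup>2 + (1 + 1 / t) * (b $ i)\<^sup>2)"
    by (intro sum_mono)
  then show ?thesis
    using assms by (simp add: nsq_eq_sum sum.distrib sum_distrib_left)
qed

lemma op_bound_projection:
  assumes E: "E \<in> carrier_mat m m" "E * E = E" "transpose_mat E = E"
  shows "op_bound E 1"
proof (rule op_boundI[OF E(1)])
  fix v :: "real Matrix.vec" assume v: "v \<in> carrier_vec m"
  have Ev: "E *\<^sub>v v \<in> carrier_vec m" using E(1) v by auto
  have "nsq (E *\<^sub>v v) = scalar_prod v (E *\<^sub>v (E *\<^sub>v v))"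
    using nsq_mult_mat_vec[OF E(1) v] E(3) by simp
  also have "E *\<^sub>v (E *\<^sub>v v) = E *\<^sub>v v"
    using assoc_mult_mat_vec[OF E(1) E(1) v] E(2) by simp
  finally have "nsq (E *\<^sub>v v) * nsq (E *\<^sub>v v) \<le> nsq v * nsq (E *\<^sub>v v)"
    using Cauchy_Schwarz_scalar_prod[OF v Ev] by (simp add: power2_eq_square)
  then show "nsq (E *\<^sub>v v) \<le> 1 * nsq v"
    using nsq_nonneg[of "E *\<^sub>v v"] nsq_nonneg[of v] by (cases "nsq (E *\<^sub>v v) = 0") auto
qed

lemma nsq_orthogonal_residual:
  assumes Q: "Q \<in> carrier_mat n r" "transpose_mat Q * Q = 1\<^sub>m r" and x: "x \<in> carrier_vec n"
    and q: "q = transpose_mat Q *\<^sub>v x"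
  shows "nsq (x - Q *\<^sub>v q) = nsq x - nsq q"
proof -
  have qc: "q \<in> carrier_vec r" using Q x q by auto
  have Qq: "Q *\<^sub>v q \<in> carrier_vec n" using Q qc by auto
  have "nsq (x - Q *\<^sub>v q) = nsq x - 2 * scalar_prod x (Q *\<^sub>v q) + nsq (Q *\<^sub>v q)"
    using x Qq comm_scalar_prod[OF Qq x] by (simp add: minus_scalar_prod_distrib[of _ n] scalar_prod_minus_distrib[of _ n])
  also have "scalar_prod x (Q *\<^sub>v q) = nsq q"
    using transpose_vec_mult_scalar[OF Q(1) qc x] q by simp
  also have "nsq (Q *\<^sub>v q) = nsq q"
    by (rule nsq_isometry[OF Q qc])
  finally show ?thesis by simp
qed

text \<open>The matrix \<open>Z F\<close> times the transpose of \<open>Q\<close> is an oblique projection, which maps \<open>x\<close> to \<open>u\<close> with the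
  same coordinates \<open>q\<close> along \<open>Q\<close> as \<open>x\<close>. Hence \<open>x - u\<close> is the difference of the residuals of \<open>x\<close> and \<open>u\<close>
  orthogonal to the range of \<open>Q\<close>. Their squared norms are at most \<open>|x|\<^sup>2 - |q|\<^sup>2\<close> and \<open>g * |q|\<^sup>2\<close>.\<close>

lemma op_bound_oblique_projection:
  assumes Q: "Q \<in> carrier_mat n r" "transpose_mat Q * Q = 1\<^sub>m r"
    and Z: "Z \<in> carrier_mat n l" "op_bound Z 1" and F: "F \<in> carrier_mat l r" "op_bound F g" "0 < g"
    and QZF: "transpose_mat Q * (Z * F) = 1\<^sub>m r"
  shows "op_bound (1\<^sub>m n - Z * F * transpose_mat Q) (1 + g)"
proof (rule op_boundI)
  show "1\<^sub>m n - Z * F * transpose_mat Q \<in> carrier_mat n n" using Q Z F by auto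
  fix x :: "real Matrix.vec" assume x: "x \<in> carrier_vec n"
  define q where "q = transpose_mat Q *\<^sub>v x"
  define u where "u = Z * F *\<^sub>v q"
  have q: "q \<in> carrier_vec r" using Q x by (auto simp: q_def)
  have ZF: "Z * F \<in> carrier_mat n r" using Z F by auto
  have u: "u \<in> carrier_vec n" using ZF q by (auto simp: u_def)
  have Qq: "Q *\<^sub>v q \<in> carrier_vec n" using Q q by auto
  have "transpose_mat Q *\<^sub>v u = transpose_mat Q * (Z * F) *\<^sub>v q"
    unfolding u_def using Q ZF q by (intro assoc_mult_mat_vec[symmetric]) auto
  then have Qu: "q = transpose_mat Q *\<^sub>v u"
    unfolding QZF using q by simp
  have "nsq u = nsq (Z *\<^sub>v (F *\<^sub>v q))"
    unfolding u_def using Z F q by simp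
  also have "\<dots> \<le> 1 * nsq (F *\<^sub>v q)"
    using F q by (intro op_boundD[OF Z(2,1)]) auto
  also have "\<dots> \<le> 1 * (g * nsq q)"
    using op_boundD[OF F(2,1) q] by simp
  finally have nsq_u: "nsq u \<le> g * nsq q" by simp
  have "(1\<^sub>m n - Z * F * transpose_mat Q) *\<^sub>v x = x - u"
  proof -
    have "(1\<^sub>m n - Z * F * transpose_mat Q) *\<^sub>v x = 1\<^sub>m n *\<^sub>v x - Z * F * transpose_mat Q *\<^sub>v x"
      using ZF Q x by (intro minus_mult_distrib_mat_vec) auto
    also have "Z * F * transpose_mat Q *\<^sub>v x = u"
      unfolding u_def q_def using ZF Q x by (intro assoc_mult_mat_vec) auto
    finally show ?thesis using x by simp
  qed
  also have "x - u = (x - Q *\<^sub>v q) - (u - Q *\<^sub>v q)"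
    using x u Q(1) by (intro eq_vecI) auto
  also have "nsq \<dots> \<le> (1 + g) * nsq (x - Q *\<^sub>v q) + (1 + 1 / g) * nsq (u - Q *\<^sub>v q)"
    using x u Qq F(3) by (intro nsq_minus_le[of _ n]) auto
  also have "nsq (x - Q *\<^sub>v q) = nsq x - nsq q"
    by (rule nsq_orthogonal_residual[OF Q x q_def])
  also have "nsq (u - Q *\<^sub>v q) = nsq u - nsq q"
    by (rule nsq_orthogonal_residual[OF Q u Qu])
  also have "(1 + g) * (nsq x - nsq q) + (1 + 1 / g) * (nsq u - nsq q) \<le>
      (1 + g) * (nsq x - nsq q) + (1 + 1 / g) * (g * nsq q)"
    using F(3) nsq_u nsq_nonneg[of q] by (intro add_left_mono mult_left_mono) (linarith, simp)
  also have "\<dots> = (1 + g) * nsq x"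
    using F(3) by (simp add: field_simps)
  finally show "nsq ((1\<^sub>m n - Z * F * transpose_mat Q) *\<^sub>v x) \<le> (1 + g) * nsq x" .
qed

lemma pseudo_inverse_projection:
  fixes X :: "real mat"
  assumes X: "X \<in> carrier_mat m l"
  defines "P \<equiv> X * pseudo_inverse X"
  shows "P \<in> carrier_mat m m" "P * X = X" "transpose_mat P = P" "P * P = P"
proof -
  note Penrose = is_pseudo_inverse_pseudo_inverse[of X, unfolded is_pseudo_inverse_def]
  have Y: "pseudo_inverse X \<in> carrier_mat l m" using Penrose X by auto
  show "P \<in> carrier_mat m m" using X Y by (auto simp: P_def)
  show "P * X = X" "transpose_mat P = P" using Penrose by (simp_all add: P_def)
  have "P * P = P * X * pseudo_inverse X"
    unfolding P_def using X Y by (intro assoc_mult_mat[symmetric]) auto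
  then show "P * P = P" using \<open>P * X = X\<close> by (simp add: P_def)
qed

lemma append_rows_orthogonal:
  fixes Q Qp :: "real mat"
  assumes Q: "Q \<in> carrier_mat n r" "transpose_mat Q * Q = 1\<^sub>m r"
    and Qp: "Qp \<in> carrier_mat n (n - r)" "transpose_mat Qp * Qp = 1\<^sub>m (n - r)"
    and QQp: "transpose_mat Q * Qp = 0\<^sub>m r (n - r)" and "r \<le> n"
  shows "(transpose_mat Q @\<^sub>r transpose_mat Qp) * transpose_mat (transpose_mat Q @\<^sub>r transpose_mat Qp) = 1\<^sub>m n"
proof -
  let ?V = "transpose_mat Q @\<^sub>r transpose_mat Qp"
  have V: "?V \<in> carrier_mat n n"
    using carrier_append_rows[of "transpose_mat Q" r n "transpose_mat Qp" "n - r"] Q Qp \<open>r \<le> n\<close> by simp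
  have row: "Matrix.row ?V i = (if i < r then Matrix.col Q i else Matrix.col Qp (i - r))" if "i < n" for i
    using that Q Qp \<open>r \<le> n\<close> by (intro eq_vecI) (auto simp: append_rows_def)
  have QpQ: "transpose_mat Qp * Q = 0\<^sub>m (n - r) r"
    using arg_cong[OF QQp, of transpose_mat] transpose_mult[of "transpose_mat Q" r n Qp "n - r"] Q Qp by simp
  have entry: "scalar_prod (Matrix.col A i) (Matrix.col B j) = (transpose_mat A * B) $$ (i, j)"
    if "A \<in> carrier_mat n a" "B \<in> carrier_mat n b" "i < a" "j < b" for A B :: "real mat" and a b i j
    using that by simp
  show ?thesis
  proof (rule eq_matI)
    fix i j assume "i < dim_row (1\<^sub>m n :: real mat)" "j < dim_col (1\<^sub>m n :: real mat)"
    then have ij: "i < n" "j < n" by auto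
    have "(?V * transpose_mat ?V) $$ (i, j) = scalar_prod (Matrix.row ?V i) (Matrix.row ?V j)"
      using ij V by simp
    also have "\<dots> = (if i = j then 1 else 0)"
      unfolding row[OF ij(1)] row[OF ij(2)]
      using ij Q(2) Qp(2) QQp QpQ entry[OF Q(1) Q(1)] entry[OF Qp(1) Qp(1)] entry[OF Q(1) Qp(1)] entry[OF Qp(1) Q(1)]
      by (cases "i < r"; cases "j < r") auto
    finally show "(?V * transpose_mat ?V) $$ (i, j) = 1\<^sub>m n $$ (i, j)"
      using ij by simp
  qed (use V in auto)
qed

lemma four_block_eq_rect_diag:
  assumes "r < n" "n \<le> m"
  shows "four_block_mat (Sigma_lead r \<sigma>) (0\<^sub>m r (n - r)) (0\<^sub>m (m - r) r) (Sigma_perp r m n \<sigma>) =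
    rect_diag m n (\<lambda>i. \<sigma> (i + 1))"
  using assms
  by (intro eq_matI)
    (auto simp: Sigma_lead_def Sigma_perp_def rect_diag_def append_rows_def mat_diag_def)

text \<open>With \<open>E\<close> the orthogonal projector onto the complement of the range of \<open>X\<close>, the error is \<open>E M\<close>. Since \<open>M Z\<close>
  lies in the range of \<open>X\<close>, this equals \<open>E M J\<close>, where \<open>J\<close> is the complementary oblique projection. The
  transpose of \<open>Q\<close> annihilates \<open>J\<close>, so that only the trailing singular values of \<open>M\<close> survive in \<open>M J\<close>. The
  norms of the other factors are at most \<open>1\<close>, and that of \<open>J\<close> at most \<open>sqrt (1 + g)\<close>.\<close>

lemma low_rank_error_bound:
  assumes nrm: "nrm = spectral_norm \<or> nrm = frobenius_norm"
    and dims: "r < n" "n \<le> m"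
    and decreasing: "\<And>i j. i \<le> j \<Longrightarrow> j < n \<Longrightarrow> d j \<le> d i" and nonneg: "\<And>i. i < n \<Longrightarrow> 0 \<le> d i"
    and Q: "Q \<in> carrier_mat n r" "transpose_mat Q * Q = 1\<^sub>m r"
    and Qp: "Qp \<in> carrier_mat n (n - r)" "transpose_mat Qp * Qp = 1\<^sub>m (n - r)"
    and QQp: "transpose_mat Q * Qp = 0\<^sub>m r (n - r)"
    and U: "U \<in> carrier_mat m m" "transpose_mat U * U = 1\<^sub>m m"
    and M: "M = U * rect_diag m n d * (transpose_mat Q @\<^sub>r transpose_mat Qp)"
    and Z: "Z \<in> carrier_mat n l" "transpose_mat Z * Z = 1\<^sub>m l"
    and F: "F \<in> carrier_mat l r" "op_bound F g" "0 < g" "transpose_mat Q * (Z * F) = 1\<^sub>m r"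
    and X: "X \<in> carrier_mat m l" and MZ: "W \<in> carrier_mat l l" "M * Z = X * W"
  shows "nrm (M - X * (pseudo_inverse X * M)) \<le> sqrt (1 + g) * tau nrm (r + 1) M"
proof -
  let ?Vt = "transpose_mat Q @\<^sub>r transpose_mat Qp" and ?D = "rect_diag m n d"
  let ?D2 = "rect_diag m n (\<lambda>i. if r \<le> i then d i else 0)"
  let ?J = "1\<^sub>m n - Z * F * transpose_mat Q"
  have Vt: "?Vt \<in> carrier_mat n n"
    using carrier_append_rows[of "transpose_mat Q" r n "transpose_mat Qp" "n - r"] Q Qp dims by simp
  have V_orth: "?Vt * transpose_mat ?Vt = 1\<^sub>m n"
    by (rule append_rows_orthogonal[OF Q Qp QQp]) (use dims in simp)
  have UD: "U * ?D \<in> carrier_mat m n" using U by (rule_tac mult_carrier_mat) auto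
  have Mc: "M \<in> carrier_mat m n" unfolding M by (rule mult_carrier_mat[OF UD Vt])
  have ZF: "Z * F \<in> carrier_mat n r" using Z F by auto
  have ZFQ: "Z * F * transpose_mat Q \<in> carrier_mat n n"
    using mult_carrier_mat[OF ZF, of "transpose_mat Q" n] Q(1) by simp
  have J: "?J \<in> carrier_mat n n"
    by (rule minus_carrier_mat[OF ZFQ])
  define P where "P = X * pseudo_inverse X"
  note P = pseudo_inverse_projection[OF X, folded P_def]
  define E where "E = 1\<^sub>m m - P"
  have E: "E \<in> carrier_mat m m" unfolding E_def by (rule minus_carrier_mat[OF P(1)])
  have "E * E = E * 1\<^sub>m m - E * P"
    using mult_minus_distrib_mat[OF E one_carrier_mat P(1)] unfolding E_def .
  also have "E * P = 1\<^sub>m m * P - P * P"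
    using minus_mult_distrib_mat[OF one_carrier_mat P(1) P(1)] unfolding E_def .
  also have "\<dots> = 0\<^sub>m m m" using P(1,4) by simp
  finally have EE: "E * E = E" using E minus_zero_mat[OF E] by (simp add: right_mult_one_mat)
  have E_sym: "transpose_mat E = E"
    unfolding E_def using P(1,3) by (simp add: transpose_minus[of _ m m])
  have E_bound: "op_bound E 1" by (rule op_bound_projection[OF E EE E_sym])
  have EX: "E * X = 0\<^sub>m m l"
  proof -
    have "E * X = 1\<^sub>m m * X - P * X"
      using minus_mult_distrib_mat[OF one_carrier_mat P(1) X] unfolding E_def .
    then show ?thesis using P(2) X by simp
  qed
  have EM: "M - X * (pseudo_inverse X * M) = E * M"
  proof -
    have "pseudo_inverse X \<in> carrier_mat l m"
      using is_pseudo_inverse_pseudo_inverse[of X] X by (auto simp: is_pseudo_inverse_def)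
    then have "X * (pseudo_inverse X * M) = P * M"
      unfolding P_def using X Mc by (intro assoc_mult_mat[symmetric])
    moreover have "E * M = 1\<^sub>m m * M - P * M"
      using minus_mult_distrib_mat[OF one_carrier_mat P(1) Mc] unfolding E_def .
    ultimately show ?thesis using Mc by simp
  qed
  have EMZ: "E * M * (Z * F * transpose_mat Q) = 0\<^sub>m m n"
  proof -
    have "E * M * (Z * F * transpose_mat Q) = E * (M * (Z * (F * transpose_mat Q)))"
      using E Mc Z F Q by (simp add: assoc_mult_mat[of Z n l F r "transpose_mat Q" n] assoc_mult_mat[of E m m M n _ n])
    also have "M * (Z * (F * transpose_mat Q)) = M * Z * (F * transpose_mat Q)"
      using Mc Z F Q by (intro assoc_mult_mat[symmetric]) auto
    also have "\<dots> = X * (W * (F * transpose_mat Q))"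
      unfolding MZ(2) using X MZ(1) F Q by (intro assoc_mult_mat) auto
    also have "E * \<dots> = E * X * (W * (F * transpose_mat Q))"
      using E X MZ(1) F Q by (intro assoc_mult_mat[symmetric]) auto
    also have "\<dots> = 0\<^sub>m m n"
      unfolding EX using MZ(1) F Q by (intro left_mult_zero_mat) auto
    finally show ?thesis .
  qed
  have EMJ: "E * M = E * M * ?J"
  proof -
    have "E * M * ?J = E * M * 1\<^sub>m n - E * M * (Z * F * transpose_mat Q)"
      by (rule mult_minus_distrib_mat[OF mult_carrier_mat[OF E Mc] one_carrier_mat ZFQ])
    then show ?thesis
      unfolding EMZ using E Mc by (simp add: right_mult_one_mat[of _ m n] minus_zero_mat[of _ m n])
  qed
  have VJ: "?Vt * ?J \<in> carrier_mat n n" using Vt J by auto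
  have VJ_zero: "(?Vt * ?J) $$ (t, j) = 0" if "t < r" "j < n" for t j
  proof -
    have "transpose_mat Q * ?J = transpose_mat Q * 1\<^sub>m n - transpose_mat Q * (Z * F * transpose_mat Q)"
      by (rule mult_minus_distrib_mat[OF _ one_carrier_mat ZFQ]) (use Q in auto)
    also have "transpose_mat Q * (Z * F * transpose_mat Q) = transpose_mat Q * (Z * F) * transpose_mat Q"
      using Q ZF by (intro assoc_mult_mat[symmetric]) auto
    also have "transpose_mat Q * 1\<^sub>m n - transpose_mat Q * (Z * F) * transpose_mat Q = 0\<^sub>m r n"
      unfolding F(4) using Q by simp
    finally have QJ: "transpose_mat Q * ?J = 0\<^sub>m r n" .
    have "Matrix.row ?Vt t = Matrix.row (transpose_mat Q) t"
      using that Q Qp dims by (intro eq_vecI) (auto simp: append_rows_def)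
    then have "(?Vt * ?J) $$ (t, j) = (transpose_mat Q * ?J) $$ (t, j)"
      using that Vt J Q dims by simp
    then show ?thesis unfolding QJ using that by simp
  qed
  have DVJ: "?D * (?Vt * ?J) = ?D2 * (?Vt * ?J)"
  proof (rule eq_matI)
    fix i j assume "i < dim_row (?D2 * (?Vt * ?J))" "j < dim_col (?D2 * (?Vt * ?J))"
    then have ij: "i < m" "j < n" using VJ by (auto simp: rect_diag_def)
    then show "(?D * (?Vt * ?J)) $$ (i, j) = (?D2 * (?Vt * ?J)) $$ (i, j)"
      unfolding rect_diag_mult_index[OF VJ ij] using VJ_zero[of i j] by auto
  qed (use VJ in \<open>auto simp: rect_diag_def\<close>)
  have D2VJ: "?D2 * (?Vt * ?J) \<in> carrier_mat m n" by (rule mult_carrier_mat[OF rect_diag_carrier VJ])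
  have "M * ?J = U * (?D2 * (?Vt * ?J))"
  proof -
    have "M * ?J = U * ?D * (?Vt * ?J)"
      unfolding M using UD Vt J by (rule assoc_mult_mat)
    also have "\<dots> = U * (?D * (?Vt * ?J))"
      using U(1) rect_diag_carrier VJ by (rule assoc_mult_mat)
    finally show ?thesis unfolding DVJ .
  qed
  then have "E * M = E * (U * (?D2 * (?Vt * ?J)))"
    using EMJ assoc_mult_mat[OF E Mc J] by simp
  then have "nrm (M - X * (pseudo_inverse X * M)) = nrm (E * (U * (?D2 * (?Vt * ?J))))"
    unfolding EM by simp
  also have "\<dots> \<le> sqrt 1 * nrm (U * (?D2 * (?Vt * ?J)))"
    using mult_carrier_mat[OF U(1) D2VJ] by (intro nrm_mult_left[OF nrm E_bound _ E]) auto
  also have "\<dots> \<le> sqrt 1 * (sqrt 1 * nrm (?D2 * (?Vt * ?J)))"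
    by (intro mult_left_mono nrm_mult_left[OF nrm op_bound_isometry[OF U] _ U(1) D2VJ]) auto
  also have "\<dots> \<le> sqrt 1 * (sqrt 1 * (sqrt (1 * (1 + g)) * nrm ?D2))"
  proof (intro mult_left_mono nrm_mult_right[OF nrm _ _ rect_diag_carrier VJ])
    have "op_bound (transpose_mat (transpose_mat ?Vt)) 1"
      using V_orth Vt by (intro op_bound_isometry_transpose[of _ n n]) auto
    then show "op_bound (?Vt * ?J) (1 * (1 + g))"
      using op_bound_oblique_projection[OF Q Z(1) op_bound_isometry[OF Z] F] Vt J
      by (intro op_bound_mult[of _ _ _ _ n n n]) auto
  qed (use F(3) in auto)
  also have "\<dots> \<le> sqrt (1 + g) * tau nrm (r + 1) M"
    using nrm_rect_diag_le_tau[OF nrm dims(2,1) decreasing nonneg U, where V = "transpose_mat ?Vt"] V_orth Vt F(3)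
    unfolding M by (simp add: mult_left_mono)
  finally show ?thesis .
qed

section \<open>Transfer of the Gaussian bounds to the range finder\<close>

lemma full_rank_injective:
  assumes H: "H \<in> carrier_mat n l" and rank: "mat_rank H = l"
    and x: "x \<in> carrier_vec l" "H *\<^sub>v x = 0\<^sub>v n"
  shows "x = 0\<^sub>v l"
proof -
  obtain B C W where B: "B \<in> carrier_mat n l" and C: "C \<in> carrier_mat l l" and W: "W \<in> carrier_mat l l"
    and HBC: "H = B * C" and CW: "C * W = 1\<^sub>m l"
    and inj: "\<And>x. x \<in> carrier_vec l \<Longrightarrow> B *\<^sub>v x = 0\<^sub>v n \<Longrightarrow> x = 0\<^sub>v l"
    using rank_factorization[OF H] unfolding rank by blast
  have "B *\<^sub>v (C *\<^sub>v x) = 0\<^sub>v n"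
    using x assoc_mult_mat_vec[OF B C x(1)] by (simp add: HBC)
  then have "C *\<^sub>v x = 0\<^sub>v l"
    using C x(1) by (intro inj) auto
  then show ?thesis
    using mult_mat_vec_eq_0_if_mult_eq_1[OF W C mat_mult_left_right_inverse[OF C W CW] x(1)] by simp
qed

lemma orthonormal_columns_of_full_rank:
  assumes H: "H \<in> carrier_mat n l" and rank: "mat_rank H = l"
  obtains S where "S \<in> carrier_mat l l" "transpose_mat (H * S) * (H * S) = 1\<^sub>m l"
proof (rule orthonormal_columns_in_kernel[of "0\<^sub>m 0 l" 0 l H n l])
  show "x = 0\<^sub>v l" if "x \<in> carrier_vec l" "H *\<^sub>v x = 0\<^sub>v n" for x
    by (rule full_rank_injective[OF H rank that])
qed (use H that in auto)

text \<open>Submultiplicativity, applied to \<open>H = H H\<^sup>+ H\<close>.\<close>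

lemma one_le_cond_number:
  assumes H: "H \<in> carrier_mat n l" and rank: "mat_rank H = l" and "0 < l"
  shows "1 \<le> cond_number H"
proof -
  let ?Y = "pseudo_inverse H"
  have Y: "?Y \<in> carrier_mat l n" and HYH: "H * ?Y * H = H"
    using is_pseudo_inverse_pseudo_inverse[of H] H by (auto simp: is_pseudo_inverse_def)
  have "spectral_norm H \<noteq> 0"
  proof
    assume "spectral_norm H = 0"
    then have "nsq (H *\<^sub>v unit_vec l 0) \<le> 0 * nsq (unit_vec l 0 :: real Matrix.vec)"
      using op_boundD[OF op_bound_spectral_norm H unit_vec_carrier, of 0] by simp
    then have "nsq (H *\<^sub>v unit_vec l 0) = 0"
      using nsq_nonneg[of "H *\<^sub>v unit_vec l 0"] by linarith
    then have "H *\<^sub>v unit_vec l 0 = 0\<^sub>v n"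
      using nsq_eq_0_iff[of "H *\<^sub>v unit_vec l 0" n] mult_mat_vec_carrier[OF H unit_vec_carrier] by simp
    then have "unit_vec l 0 = (0\<^sub>v l :: real Matrix.vec)"
      by (rule full_rank_injective[OF H rank unit_vec_carrier])
    then show False
      using unit_vec_nonzero[OF \<open>0 < l\<close>] by blast
  qed
  then have pos: "0 < spectral_norm H"
    using spectral_norm_nonneg[of H] by linarith
  have "spectral_norm H = spectral_norm (H * ?Y * H)"
    by (simp add: HYH)
  also have "\<dots> \<le> sqrt ((spectral_norm (H * ?Y))\<^sup>2) * spectral_norm H"
    using H Y by (intro spectral_norm_mult_left[OF op_bound_spectral_norm]) auto
  also have "\<dots> = spectral_norm (H * ?Y) * spectral_norm H"
    by simp
  also have "spectral_norm (H * ?Y) \<le> sqrt ((spectral_norm H)\<^sup>2) * spectral_norm ?Y"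
    using H Y by (intro spectral_norm_mult_left[OF op_bound_spectral_norm]) auto
  finally have "spectral_norm H \<le> cond_number H * spectral_norm H"
    by (simp add: cond_number_def mult_right_mono)
  then show ?thesis using pos by simp
qed

lemma nsq_transpose_mult_vec:
  assumes "A \<in> carrier_mat r l" "x \<in> carrier_vec r"
  shows "nsq (transpose_mat A *\<^sub>v x) = image_sqn r l (\<lambda>i k. A $$ (i, k)) (\<lambda>i. x $ i)"
  using assms by (simp add: nsq_eq_sum image_sqn_def sqn_def scalar_prod_def atLeast0LessThan mult.commute)

lemma image_sqn_cong:
  assumes "\<And>i k. i < r \<Longrightarrow> k < l \<Longrightarrow> B i k = B' i k"
  shows "image_sqn r l B x = image_sqn r l B' x"
  unfolding image_sqn_def sqn_def using assms by (intro sum.cong refl arg_cong[where f = "\<lambda>u. u\<^sup>2"]) auto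

text \<open>The square matrix \<open>R = G Q\<close> satisfies \<open>G = R Q\<^sup>T\<close>, hence \<open>G Z = R (Q\<^sup>T Z)\<close>. If \<open>N\<close> is the pseudo inverse of \<open>G Z\<close>,
  then \<open>Q\<^sup>T Z N\<close> is a right inverse of \<open>R\<close> and so also a left inverse, that is, \<open>F = N R\<close> inverts \<open>Q\<^sup>T Z\<close>
  on the right. In this way the norm of \<open>F\<close> is controlled by \<open>G\<close> and \<open>Z\<close>, although
  \<open>Q\<close> is a nonlinear function of \<open>G\<close>.\<close>

lemma oblique_factor_exists:
  assumes G: "G \<in> carrier_mat r n" and Q: "Q \<in> carrier_mat n r" "transpose_mat Q * Q = 1\<^sub>m r"
    and GQ: "G = G * Q * transpose_mat Q" and Z: "Z \<in> carrier_mat n l"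
    and G_bound: "op_bound (transpose_mat G) \<beta>" "0 \<le> \<beta>"
    and GZ_bound: "\<And>x. x \<in> carrier_vec r \<Longrightarrow> \<delta> * nsq x \<le> nsq (transpose_mat (G * Z) *\<^sub>v x)" "0 < \<delta>"
  obtains F where "F \<in> carrier_mat l r" "op_bound F (\<beta> / \<delta>)" "transpose_mat Q * (Z * F) = 1\<^sub>m r"
proof -
  let ?A = "G * Z" and ?R = "G * Q"
  have A: "?A \<in> carrier_mat r l" using G Z by auto
  have At: "transpose_mat ?A \<in> carrier_mat l r" using A by auto
  have R: "?R \<in> carrier_mat r r" using G Q by auto
  have inj: "x = 0\<^sub>v r" if "x \<in> carrier_vec r" "transpose_mat ?A *\<^sub>v x = 0\<^sub>v l" for x
  proof -
    have "\<delta> * nsq x \<le> 0"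
      using GZ_bound(1)[OF that(1)] that(2) by simp
    then have "nsq x = 0"
      using \<open>0 < \<delta>\<close> nsq_nonneg[of x] by (simp add: mult_le_0_iff)
    then show ?thesis using nsq_eq_0_iff[OF that(1)] by simp
  qed
  obtain L where L: "L \<in> carrier_mat r l" "L * transpose_mat ?A = 1\<^sub>m r"
      "transpose_mat (transpose_mat ?A * L) = transpose_mat ?A * L"
    using left_inverse_symmetric_projection[OF At inj] by blast
  define N where "N = transpose_mat L"
  have N: "N \<in> carrier_mat l r" using L by (simp add: N_def)
  have AN: "?A * N = 1\<^sub>m r"
    using arg_cong[OF L(2), of transpose_mat] transpose_mult[OF L(1) At] by (simp add: N_def)
  have L_bound: "op_bound L (1 / \<delta>)"
  proof (rule op_boundI[OF L(1)])
    fix v :: "real Matrix.vec" assume v: "v \<in> carrier_vec l"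
    have Lv: "L *\<^sub>v v \<in> carrier_vec r" using L(1) v by auto
    have AL: "transpose_mat ?A * L \<in> carrier_mat l l" using At L(1) by (rule mult_carrier_mat)
    have "transpose_mat ?A * L * (transpose_mat ?A * L) = transpose_mat ?A * (L * (transpose_mat ?A * L))"
      using At L(1) AL by (rule assoc_mult_mat)
    also have "L * (transpose_mat ?A * L) = L * transpose_mat ?A * L"
      using L(1) At L(1) by (rule assoc_mult_mat[symmetric])
    finally have idem: "transpose_mat ?A * L * (transpose_mat ?A * L) = transpose_mat ?A * L"
      using L(1,2) by simp
    have "\<delta> * nsq (L *\<^sub>v v) \<le> nsq (transpose_mat ?A *\<^sub>v (L *\<^sub>v v))"
      by (rule GZ_bound(1)[OF Lv])
    also have "\<dots> = nsq (transpose_mat ?A * L *\<^sub>v v)"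
      using assoc_mult_mat_vec[OF At L(1) v] by simp
    also have "\<dots> \<le> 1 * nsq v"
      by (rule op_boundD[OF op_bound_projection[OF AL idem L(3)] AL v])
    finally show "nsq (L *\<^sub>v v) \<le> 1 / \<delta> * nsq v"
      using \<open>0 < \<delta>\<close> by (simp add: field_simps)
  qed
  have N_bound: "op_bound N (1 / \<delta>)"
    unfolding N_def using \<open>0 < \<delta>\<close> by (intro op_bound_transpose[OF L_bound]) simp
  have R_bound: "op_bound ?R (\<beta> * 1)"
    using op_bound_transpose[OF G_bound] by (intro op_bound_mult[OF _ op_bound_isometry[OF Q] G_bound(2) G Q(1)]) simp
  define F where "F = N * ?R"
  have F: "F \<in> carrier_mat l r" unfolding F_def using N R by (rule mult_carrier_mat)
  have "op_bound F (1 / \<delta> * (\<beta> * 1))"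
    unfolding F_def using \<open>0 < \<delta>\<close> by (intro op_bound_mult[OF N_bound R_bound _ N R]) simp
  then have F_bound: "op_bound F (\<beta> / \<delta>)" by simp
  have ZN: "Z * N \<in> carrier_mat n r" using Z N by (rule mult_carrier_mat)
  have QZN: "transpose_mat Q * (Z * N) \<in> carrier_mat r r"
    by (rule mult_carrier_mat[OF _ ZN]) (use Q(1) in simp)
  have "?R * (transpose_mat Q * (Z * N)) = ?R * transpose_mat Q * (Z * N)"
    using R Q ZN by (intro assoc_mult_mat[symmetric]) auto
  also have "\<dots> = ?A * N"
    unfolding GQ[symmetric] using G Z N by (rule assoc_mult_mat[symmetric])
  finally have "?R * (transpose_mat Q * (Z * N)) = 1\<^sub>m r"
    unfolding AN .
  then have "transpose_mat Q * (Z * N) * ?R = 1\<^sub>m r"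
    by (rule mat_mult_left_right_inverse[OF R QZN])
  moreover have "transpose_mat Q * (Z * F) = transpose_mat Q * (Z * N) * ?R"
  proof -
    have "Z * F = Z * N * ?R"
      unfolding F_def using Z N R by (rule assoc_mult_mat[symmetric])
    then show ?thesis
      using assoc_mult_mat[of "transpose_mat Q" r n "Z * N" r ?R r] Q(1) ZN R by simp
  qed
  ultimately show thesis using that F F_bound by simp
qed

lemma row_space_basis:
  assumes G: "G \<in> carrier_mat r n" and Q: "Q \<in> carrier_mat n r"
    and basis: "columns_orthonormal_basis Q (vec_space.row_space n G)"
  shows "transpose_mat Q * Q = 1\<^sub>m r" "G = G * Q * transpose_mat Q"
proof -
  interpret vec_space "TYPE(real)" n .
  show QQ: "transpose_mat Q * Q = 1\<^sub>m r"
    using basis orthonormal_columns_iff[OF Q] by (simp add: columns_orthonormal_basis_def)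
  have space: "col_space Q = row_space G"
    using basis Q by (simp add: columns_orthonormal_basis_def)
  have "Matrix.row G i = Q *\<^sub>v (transpose_mat Q *\<^sub>v Matrix.row G i)" if "i < r" for i
  proof -
    have "Matrix.row G i \<in> set (rows G)"
      using G that by (auto simp: rows_def)
    then have "Matrix.row G i \<in> row_space G"
      unfolding row_space_def using G rows_carrier[of G] in_own_span by blast
    then obtain y where y: "y \<in> carrier_vec r" "Q *\<^sub>v y = Matrix.row G i"
      unfolding space[symmetric] col_space_eq[OF Q] using Q by auto
    have "transpose_mat Q *\<^sub>v (Q *\<^sub>v y) = transpose_mat Q * Q *\<^sub>v y"
      using Q y(1) by (intro assoc_mult_mat_vec[symmetric]) auto
    then show ?thesis
      unfolding y(2)[symmetric] QQ using y(1) by simp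
  qed
  then have row: "Matrix.row G i = Q * transpose_mat Q *\<^sub>v Matrix.row G i" if "i < r" for i
    using that Q G assoc_mult_mat_vec[of Q n r "transpose_mat Q" n "Matrix.row G i"] by simp
  have QQt: "Q * transpose_mat Q \<in> carrier_mat n n" using Q by auto
  have sym: "transpose_mat (Q * transpose_mat Q) = Q * transpose_mat Q"
    using Q by (simp add: transpose_mult[of _ n r])
  have "G = G * (Q * transpose_mat Q)"
  proof (rule eq_matI)
    fix i j assume "i < dim_row (G * (Q * transpose_mat Q))" "j < dim_col (G * (Q * transpose_mat Q))"
    then have ij: "i < r" "j < n" using G Q by auto
    have "G $$ (i, j) = (Q * transpose_mat Q *\<^sub>v Matrix.row G i) $ j"
      using row[OF ij(1)] ij G by (metis carrier_matD index_row(1))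
    also have "\<dots> = scalar_prod (Matrix.row (Q * transpose_mat Q) j) (Matrix.row G i)"
      using ij QQt by (intro index_mult_mat_vec) auto
    also have "Matrix.row (Q * transpose_mat Q) j = Matrix.col (Q * transpose_mat Q) j"
      using ij QQt sym by (metis carrier_matD(2) row_transpose)
    also have "scalar_prod \<dots> (Matrix.row G i) = scalar_prod (Matrix.row G i) (Matrix.col (Q * transpose_mat Q) j)"
      using G QQt ij by (intro comm_scalar_prod[of _ n]) auto
    also have "\<dots> = (G * (Q * transpose_mat Q)) $$ (i, j)"
      using ij G QQt by (intro index_mult_mat(1)[symmetric]) auto
    finally show "G $$ (i, j) = (G * (Q * transpose_mat Q)) $$ (i, j)" .
  qed (use G Q in auto)
  then show "G = G * Q * transpose_mat Q"
    using assoc_mult_mat[of G r n Q r "transpose_mat Q" n] G Q by simp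
qed

lemma orthogonal_complement_basis:
  assumes G: "G \<in> carrier_mat r n" and Q: "Q \<in> carrier_mat n r" and Qp: "Qp \<in> carrier_mat n k"
    and basis: "columns_orthonormal_basis Q (vec_space.row_space n G)"
    and basis_p: "columns_orthonormal_basis Qp (vec_module.orthogonal_complement n (vec_space.row_space n G))"
  shows "transpose_mat Qp * Qp = 1\<^sub>m k" "transpose_mat Q * Qp = 0\<^sub>m r k"
proof -
  interpret vec_space "TYPE(real)" n .
  show "transpose_mat Qp * Qp = 1\<^sub>m k"
    using basis_p orthonormal_columns_iff[OF Qp] by (simp add: columns_orthonormal_basis_def)
  have col_in: "Matrix.col A j \<in> col_space A" if "A \<in> carrier_mat n a" "j < a" for A a j
  proof -
    have "set (cols A) \<subseteq> carrier_vec n" using that cols_dim by blast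
    then have "set (cols A) \<subseteq> col_space A"
      unfolding col_space_def by (rule in_own_span)
    then show ?thesis using that by (auto simp: cols_def)
  qed
  show "transpose_mat Q * Qp = 0\<^sub>m r k"
  proof (rule eq_matI)
    fix i j assume "i < dim_row (0\<^sub>m r k :: real mat)" "j < dim_col (0\<^sub>m r k :: real mat)"
    then have ij: "i < r" "j < k" by auto
    have "Matrix.col Q i \<in> row_space G"
      using col_in[OF Q ij(1)] basis Q by (simp add: columns_orthonormal_basis_def)
    moreover have "Matrix.col Qp j \<in> orthogonal_complement (row_space G)"
      using col_in[OF Qp ij(2)] basis_p Qp by (simp add: columns_orthonormal_basis_def)
    ultimately have "scalar_prod (Matrix.col Qp j) (Matrix.col Q i) = 0"
      by (auto simp: orthogonal_complement_def)
    then have "scalar_prod (Matrix.col Q i) (Matrix.col Qp j) = 0"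
      using comm_scalar_prod[of "Matrix.col Q i" n "Matrix.col Qp j"] Q Qp ij by simp
    then show "(transpose_mat Q * Qp) $$ (i, j) = 0\<^sub>m r k $$ (i, j)"
      using ij Q Qp by simp
  qed (use Q Qp in auto)
qed

lemma mat_inverse_invertible:
  fixes T :: "real mat"
  assumes T: "T \<in> carrier_mat l l" "invertible_mat T"
  shows "the (mat_inverse T) \<in> carrier_mat l l" "the (mat_inverse T) * T = 1\<^sub>m l"
proof -
  obtain B where B: "T * B = 1\<^sub>m l" "B * T = 1\<^sub>m (dim_row B)"
    using T by (auto simp: invertible_mat_def inverts_mat_def)
  have "dim_row B = l" "dim_col B = l"
    using T arg_cong[OF B(1), of dim_col] arg_cong[OF B(2), of dim_col] by auto
  then have "T \<in> Units (ring_mat TYPE(real) l ())"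
    using T B unfolding Units_def ring_mat_def by (auto intro!: bexI[of _ B])
  then obtain B' where "mat_inverse T = Some B'"
    using mat_inverse(1)[OF T(1), where b = "()"] by (cases "mat_inverse T") auto
  then show "the (mat_inverse T) \<in> carrier_mat l l" "the (mat_inverse T) * T = 1\<^sub>m l"
    using mat_inverse(2)[OF T(1)] by auto
qed

lemma tau_nonneg:
  assumes "nrm = spectral_norm \<or> nrm = frobenius_norm" "0 < k"
  shows "0 \<le> tau nrm k M"
  unfolding tau_def
proof (rule cInf_greatest)
  show "{nrm (M - N) |N. N \<in> carrier_mat (dim_row M) (dim_col M) \<and> mat_rank N < k} \<noteq> {}"
    using assms(2) by (auto intro!: exI[of _ "0\<^sub>m (dim_row M) (dim_col M)"] simp: vec_space.rank_0I)
qed (use assms(1) in auto)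

theorem theorem9p1:
  fixes P :: "'a measure"
    and r l m n :: nat
    and \<sigma> :: "nat \<Rightarrow> real"
    and G Q Qp U T M X Y :: "'a \<Rightarrow> real mat"
    and H :: "real mat"
    and nrm :: "real mat \<Rightarrow> real"
  assumes P: "prob_space P"
    and nrm: "nrm = spectral_norm \<or> nrm = frobenius_norm"
    and dims: "0 < r" "0 < l" "0 < m" "0 < n" "r < n" "n \<le> m" "36 * r < n" "22 * (r - 1) < l"
      "r \<le> l" "l < min m n"
    and \<sigma>_decreasing: "\<And>i j. 1 \<le> i \<Longrightarrow> i \<le> j \<Longrightarrow> j \<le> n \<Longrightarrow> \<sigma> j \<le> \<sigma> i"
    and \<sigma>_nonneg: "0 \<le> \<sigma> n"
    and \<sigma>_pos: "0 < \<sigma> r"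
    and G: "prob_space.gaussian_matrix P r n G"
    and Q_dim: "\<And>\<omega>. \<omega> \<in> space P \<Longrightarrow> Q \<omega> \<in> carrier_mat n r"
    and Qp_dim: "\<And>\<omega>. \<omega> \<in> space P \<Longrightarrow> Qp \<omega> \<in> carrier_mat n (n - r)"
    and Q: "AE \<omega> in P. columns_orthonormal_basis (Q \<omega>) (vec_space.row_space n (G \<omega>))"
    and Qp: "AE \<omega> in P. columns_orthonormal_basis (Qp \<omega>)
               (vec_module.orthogonal_complement n (vec_space.row_space n (G \<omega>)))"
    and U_dim: "\<And>\<omega>. \<omega> \<in> space P \<Longrightarrow> U \<omega> \<in> carrier_mat m m"
    and U: "\<And>\<omega>. \<omega> \<in> space P \<Longrightarrow> orthonormal_columns (U \<omega>)"
    and M: "\<And>\<omega>. \<omega> \<in> space P \<Longrightarrow>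
              M \<omega> = U \<omega>
                * four_block_mat (Sigma_lead r \<sigma>) (0\<^sub>m r (n - r))
                                 (0\<^sub>m (m - r) r) (Sigma_perp r m n \<sigma>)
                * (transpose_mat (Q \<omega>) @\<^sub>r transpose_mat (Qp \<omega>))"
    and H_dim: "H \<in> carrier_mat n l"
    and T_dim: "\<And>\<omega>. \<omega> \<in> space P \<Longrightarrow> T \<omega> \<in> carrier_mat l l"
    and T: "\<And>\<omega>. \<omega> \<in> space P \<Longrightarrow> invertible_mat (T \<omega>)"
    and X: "\<And>\<omega>. \<omega> \<in> space P \<Longrightarrow> X \<omega> = M \<omega> * H * the (mat_inverse (T \<omega>))"
    and Y: "\<And>\<omega>. \<omega> \<in> space P \<Longrightarrow> Y \<omega> = pseudo_inverse (X \<omega>) * M \<omega>"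
  shows "(orthonormal_columns H \<longrightarrow>
            prob_space.holds_with_prob_at_least P
              (1 - exp (- (real n / 72)) - exp (- ((real l - real r) / 20)))
              (\<lambda>\<omega>. nrm (M \<omega> - X \<omega> * Y \<omega>) \<le> sqrt (1 + 16 * real n / real l) * tau nrm (r + 1) (M \<omega>)))
       \<and> (mat_rank H = l \<longrightarrow>
            prob_space.holds_with_prob_at_least P
              (1 - exp (- (real n / 72)) - exp (- ((real l - real r) / 20)))
              (\<lambda>\<omega>. nrm (M \<omega> - X \<omega> * Y \<omega>)
                 \<le> sqrt (1 + 16 * (cond_number H)\<^sup>2 * real n / real l) * tau nrm (r + 1) (M \<omega>)))"
proof -
  interpret prob_space P by (rule P)
  let ?p = "1 - exp (- (real n / 72)) - exp (- ((real l - real r) / 20))"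
  let ?D = "rect_diag m n (\<lambda>i. \<sigma> (i + 1))"
  have Gc: "G \<omega> \<in> carrier_mat r n" if "\<omega> \<in> space P" for \<omega>
    using G that by (auto simp: gaussian_matrix_def)
  have indep: "indep_vars (\<lambda>_. borel) (\<lambda>ij \<omega>. G \<omega> $$ ij) ({..<r} \<times> {..<n})"
    and normal: "\<And>i j. i < r \<Longrightarrow> j < n \<Longrightarrow> distributed P lborel (\<lambda>\<omega>. G \<omega> $$ (i, j)) std_normal_density"
    using G by (auto simp: gaussian_matrix_def)
  have main: "holds_with_prob_at_least ?p (\<lambda>\<omega>. nrm (M \<omega> - X \<omega> * Y \<omega>) \<le>
      sqrt (1 + 16 * real n / real l) * tau nrm (r + 1) (M \<omega>))"
    if S: "S \<in> carrier_mat l l" and HS: "transpose_mat (H * S) * (H * S) = 1\<^sub>m l" for S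
  proof -
    \<comment> \<open>The projector onto the range of \<open>M H\<close> does not change when \<open>H\<close> is multiplied by an
      invertible matrix, so \<open>Z\<close> replaces \<open>H\<close>. Part (i) is the case that \<open>S\<close> is the identity.\<close>
    define Z where "Z = H * S"
    have Z: "Z \<in> carrier_mat n l" "transpose_mat Z * Z = 1\<^sub>m l"
      using H_dim S HS by (auto simp: Z_def)
    have Z_sum: "(\<Sum>j<n. Z $$ (j, k) * Z $$ (j, k')) = (if k = k' then 1 else 0)" if "k < l" "k' < l" for k k'
    proof -
      have "(\<Sum>j<n. Z $$ (j, k) * Z $$ (j, k')) = (transpose_mat Z * Z) $$ (k, k')"
        using that Z(1) by (simp add: scalar_prod_def atLeast0LessThan)
      then show ?thesis unfolding Z(2) using that by simp
    qed
    obtain E where E: "E \<in> events" and prob_E: "?p \<le> prob E"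
      and upper: "\<And>\<omega> x. \<omega> \<in> E \<Longrightarrow> image_sqn r n (\<lambda>i j. G \<omega> $$ (i, j)) x \<le> 16 / 9 * real n * sqn r x"
      and lower: "\<And>\<omega> x. \<omega> \<in> E \<Longrightarrow> real l / 9 * sqn r x \<le>
        image_sqn r l (\<lambda>i k. \<Sum>j<n. G \<omega> $$ (i, j) * Z $$ (j, k)) x"
      using gaussian_conditioning[OF indep normal Z_sum dims(1,7,8)] by blast
    have "AE \<omega> in P. columns_orthonormal_basis (Q \<omega>) (vec_space.row_space n (G \<omega>)) \<and>
        columns_orthonormal_basis (Qp \<omega>) (vec_module.orthogonal_complement n (vec_space.row_space n (G \<omega>)))"
      using Q Qp by eventually_elim simp
    then obtain N where N: "N \<in> null_sets P" and bases: "\<And>\<omega>. \<omega> \<in> space P - N \<Longrightarrow>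
        columns_orthonormal_basis (Q \<omega>) (vec_space.row_space n (G \<omega>)) \<and>
        columns_orthonormal_basis (Qp \<omega>) (vec_module.orthogonal_complement n (vec_space.row_space n (G \<omega>)))"
      by (rule AE_E3) blast
    have bound: "nrm (M \<omega> - X \<omega> * Y \<omega>) \<le> sqrt (1 + 16 * real n / real l) * tau nrm (r + 1) (M \<omega>)"
      if \<omega>: "\<omega> \<in> E - N" for \<omega>
    proof -
      have sp: "\<omega> \<in> space P" using \<omega> E sets.sets_into_space by blast
      then have "\<omega> \<in> space P - N" using \<omega> by blast
      note basis = bases[OF this, THEN conjunct1] and basis_p = bases[OF this, THEN conjunct2]
      note Q' = Q_dim[OF sp] row_space_basis[OF Gc[OF sp] Q_dim[OF sp] basis]
      note Qp' = orthogonal_complement_basis[OF Gc[OF sp] Q_dim[OF sp] Qp_dim[OF sp] basis basis_p]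
      have U': "transpose_mat (U \<omega>) * U \<omega> = 1\<^sub>m m"
        using orthonormal_columns_iff[OF U_dim[OF sp]] U[OF sp] by simp
      have M': "M \<omega> = U \<omega> * ?D * (transpose_mat (Q \<omega>) @\<^sub>r transpose_mat (Qp \<omega>))"
        using M[OF sp] four_block_eq_rect_diag[OF dims(5,6), of \<sigma>] by simp
      have Vt: "transpose_mat (Q \<omega>) @\<^sub>r transpose_mat (Qp \<omega>) \<in> carrier_mat n n"
        using carrier_append_rows[of "transpose_mat (Q \<omega>)" r n "transpose_mat (Qp \<omega>)" "n - r"]
          Q_dim[OF sp] Qp_dim[OF sp] dims by simp
      have Mc: "M \<omega> \<in> carrier_mat m n"
        unfolding M' by (intro mult_carrier_mat[OF mult_carrier_mat[OF U_dim[OF sp] rect_diag_carrier] Vt])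
      let ?Ti = "the (mat_inverse (T \<omega>))"
      note Ti = mat_inverse_invertible[OF T_dim[OF sp] T[OF sp]]
      have MH: "M \<omega> * H \<in> carrier_mat m l" using Mc H_dim by (rule mult_carrier_mat)
      have Xc: "X \<omega> \<in> carrier_mat m l" unfolding X[OF sp] using MH Ti(1) by (rule mult_carrier_mat)
      have TS: "T \<omega> * S \<in> carrier_mat l l" using T_dim[OF sp] S by (rule mult_carrier_mat)
      have "X \<omega> * (T \<omega> * S) = M \<omega> * H * (?Ti * (T \<omega> * S))"
        unfolding X[OF sp] using MH Ti(1) TS by (rule assoc_mult_mat)
      also have "?Ti * (T \<omega> * S) = S"
        using assoc_mult_mat[OF Ti(1) T_dim[OF sp] S] Ti(2) S by simp
      also have "M \<omega> * H * S = M \<omega> * Z"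
        unfolding Z_def using Mc H_dim S by (rule assoc_mult_mat)
      finally have MZ: "M \<omega> * Z = X \<omega> * (T \<omega> * S)" ..
      have "op_bound (transpose_mat (G \<omega>)) (16 / 9 * real n)"
      proof (rule op_boundI)
        show "transpose_mat (G \<omega>) \<in> carrier_mat n r" using Gc[OF sp] by simp
        fix x :: "real Matrix.vec" assume x: "x \<in> carrier_vec r"
        show "nsq (transpose_mat (G \<omega>) *\<^sub>v x) \<le> 16 / 9 * real n * nsq x"
          using upper[of \<omega> "\<lambda>i. x $ i"] \<omega> x
          unfolding nsq_transpose_mult_vec[OF Gc[OF sp] x] by (simp add: nsq_eq_sum sqn_def)
      qed
      moreover have "real l / 9 * nsq x \<le> nsq (transpose_mat (G \<omega> * Z) *\<^sub>v x)" if x: "x \<in> carrier_vec r" for x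
      proof -
        have "image_sqn r l (\<lambda>i k. (G \<omega> * Z) $$ (i, k)) (\<lambda>i. x $ i) =
            image_sqn r l (\<lambda>i k. \<Sum>j<n. G \<omega> $$ (i, j) * Z $$ (j, k)) (\<lambda>i. x $ i)"
          using Gc[OF sp] Z(1) by (intro image_sqn_cong) (simp add: scalar_prod_def atLeast0LessThan)
        then show ?thesis
          using lower[of \<omega> "\<lambda>i. x $ i"] \<omega> x
          unfolding nsq_transpose_mult_vec[OF mult_carrier_mat[OF Gc[OF sp] Z(1)] x]
          by (simp add: nsq_eq_sum sqn_def)
      qed
      ultimately obtain F where F: "F \<in> carrier_mat l r" "op_bound F (16 / 9 * real n / (real l / 9))"
          "transpose_mat (Q \<omega>) * (Z * F) = 1\<^sub>m r"
        using oblique_factor_exists[OF Gc[OF sp] Q' Z(1), of "16 / 9 * real n" "real l / 9"] dims by auto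
      have ratio: "16 / 9 * real n / (real l / 9) = 16 * real n / real l"
        by simp
      have "nrm (M \<omega> - X \<omega> * (pseudo_inverse (X \<omega>) * M \<omega>)) \<le>
          sqrt (1 + 16 * real n / real l) * tau nrm (r + 1) (M \<omega>)"
      proof (rule low_rank_error_bound[OF nrm dims(5,6) _ _ Q'(1,2) Qp_dim[OF sp] Qp' U_dim[OF sp] U' M' Z
            F(1) F(2)[unfolded ratio] _ F(3) Xc TS MZ])
        show "\<sigma> (j + 1) \<le> \<sigma> (i + 1)" if "i \<le> j" "j < n" for i j
          using that by (intro \<sigma>_decreasing) auto
        show "0 \<le> \<sigma> (i + 1)" if "i < n" for i
          using that \<sigma>_decreasing[of "i + 1" n] \<sigma>_nonneg by simp
      qed (use dims in simp)
      then show ?thesis unfolding Y[OF sp] .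
    qed
    show ?thesis
      unfolding holds_with_prob_at_least_def
    proof (intro bexI[of _ "E - N"] conjI ballI)
      show "E - N \<in> events" using E N by auto
      show "?p \<le> prob (E - N)" using prob_E measure_Diff_null_set[OF E N] by simp
    qed (rule bound)
  qed
  show ?thesis
  proof (intro conjI impI)
    assume "orthonormal_columns H"
    then show "holds_with_prob_at_least ?p (\<lambda>\<omega>. nrm (M \<omega> - X \<omega> * Y \<omega>) \<le>
        sqrt (1 + 16 * real n / real l) * tau nrm (r + 1) (M \<omega>))"
      using main[of "1\<^sub>m l"] orthonormal_columns_iff[OF H_dim] H_dim by simp
  next
    assume rank: "mat_rank H = l"
    obtain S where S: "S \<in> carrier_mat l l" "transpose_mat (H * S) * (H * S) = 1\<^sub>m l"
      using orthonormal_columns_of_full_rank[OF H_dim rank] by blast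
    have "1 \<le> (cond_number H)\<^sup>2"
      using one_le_cond_number[OF H_dim rank dims(2)] by (rule one_le_power)
    then have "1 * (16 * real n / real l) \<le> (cond_number H)\<^sup>2 * (16 * real n / real l)"
      by (intro mult_right_mono) auto
    then have "sqrt (1 + 16 * real n / real l) \<le> sqrt (1 + 16 * (cond_number H)\<^sup>2 * real n / real l)"
      by (simp add: mult_ac)
    then have "sqrt (1 + 16 * real n / real l) * tau nrm (r + 1) (M \<omega>) \<le>
        sqrt (1 + 16 * (cond_number H)\<^sup>2 * real n / real l) * tau nrm (r + 1) (M \<omega>)" for \<omega>
      using tau_nonneg[OF nrm, of "r + 1" "M \<omega>"] by (intro mult_right_mono) auto
    then show "holds_with_prob_at_least ?p (\<lambda>\<omega>. nrm (M \<omega> - X \<omega> * Y \<omega>) \<le>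
        sqrt (1 + 16 * (cond_number H)\<^sup>2 * real n / real l) * tau nrm (r + 1) (M \<omega>))"
      using main[OF S] unfolding holds_with_prob_at_least_def by (meson order_trans)
  qed
qed

end
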